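(* Let $\gamma\in A_1^{\rm loc}(\mathbb{R}^{n+1})$, let $\lambda=2^{-k_0}$ with $k_0\in\mathbb{Z}_+$, and write $\widetilde{Q}:=(1+\lambda)Q$ for cubes $Q\subset\mathbb{R}^n$. Then there exist constants $c_1=c_1(n,C_\gamma)\ge1$ and $c_2=c_2(n,C_\gamma)\ge1$ such that for every function $f\in W^1_1(\mathbb{R}^{n+1}_+,\gamma)$, with trace $\varphi=\operatorname{tr}|_{t=0}f$ on $\mathbb{R}^n$, there exists a system of tilings $T=\{T^s\}_{s=0}^\infty(c_1,c_2)$ of $\mathbb{R}^n$, admissible for the weight $\gamma$, such that $$\sum_{m\in\mathbb{Z}^n}\widehat{\gamma}_{0,m}\|\varphi|L_1(Q_{0,m})\|+\sum_{s=1}^\infty\sum_{\alpha\in\widetilde{A}^s}\widehat{\gamma}^s_\alpha\int_{\widetilde{Q}^s_\alpha}|\varphi^s_\alpha-\varphi(x)|\,dx\le C\,\|f|W^1_1(\mathbb{R}^{n+1}_+,\gamma)\|,$$ where the constant $C$ depends only on $n,C_\gamma,\lambda,c_1,c_2$.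
   Context: $n\in\mathbb{N}$ is fixed; points of $\mathbb{R}^{n+1}$ are $(x,t)$, $x\in\mathbb{R}^n$, $t\in\mathbb{R}$; $\mathbb{R}^{n+1}_+=\mathbb{R}^n\times(0,\infty)$; $\mathbb{Z}_+=\{0,1,2,\dots\}$. Cubes have sides parallel to the axes; $r(Q)$ is the side length; $cQ$ is the cube concentric with $Q$ of side length $c\,r(Q)$. For $k\in\mathbb{Z}_+$, $m\in\mathbb{Z}^n$, $Q_{k,m}=\prod_{i=1}^n(\frac{m_i}{2^k},\frac{m_i+1}{2^k})$ (open dyadic cube), $\overline{Q}_{k,m}$ is its closure. A weight is a function $\gamma\in L_1^{\rm loc}(\mathbb{R}^{n+1})$ positive a.e.; $\gamma\in A_1^{\rm loc}(\mathbb{R}^{n+1})$ means that there is a constant $C_\gamma\ge1$ with $\frac1{|Q|}\iint_Q\gamma\,dx\,dt\le C_\gamma\operatorname{ess\,inf}_Q\gamma$ for every cube $Q\subset\mathbb{R}^{n+1}$ with $r(Q)\le1$. $W^1_1(\mathbb{R}^{n+1}_+,\gamma)$ is the space of locally integrable $f$ on $\mathbb{R}^{n+1}_+$ (with generalized first-order derivatives) with finite norm $\sum_{|\alpha|\le1}\|\gamma D^\alpha f|L_1(\mathbb{R}^{n+1}_+)\|$. The trace $\varphi=\operatorname{tr}|_{t=0}f\in L_1^{\rm loc}(\mathbb{R}^n)$ is the function such that $\int_Q|\varphi(x)-f(x,t)|\,dx\to0$ as $t\to+0$ for every open cube $Q\subset\mathbb{R}^n$ (every $f\in W^1_1(\mathbb{R}^{n+1}_+,\gamma)$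 has a trace). Tilings. A tiling of $\mathbb{R}^n$ is a family $\{\overline{Q}_\alpha\}_{\alpha\in A}$, $A\subset\mathbb{Z}_+\times\mathbb{Z}^n$, of closed dyadic cubes with pairwise disjoint interiors whose union is $\mathbb{R}^n$. A tiling $T'$ succeeds $T$ ($T'\succ T$) if each cube of $T'$ is contained in some cube of $T$. A system of tilings is a sequence $T=\{T^s\}_{s=0}^\infty$, $T^s=\{\overline{Q}^s_\alpha\}_{\alpha\in A^s}$, with $T^{s+1}\succ T^s$; here $Q^s_\alpha=Q_{k,m}$ if $\alpha=(k,m)$. The set $\widetilde{A}$. For a tiling $\{\overline{Q}_\alpha\}_{\alpha\in A}$ fix an enumeration $\alpha_1,\alpha_2,\dots$ of $A$, and run through the indices in this order, discarding $\alpha_i$ if $\widetilde{Q}_{\alpha_i}$ is contained in the union of $\widetilde{Q}_\alpha$ over all other indices $\alpha$ not yet discarded. $\widetilde{A}\subset A$ is the set of indices never discarded. $\widetilde{A}^s$ is the set obtained in this way from $T^s$. Weights and means. $\widehat{\gamma}_{k,m}:=\frac1{|\Pi_{k,m}|}\iint_{\Pi_{k,m}}\gamma\,dx\,dt$ with $\Pi_{k,m}=Q_{k,m}\times(0,r(Q_{k,m}))$; $\widehat{\gamma}^s_\alpha:=\widehat{\gamma}_{k,m}$ for $\alpha=(k,m)\in A^s$; $\varphi^s_\alpha:=\frac1{|\widetilde{Q}^s_\alpha|}\int_{\widetilde{Q}^s_\alpha}\varphi(x)\,dx$. Admissibility. For $c_1,c_2\ge1$, a system of tilings $T=\{T^s\}_{s=0}^\infty(c_1,c_2)$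 is admissible for $\gamma$ if for each $s\in\mathbb{Z}_+$: (1) if $\alpha,\alpha'\in A^s$ and $\widetilde{Q}^s_\alpha\cap\widetilde{Q}^s_{\alpha'}\ne\varnothing$, then $\widehat{\gamma}^s_\alpha\le c_1\widehat{\gamma}^s_{\alpha'}$; (2) if $\alpha\in A^s$, $\alpha'\in A^{s+1}$ and $Q^{s+1}_{\alpha'}\subset Q^s_\alpha$, then $\widehat{\gamma}^s_\alpha\le c_2\widehat{\gamma}^{s+1}_{\alpha'}$ and $\widehat{\gamma}^{s+1}_{\alpha'}\le c_2\widehat{\gamma}^s_\alpha$; (3) for any $x\in\mathbb{R}^n$, $\max\{r(Q^{s+1}_{\alpha'}):\alpha'\in A^{s+1},\,x\in\widetilde{Q}^{s+1}_{\alpha'}\}\le\frac12\min\{r(Q^s_\alpha):\alpha\in A^s,\,x\in\widetilde{Q}^s_\alpha\}$; (4) $r(Q^s_\alpha)\ge2^{-l_s}$ for all $\alpha\in A^s$, for some strictly increasing sequence $\{l_j\}_{j=0}^\infty$ of nonnegative integers with $l_0=0$. *)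

theory Defs
  imports "HOL-Analysis.Analysis" "HOL-Probability.Essential_Supremum"
begin

section \<open>Local integrability, cubes and weights\<close>

definition locally_L1 :: "'a::euclidean_space set \<Rightarrow> ('a \<Rightarrow> real) \<Rightarrow> bool" where
  "locally_L1 U f \<longleftrightarrow> (\<forall>K. compact K \<and> K \<subseteq> U \<longrightarrow> set_integrable lebesgue K f)"

definition open_cube :: "'a::euclidean_space \<Rightarrow> real \<Rightarrow> 'a set" where
  "open_cube c r = box (c - (r / 2) *\<^sub>R One) (c + (r / 2) *\<^sub>R One)"

definition mean :: "'a::euclidean_space set \<Rightarrow> ('a \<Rightarrow> real) \<Rightarrow> real" where
  "mean Q f = (LINT x:Q|lebesgue. f x) / measure lebesgue Q"

definition ess_inf :: "'a::euclidean_space set \<Rightarrow> ('a \<Rightarrow> real) \<Rightarrow> ereal" where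
  "ess_inf Q f = - esssup (lebesgue_on Q) (\<lambda>x. - ereal (f x))"

definition weight :: "('a::euclidean_space \<Rightarrow> real) \<Rightarrow> bool" where
  "weight \<gamma> \<longleftrightarrow> locally_L1 UNIV \<gamma> \<and> (AE z in lebesgue. 0 < \<gamma> z)"

definition A1_loc :: "real \<Rightarrow> ('a::euclidean_space \<Rightarrow> real) \<Rightarrow> bool" where
  "A1_loc C \<gamma> \<longleftrightarrow> weight \<gamma> \<and> 1 \<le> C \<and>
     (\<forall>c r. 0 < r \<and> r \<le> 1 \<longrightarrow>
        ereal (mean (open_cube c r) \<gamma>) \<le> ereal C * ess_inf (open_cube c r) \<gamma>)"

section \<open>The weighted Sobolev space on the upper half-space and traces\<close>

text \<open>Points of the (n+1)-dimensional space are pairs (x, t).\<close>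

definition upper_half :: "((real^'n) \<times> real) set" where
  "upper_half = UNIV \<times> {0<..}"

primrec Ck :: "nat \<Rightarrow> ('a::euclidean_space \<Rightarrow> real) \<Rightarrow> bool" where
  "Ck 0 \<psi> \<longleftrightarrow> continuous_on UNIV \<psi>"
| "Ck (Suc k) \<psi> \<longleftrightarrow> (\<forall>z. \<psi> differentiable (at z)) \<and>
     (\<forall>b\<in>Basis. Ck k (\<lambda>z. frechet_derivative \<psi> (at z) b))"

definition test_function :: "'a::euclidean_space set \<Rightarrow> ('a \<Rightarrow> real) \<Rightarrow> bool" where
  "test_function U \<psi> \<longleftrightarrow> (\<forall>k. Ck k \<psi>) \<and>
     compact (closure {z. \<psi> z \<noteq> 0}) \<and> closure {z. \<psi> z \<noteq> 0} \<subseteq> U"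

definition is_weak_deriv ::
  "'a::euclidean_space set \<Rightarrow> 'a \<Rightarrow> ('a \<Rightarrow> real) \<Rightarrow> ('a \<Rightarrow> real) \<Rightarrow> bool" where
  "is_weak_deriv U b f g \<longleftrightarrow> locally_L1 U g \<and>
     (\<forall>\<psi>. test_function U \<psi> \<longrightarrow>
        (LINT z:U|lebesgue. f z * frechet_derivative \<psi> (at z) b) =
        - (LINT z:U|lebesgue. g z * \<psi> z))"

text \<open>Unique up to a null subset of U when it exists.\<close>

definition weak_deriv ::
  "'a::euclidean_space set \<Rightarrow> 'a \<Rightarrow> ('a \<Rightarrow> real) \<Rightarrow> 'a \<Rightarrow> real" where
  "weak_deriv U b f = (SOME g. is_weak_deriv U b f g)"

definition L1_norm :: "'a::euclidean_space set \<Rightarrow> ('a \<Rightarrow> real) \<Rightarrow> ennreal" where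
  "L1_norm U f = (\<integral>\<^sup>+z\<in>U. ennreal \<bar>f z\<bar> \<partial>lebesgue)"

definition W11_norm ::
  "((real^'n) \<times> real \<Rightarrow> real) \<Rightarrow> ((real^'n) \<times> real \<Rightarrow> real) \<Rightarrow> ennreal" where
  "W11_norm \<gamma> f = L1_norm upper_half (\<lambda>z. \<gamma> z * f z) +
     (\<Sum>b\<in>Basis. L1_norm upper_half (\<lambda>z. \<gamma> z * weak_deriv upper_half b f z))"

definition W11 ::
  "((real^'n) \<times> real \<Rightarrow> real) \<Rightarrow> ((real^'n) \<times> real \<Rightarrow> real) set" where
  "W11 \<gamma> = {f. locally_L1 upper_half f \<and>
     (\<forall>b\<in>Basis. \<exists>g. is_weak_deriv upper_half b f g) \<and> W11_norm \<gamma> f < \<infinity>}"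

text \<open>
  Elements of the Sobolev space are determined only up to null sets, whereas the slices f(., t)
  are not. Hence the slices are those of some representative g of the class of f.
\<close>

definition is_trace :: "((real^'n) \<times> real \<Rightarrow> real) \<Rightarrow> (real^'n \<Rightarrow> real) \<Rightarrow> bool" where
  "is_trace f \<phi> \<longleftrightarrow> locally_L1 UNIV \<phi> \<and>
     (\<exists>g. (AE z in lebesgue. z \<in> upper_half \<longrightarrow> g z = f z) \<and>
       (\<forall>c r. 0 < r \<longrightarrow>
         (\<forall>\<^sub>F t in at_right 0. set_integrable lebesgue (open_cube c r) (\<lambda>x. \<phi> x - g (x, t))) \<and>
         ((\<lambda>t. LINT x:open_cube c r|lebesgue. \<bar>\<phi> x - g (x, t)\<bar>) \<longlongrightarrow> 0) (at_right 0)))"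

section \<open>Dyadic cubes and tilings\<close>

type_synonym 'n idx = "nat \<times> (int^'n)"

definition side :: "'n idx \<Rightarrow> real" where
  "side \<alpha> = 1 / 2 ^ fst \<alpha>"

definition dyadic :: "'n idx \<Rightarrow> (real^'n) set" where
  "dyadic \<alpha> = box (\<chi> i. of_int (snd \<alpha> $ i) / 2 ^ fst \<alpha>)
                  (\<chi> i. (of_int (snd \<alpha> $ i) + 1) / 2 ^ fst \<alpha>)"

text \<open>The cube c Q, where Q is the dyadic cube with index \<open>\<alpha>\<close>.\<close>

definition dilate :: "real \<Rightarrow> 'n idx \<Rightarrow> (real^'n) set" where
  "dilate c \<alpha> = open_cube (\<chi> i. (of_int (snd \<alpha> $ i) + 1 / 2) / 2 ^ fst \<alpha>) (c * side \<alpha>)"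

lemma dilate_1: "dilate 1 \<alpha> = dyadic (\<alpha> :: 'n::finite idx)"
proof -
  have "(One :: real^'n) $ i = 1" for i
    using inner_sum_Basis[of "axis i (1::real)"] by (simp add: inner_axis axis_in_Basis_iff)
  then show ?thesis
    unfolding dilate_def dyadic_def open_cube_def side_def
    by (intro arg_cong2[where f = box]) (simp_all add: vec_eq_iff field_simps)
qed

definition is_tiling :: "'n::finite idx set \<Rightarrow> bool" where
  "is_tiling A \<longleftrightarrow>
     (\<forall>\<alpha>\<in>A. \<forall>\<beta>\<in>A. \<alpha> \<noteq> \<beta> \<longrightarrow>
        interior (closure (dyadic \<alpha>)) \<inter> interior (closure (dyadic \<beta>)) = {}) \<and>
     (\<Union>\<alpha>\<in>A. closure (dyadic \<alpha>)) = UNIV"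

definition succeeds :: "'n::finite idx set \<Rightarrow> 'n idx set \<Rightarrow> bool" where
  "succeeds A' A \<longleftrightarrow> (\<forall>\<alpha>'\<in>A'. \<exists>\<alpha>\<in>A. closure (dyadic \<alpha>') \<subseteq> closure (dyadic \<alpha>))"

definition system_of_tilings :: "(nat \<Rightarrow> 'n::finite idx set) \<Rightarrow> bool" where
  "system_of_tilings A \<longleftrightarrow> (\<forall>s. is_tiling (A s) \<and> succeeds (A (Suc s)) (A s))"

text \<open>
  The set of indices discarded during the first i steps, when A is enumerated as
  e 0, e 1, and so on. Indices later in the enumeration count as not yet discarded.
\<close>

primrec discarded ::
  "real \<Rightarrow> 'n::finite idx set \<Rightarrow> (nat \<Rightarrow> 'n idx) \<Rightarrow> nat \<Rightarrow> 'n idx set" where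
  "discarded lam A e 0 = {}"
| "discarded lam A e (Suc i) =
     (if dilate (1 + lam) (e i) \<subseteq> (\<Union>\<alpha>\<in>A - discarded lam A e i - {e i}. dilate (1 + lam) \<alpha>)
      then insert (e i) (discarded lam A e i) else discarded lam A e i)"

definition remaining ::
  "real \<Rightarrow> 'n::finite idx set \<Rightarrow> (nat \<Rightarrow> 'n idx) \<Rightarrow> 'n idx set" where
  "remaining lam A e = A - (\<Union>i. discarded lam A e i)"

definition weight_mean :: "((real^'n) \<times> real \<Rightarrow> real) \<Rightarrow> 'n::finite idx \<Rightarrow> real" where
  "weight_mean \<gamma> \<alpha> = mean (dyadic \<alpha> \<times> {0<..<side \<alpha>}) \<gamma>"

text \<open>
  The last condition bounds the side lengths occurring in each tiling from below and makes them
  a finite set, so the Max and Min in the third one range over finite nonempty sets.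
\<close>

definition admissible ::
  "real \<Rightarrow> real \<Rightarrow> real \<Rightarrow> ((real^'n) \<times> real \<Rightarrow> real) \<Rightarrow> (nat \<Rightarrow> 'n::finite idx set) \<Rightarrow> bool" where
  "admissible lam c1 c2 \<gamma> A \<longleftrightarrow>
     system_of_tilings A \<and>
     (\<forall>s. \<forall>\<alpha>\<in>A s. \<forall>\<alpha>'\<in>A s. dilate (1 + lam) \<alpha> \<inter> dilate (1 + lam) \<alpha>' \<noteq> {} \<longrightarrow>
        weight_mean \<gamma> \<alpha> \<le> c1 * weight_mean \<gamma> \<alpha>') \<and>
     (\<forall>s. \<forall>\<alpha>\<in>A s. \<forall>\<alpha>'\<in>A (Suc s). dyadic \<alpha>' \<subseteq> dyadic \<alpha> \<longrightarrow>
        weight_mean \<gamma> \<alpha> \<le> c2 * weight_mean \<gamma> \<alpha>' \<and>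
        weight_mean \<gamma> \<alpha>' \<le> c2 * weight_mean \<gamma> \<alpha>) \<and>
     (\<forall>s x. Max {side \<alpha>' |\<alpha>'. \<alpha>' \<in> A (Suc s) \<and> x \<in> dilate (1 + lam) \<alpha>'}
        \<le> 1 / 2 * Min {side \<alpha> |\<alpha>. \<alpha> \<in> A s \<and> x \<in> dilate (1 + lam) \<alpha>}) \<and>
     (\<exists>l :: nat \<Rightarrow> nat. strict_mono l \<and> l 0 = 0 \<and>
        (\<forall>s. \<forall>\<alpha>\<in>A s. 1 / 2 ^ l s \<le> side \<alpha>))"

end

theory Submission
  imports Defs
begin

text \<open>
  Write \<open>w\<close> for the weight mean of a dyadic cube \<open>Q\<close> of side \<open>r\<close>, and \<open>Q'\<close> for its dilate.

  The oscillation of the trace on \<open>Q'\<close> is at most a constant times the integral of \<open>\<bar>\<partial>\<^sub>t f\<bar>\<close> over the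
  column \<open>Q' \<times> (0, r)\<close> plus the integral of \<open>\<bar>\<nabla>f\<bar>\<close> over the layer \<open>Q' \<times> (r/2, r)\<close>: one moves from
  the boundary up into the layer and applies a Poincare inequality there (\<open>trace_oscillation\<close>). Since
  \<open>\<gamma>\<close> is a local A1 weight, \<open>w \<le> const * \<gamma>\<close> almost everywhere on the column, so after
  multiplication by \<open>w\<close> both integrals carry the weight \<open>\<gamma>\<close>. Layers of cubes of different sizes are
  disjoint, and a dyadic cube lies in at most one of the tilings; hence the layer terms add up to a
  multiple of the norm. The columns over one point are nested, and for general tilings their sum
  may diverge. The tilings are chosen so that it converges.

  The choice rests on a clock. First, scales \<open>l 1 < l 2 < \<dots>\<close> are chosen, depending on \<open>f\<close>, such that the
  strip \<open>t < 2^(- l j)\<close> carries at most the fraction \<open>2^(- j)\<close> of the integral of \<open>\<gamma> \<bar>\<partial>\<^sub>t f\<bar>\<close>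
  (\<open>vanishing_tails\<close>). The A1 condition says that, up to factors \<open>exp d\<close>, the mean \<open>w\<close> can only
  grow when \<open>Q\<close> shrinks, and that it is comparable on neighbouring cubes and on parent and child. The
  clock of \<open>Q\<close> is the logarithm of the growth of \<open>w\<close> from the unit cube around \<open>Q\<close> down to \<open>Q\<close>, plus
  \<open>d\<close> for every scale passed on the way. The tiling number \<open>s\<close> consists of the largest cubes all of
  whose neighbours have seen the clock reach \<open>8 d s\<close>. The clocks of neighbours differ by at most \<open>2 d\<close>
  and increase by at most \<open>2 d\<close> from parent to child, so on all tiles of number \<open>s\<close> the clock agrees
  with \<open>8 d s\<close> up to \<open>4 d\<close>. This gives admissibility: weights of consecutive tilings
  differ by a bounded factor, and where two dilates meet, the tile of the later tiling is strictly
  smaller. Because the stopping rule looks at the neighbours, tiles of one tiling with intersecting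
  dilates have sizes that differ by a factor of at most 4, so that their weights are comparable and
  the dilates overlap boundedly.

  For the column terms, fix \<open>z = (x, t)\<close> and group the tiles whose columns contain \<open>z\<close> by
  the number of scales that they have passed. Within a group the clock can advance only through growth of
  the weight, so the weights grow geometrically with \<open>s\<close> and their sum is comparable to the last
  one, which is at most a constant times \<open>\<gamma> z\<close>. There are at most as many groups as one plus the number of
  scales with \<open>t < 2^(- l j)\<close> (\<open>clock_sum_bound\<close>). Integrating this number against
  \<open>\<gamma> \<bar>\<partial>\<^sub>t f\<bar>\<close> gives a convergent geometric series by the choice of the scales.

  All facts about weak derivatives come from one identity: \<open>f(z + h) - f(z)\<close> is the integral over
  \<open>\<theta>\<close> in \<open>[0, 1]\<close> of the weak derivative in direction \<open>h\<close> at \<open>z + \<theta> h\<close>, for almost every \<open>z\<close>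
  (\<open>weak_translation_identity\<close>). It is obtained by testing against smooth functions that
  converge to the indicator of a box.
\<close>

section \<open>Dyadic cubes\<close>

text \<open>
  The ancestor of level \<open>j\<close>; it is meaningful for levels up to that of the cube.
\<close>

definition anc :: "nat \<Rightarrow> 'n idx \<Rightarrow> 'n::finite idx" where
  "anc j \<alpha> = (j, \<chi> i. (snd \<alpha> $ i) div 2 ^ (fst \<alpha> - j))"

definition nbr :: "'n idx \<Rightarrow> 'n::finite idx \<Rightarrow> bool" where
  "nbr \<alpha> \<beta> \<longleftrightarrow> fst \<alpha> = fst \<beta> \<and> (\<forall>i. \<bar>snd \<alpha> $ i - snd \<beta> $ i\<bar> \<le> 1)"

definition cube_at :: "nat \<Rightarrow> real^'n \<Rightarrow> 'n::finite idx" where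
  "cube_at k x = (k, \<chi> i. \<lfloor>x $ i * 2 ^ k\<rfloor>)"

lemma fst_anc [simp]: "fst (anc j \<alpha>) = j"
  by (simp add: anc_def)

lemma fst_cube_at [simp]: "fst (cube_at k x) = k"
  by (simp add: cube_at_def)

lemma anc_self [simp]: "anc (fst \<alpha>) \<alpha> = \<alpha>"
  by (cases \<alpha>) (simp add: anc_def vec_eq_iff)

lemma anc_anc: "i \<le> j \<Longrightarrow> j \<le> fst \<alpha> \<Longrightarrow> anc i (anc j \<alpha>) = anc i \<alpha>"
  by (simp add: anc_def vec_eq_iff div_mult2_eq [symmetric] power_add [symmetric]
      zdiv_zmult2_eq[symmetric])

lemma nbr_refl [simp]: "nbr \<alpha> \<alpha>"
  by (simp add: nbr_def)

lemma nbr_sym: "nbr \<alpha> \<beta> \<Longrightarrow> nbr \<beta> \<alpha>"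
  by (simp add: nbr_def abs_minus_commute)

lemma nbr_fst: "nbr \<alpha> \<beta> \<Longrightarrow> fst \<alpha> = fst \<beta>"
  by (simp add: nbr_def)

text \<open>
  Division by a positive integer does not increase distances that are at most 1.
\<close>

lemma nbr_anc:
  assumes "nbr \<alpha> \<beta>"
  shows "nbr (anc j \<alpha>) (anc j \<beta>)"
proof -
  have "\<bar>a div c - b div c\<bar> \<le> 1" if "\<bar>a - b\<bar> \<le> 1" "0 < c" for a b c :: int
  proof -
    have "a div c \<le> (b + c) div c" by (rule zdiv_mono1) (use that in auto)
    moreover have "b div c \<le> (a + c) div c" by (rule zdiv_mono1) (use that in auto)
    moreover have "(b + c) div c = b div c + 1" "(a + c) div c = a div c + 1"
      using that by (simp_all add: div_add_self2)
    ultimately show ?thesis by linarith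
  qed
  then show ?thesis
    using assms by (auto simp: nbr_def anc_def)
qed

lemma mem_dyadic: "x \<in> dyadic \<alpha> \<longleftrightarrow>
    (\<forall>i. of_int (snd \<alpha> $ i) < x $ i * 2 ^ fst \<alpha> \<and> x $ i * 2 ^ fst \<alpha> < of_int (snd \<alpha> $ i) + 1)"
  by (simp add: dyadic_def mem_box_cart field_simps)

lemma closure_dyadic: "closure (dyadic \<alpha>) =
    {x. \<forall>i. of_int (snd \<alpha> $ i) \<le> x $ i * 2 ^ fst \<alpha> \<and> x $ i * 2 ^ fst \<alpha> \<le> of_int (snd \<alpha> $ i) + 1}"
proof -
  have "dyadic \<alpha> \<noteq> {}"
    by (simp add: dyadic_def interval_ne_empty_cart divide_strict_right_mono)
  then have "closure (dyadic \<alpha>) = cbox (\<chi> i. of_int (snd \<alpha> $ i) / 2 ^ fst \<alpha>)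
                  (\<chi> i. (of_int (snd \<alpha> $ i) + 1) / 2 ^ fst \<alpha>)"
    unfolding dyadic_def by (rule closure_box)
  then show ?thesis
    by (auto simp: mem_box_cart field_simps)
qed

lemma interior_closure_dyadic: "interior (closure (dyadic \<alpha>)) = dyadic \<alpha>"
proof -
  have "dyadic \<alpha> \<noteq> {}"
    by (simp add: dyadic_def interval_ne_empty_cart divide_strict_right_mono)
  then show ?thesis
    unfolding dyadic_def by (simp add: closure_box interior_cbox)
qed

lemma One_nth [simp]: "(One :: real^'n) $ i = 1"
  using inner_sum_Basis[of "axis i (1::real)"] by (simp add: inner_axis axis_in_Basis_iff)

lemma mem_dilate: "x \<in> dilate c \<alpha> \<longleftrightarrow>
    (\<forall>i. \<bar>x $ i * 2 ^ fst \<alpha> - (of_int (snd \<alpha> $ i) + 1 / 2)\<bar> < c / 2)"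
proof -
  have "((m + 1/2) / P - c / P / 2 < y \<and> y < (m + 1/2) / P + c / P / 2) \<longleftrightarrow> \<bar>y * P - (m + 1/2)\<bar> < c / 2"
    if "0 < P" for m P y :: real
  proof -
    have "(m + 1/2) / P - c / P / 2 = (m + 1/2 - c / 2) / P" "(m + 1/2) / P + c / P / 2 = (m + 1/2 + c / 2) / P"
      by (simp_all add: diff_divide_distrib add_divide_distrib)
    then have "((m + 1/2) / P - c / P / 2 < y \<and> y < (m + 1/2) / P + c / P / 2) \<longleftrightarrow>
        m + 1/2 - c / 2 < y * P \<and> y * P < m + 1/2 + c / 2"
      by (simp only: pos_divide_less_eq[OF that] pos_less_divide_eq[OF that])
    then show ?thesis by (simp only: abs_less_iff) linarith
  qed
  then show ?thesis
    by (simp add: dilate_def open_cube_def mem_box_cart side_def del: sum_component)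
qed

lemma dilate_mono: "c \<le> c' \<Longrightarrow> dilate c \<alpha> \<subseteq> dilate c' \<alpha>"
  unfolding mem_dilate subset_iff by (meson divide_right_mono less_le_trans zero_le_numeral)

lemma dilateD: "x \<in> dilate c \<alpha> \<Longrightarrow> \<bar>x $ i * 2 ^ fst \<alpha> - (of_int (snd \<alpha> $ i) + 1 / 2)\<bar> < c / 2"
  by (simp only: mem_dilate)

lemma dyadic_subset_dilate: "1 \<le> c \<Longrightarrow> dyadic \<alpha> \<subseteq> dilate c \<alpha>"
  using dilate_mono[of 1 c \<alpha>] by (simp add: dilate_1)

lemma closure_dyadic_subset_dilate: "1 < c \<Longrightarrow> closure (dyadic \<alpha>) \<subseteq> dilate c \<alpha>"
proof
  fix x assume c: "1 < c" and x: "x \<in> closure (dyadic \<alpha>)"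
  show "x \<in> dilate c \<alpha>" unfolding mem_dilate
  proof
    fix i
    have "of_int (snd \<alpha> $ i) \<le> x $ i * 2 ^ fst \<alpha> \<and> x $ i * 2 ^ fst \<alpha> \<le> of_int (snd \<alpha> $ i) + 1"
      using x by (simp add: closure_dyadic)
    then show "\<bar>x $ i * 2 ^ fst \<alpha> - (of_int (snd \<alpha> $ i) + 1 / 2)\<bar> < c / 2"
      using c unfolding abs_less_iff by linarith
  qed
qed

lemma dyadic_nonempty: "dyadic \<alpha> \<noteq> {}"
  by (simp add: dyadic_def interval_ne_empty_cart divide_strict_right_mono)

lemma mem_dyadic_imp_cube_at:
  assumes "x \<in> dyadic \<alpha>" shows "\<alpha> = cube_at (fst \<alpha>) x"
proof (rule prod_eqI)
  show "snd \<alpha> = snd (cube_at (fst \<alpha>) x)"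
    unfolding vec_eq_iff
  proof
    fix i
    show "snd \<alpha> $ i = snd (cube_at (fst \<alpha>) x) $ i"
      using assms unfolding cube_at_def mem_dyadic
      by (auto intro!: floor_unique[symmetric] less_imp_le)
  qed
qed simp

lemma anc_cube_at: "j \<le> k \<Longrightarrow> anc j (cube_at k x) = cube_at j x"
proof -
  assume "j \<le> k"
  then have *: "(2::real) ^ k = 2 ^ j * 2 ^ (k - j)" by (simp flip: power_add)
  have "\<lfloor>y * 2 ^ k\<rfloor> div 2 ^ (k - j) = \<lfloor>y * 2 ^ j\<rfloor>" for y :: real
    using floor_divide_real_eq_div[of "2 ^ (k - j)" "y * 2 ^ k"] by (simp add: *)
  then show ?thesis by (simp add: anc_def cube_at_def)
qed

lemma mem_closure_cube_at: "x \<in> closure (dyadic (cube_at k x))"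
  by (auto simp: closure_dyadic cube_at_def intro: less_imp_le)

lemma dilate_nbr_cube_at:
  assumes "x \<in> dilate c \<alpha>" "c \<le> 2" shows "nbr \<alpha> (cube_at (fst \<alpha>) x)"
  unfolding nbr_def
proof safe
  fix i
  have "\<bar>x $ i * 2 ^ fst \<alpha> - (of_int (snd \<alpha> $ i) + 1 / 2)\<bar> < 1"
    using assms dilateD[of x c \<alpha> i] by linarith
  then show "\<bar>snd \<alpha> $ i - snd (cube_at (fst \<alpha>) x) $ i\<bar> \<le> 1"
    unfolding cube_at_def by simp linarith
qed simp

text \<open>
  A dilate reaches \<open>(c - 1) / 2\<close> side lengths beyond its cube, which is less for the smaller cube.
\<close>

lemma dilate_anc:
  assumes "x \<in> dilate c \<alpha>" "1 \<le> c" "j \<le> fst \<alpha>"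
  shows "x \<in> dilate c (anc j \<alpha>)"
  unfolding mem_dilate
proof
  fix i
  define m where "m = snd \<alpha> $ i"
  define P :: int where "P = 2 ^ (fst \<alpha> - j)"
  define y where "y = x $ i * 2 ^ j"
  have P: "P \<ge> 1" by (simp add: P_def)
  have eq: "x $ i * 2 ^ fst \<alpha> = y * P"
    using assms(3) by (simp add: y_def P_def flip: power_add)
  have a: "\<bar>y * P - (m + 1/2)\<bar> < c / 2"
    using dilateD[OF assms(1), of i] unfolding eq m_def .
  have "m = P * (m div P) + m mod P" "0 \<le> m mod P" "m mod P \<le> P - 1"
    using P by (simp_all add: pos_mod_bound zle_diff1_eq)
  then have "P * (m div P) \<le> m" "m + 1 \<le> P * (m div P) + P" by linarith+
  then have b: "real_of_int P * (m div P) \<le> m" "real_of_int m + 1 \<le> P * (m div P) + P"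
    by (metis of_int_le_iff of_int_mult, metis of_int_1 of_int_add of_int_le_iff of_int_mult)
  have c: "(c - 1) / 2 * 1 \<le> (c - 1) / 2 * P"
    using assms(2) P by (intro mult_left_mono) auto
  have "\<bar>y * P - P * (m div P + 1/2)\<bar> < P * (c / 2)"
    using a b c by (simp add: field_simps abs_less_iff)
  moreover have "y * P - P * (m div P + 1/2) = P * (y - (m div P + 1/2))"
    by (simp add: algebra_simps)
  ultimately have "P * \<bar>y - (m div P + 1/2)\<bar> < P * (c / 2)"
    using P by (simp only: abs_mult)
  then have "\<bar>y - (m div P + 1/2)\<bar> < c / 2"
    using P by simp
  then show "\<bar>x $ i * 2 ^ fst (anc j \<alpha>) - (of_int (snd (anc j \<alpha>) $ i) + 1 / 2)\<bar> < c / 2"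
    by (simp add: anc_def y_def m_def P_def)
qed

text \<open>
  For \<open>c \<le> 2\<close> the centres of two cubes of the same level whose dilates meet are less than two side
  lengths apart, so their integer coordinates differ by at most 1.
\<close>

lemma dilate_nbr_anc:
  assumes "x \<in> dilate c \<alpha>" "x \<in> dilate c \<beta>" "1 \<le> c" "c \<le> 2" "fst \<alpha> \<le> fst \<beta>"
  shows "nbr \<alpha> (anc (fst \<alpha>) \<beta>)"
  unfolding nbr_def
proof safe
  fix i
  have "\<bar>x $ i * 2 ^ fst \<alpha> - (of_int (snd \<alpha> $ i) + 1 / 2)\<bar> < 1"
       "\<bar>x $ i * 2 ^ fst \<alpha> - (of_int (snd (anc (fst \<alpha>) \<beta>) $ i) + 1 / 2)\<bar> < 1"
    using assms(4) dilateD[OF assms(1), of i] dilateD[OF dilate_anc[OF assms(2,3,5)], of i] by simp_all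
  then show "\<bar>snd \<alpha> $ i - snd (anc (fst \<alpha>) \<beta>) $ i\<bar> \<le> 1" by linarith
qed simp

lemma finite_box_int: "finite {m :: int^'n::finite. \<forall>i. \<bar>m $ i\<bar> \<le> 1}"
proof (rule finite_subset)
  show "{m :: int^'n. \<forall>i. \<bar>m $ i\<bar> \<le> 1} \<subseteq> vec_lambda ` (PiE UNIV (\<lambda>_. {-1..1}))"
  proof
    fix m :: "int^'n" assume "m \<in> {m. \<forall>i. \<bar>m $ i\<bar> \<le> 1}"
    then have "vec_nth m \<in> PiE UNIV (\<lambda>_. {-1..1})" by (auto simp: abs_le_iff minus_le_iff)
    then show "m \<in> vec_lambda ` (PiE UNIV (\<lambda>_. {-1..1}))"
      by (metis image_eqI vec_nth_inverse)
  qed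
qed (auto intro!: finite_imageI finite_PiE)

text \<open>
  A bound for the number of cubes of one level whose dilates contain a given point.
\<close>

definition nbr_count :: "'n::finite itself \<Rightarrow> nat" where
  "nbr_count _ = card {m :: int^'n. \<forall>i. \<bar>m $ i\<bar> \<le> 1}"

lemma nbr_finite_card:
  "finite {\<alpha> :: 'n::finite idx. nbr \<alpha> \<beta>}"
  "card {\<alpha> :: 'n::finite idx. nbr \<alpha> \<beta>} \<le> nbr_count TYPE('n)"
proof -
  let ?M = "{m :: int^'n. \<forall>i. \<bar>m $ i\<bar> \<le> 1}"
  have sub: "{\<alpha>. nbr \<alpha> \<beta>} \<subseteq> (\<lambda>m. (fst \<beta>, snd \<beta> + m)) ` ?M"
  proof
    fix \<alpha> assume "\<alpha> \<in> {\<alpha>. nbr \<alpha> \<beta>}"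
    then have "snd \<alpha> - snd \<beta> \<in> ?M" "\<alpha> = (fst \<beta>, snd \<beta> + (snd \<alpha> - snd \<beta>))"
      by (auto simp: nbr_def prod_eq_iff)
    then show "\<alpha> \<in> (\<lambda>m. (fst \<beta>, snd \<beta> + m)) ` ?M" by blast
  qed
  show "finite {\<alpha>. nbr \<alpha> \<beta>}"
    using finite_subset[OF sub] finite_box_int by blast
  show "card {\<alpha>. nbr \<alpha> \<beta>} \<le> nbr_count TYPE('n)"
    unfolding nbr_count_def using surj_card_le[OF finite_box_int sub] .
qed

lemma dilate_level_card:
  assumes "c \<le> 2"
  shows "finite {\<alpha> :: 'n::finite idx. fst \<alpha> = k \<and> x \<in> dilate c \<alpha>}"
    "card {\<alpha> :: 'n::finite idx. fst \<alpha> = k \<and> x \<in> dilate c \<alpha>} \<le> nbr_count TYPE('n)"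
proof -
  have sub: "{\<alpha> :: 'n idx. fst \<alpha> = k \<and> x \<in> dilate c \<alpha>} \<subseteq> {\<alpha>. nbr \<alpha> (cube_at k x)}"
    using dilate_nbr_cube_at[OF _ assms] by auto
  show "finite {\<alpha> :: 'n idx. fst \<alpha> = k \<and> x \<in> dilate c \<alpha>}"
    using finite_subset[OF sub nbr_finite_card(1)] .
  show "card {\<alpha> :: 'n idx. fst \<alpha> = k \<and> x \<in> dilate c \<alpha>} \<le> nbr_count TYPE('n)"
    using card_mono[OF nbr_finite_card(1) sub] nbr_finite_card(2)[of "cube_at k x"] by linarith
qed

section \<open>Stopping-time tilings\<close>

text \<open>
  In the application \<open>v\<close> is the logarithm of the weight mean, and \<open>N k\<close> is the number of chosen
  scales \<open>l j\<close> with \<open>j \<ge> 1\<close> and \<open>l j \<le> k\<close>. The three conditions on \<open>v\<close> express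
  the local A1 condition (\<open>A1_dyadic_clock\<close>); by the first, \<open>v\<close> is increasing along shrinking cubes, up to
  an error \<open>d\<close>.
\<close>

locale dyadic_clock =
  fixes v :: "'n::finite idx \<Rightarrow> real" and d :: real and N :: "nat \<Rightarrow> nat"
  assumes d_ge_1: "1 \<le> d"
    and v_anc: "\<And>j \<alpha>. j \<le> fst \<alpha> \<Longrightarrow> v (anc j \<alpha>) - d \<le> v \<alpha>"
    and v_nbr: "\<And>\<alpha> \<beta>. nbr \<alpha> \<beta> \<Longrightarrow> v \<alpha> \<le> v \<beta> + d"
    and v_child: "\<And>k \<alpha>. fst \<alpha> = Suc k \<Longrightarrow> v \<alpha> \<le> v (anc k \<alpha>) + d"
    and N_0: "N 0 = 0" and N_mono: "\<And>j k. j \<le> k \<Longrightarrow> N j \<le> N k"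
    and N_Suc: "\<And>k. N (Suc k) \<le> Suc (N k)" and N_unbounded: "\<And>j. \<exists>k. j \<le> N k"
begin

definition clock :: "'n idx \<Rightarrow> real" where
  "clock \<alpha> = v \<alpha> - v (anc 0 \<alpha>) + d * N (fst \<alpha>)"

text \<open>
  Including the neighbours makes the sizes of adjacent tiles comparable (\<open>tiles_graded\<close>). A neighbour
  counts as soon as one of its ancestors has reached the level, so that the condition passes to subcubes
  although the clock itself is only increasing up to \<open>d\<close>. The step \<open>8 * d\<close> is the total
  of the errors, one of them strict, in the comparison of two meeting tiles (\<open>tiles_Suc_finer\<close>).
\<close>

definition stop :: "nat \<Rightarrow> 'n idx \<Rightarrow> bool" where
  "stop s \<alpha> \<longleftrightarrow> (\<forall>\<beta>. nbr \<alpha> \<beta> \<longrightarrow> (\<exists>j\<le>fst \<alpha>. 8 * d * s \<le> clock (anc j \<beta>)))"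

definition tiles :: "nat \<Rightarrow> 'n idx set" where
  "tiles s = {\<alpha>. stop s \<alpha> \<and> (\<forall>j<fst \<alpha>. \<not> stop s (anc j \<alpha>))}"

lemma clock_anc: "j \<le> fst \<alpha> \<Longrightarrow> clock (anc j \<alpha>) - d \<le> clock \<alpha>"
proof -
  assume j: "j \<le> fst \<alpha>"
  then have "d * N j \<le> d * N (fst \<alpha>)"
    using d_ge_1 N_mono by (intro mult_left_mono) auto
  then show ?thesis using v_anc[OF j] j by (simp add: clock_def anc_anc)
qed

lemma clock_nbr: "nbr \<alpha> \<beta> \<Longrightarrow> clock \<alpha> \<le> clock \<beta> + 2 * d"
  using v_nbr[of \<alpha> \<beta>] v_nbr[OF nbr_sym, OF nbr_anc, of \<alpha> \<beta> 0] nbr_fst[of \<alpha> \<beta>]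
  by (simp add: clock_def)

lemma clock_child: "fst \<alpha> = Suc k \<Longrightarrow> clock \<alpha> \<le> clock (anc k \<alpha>) + 2 * d"
proof -
  assume a: "fst \<alpha> = Suc k"
  have "d * real (N (Suc k)) \<le> d * (real (N k) + 1)"
    using d_ge_1 N_Suc[of k] by (intro mult_left_mono) linarith+
  then show ?thesis
    using v_child[OF a] a by (simp add: clock_def anc_anc algebra_simps)
qed

lemma clock_0: "fst \<alpha> = 0 \<Longrightarrow> clock \<alpha> = 0"
  using anc_self[of \<alpha>] by (simp add: clock_def N_0)

lemma stop_clock: "stop s \<alpha> \<Longrightarrow> 8 * d * s - d \<le> clock \<alpha>"
proof -
  assume "stop s \<alpha>"
  then obtain j where "j \<le> fst \<alpha>" "8 * d * s \<le> clock (anc j \<alpha>)"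
    unfolding stop_def using nbr_refl by blast
  then show ?thesis using clock_anc[of j \<alpha>] by linarith
qed

lemma not_stop_clock:
  assumes "\<not> stop s \<alpha>" shows "clock \<alpha> < 8 * d * s + 2 * d"
proof -
  obtain \<beta> where "nbr \<alpha> \<beta>" "\<And>j. j \<le> fst \<alpha> \<Longrightarrow> clock (anc j \<beta>) < 8 * d * s"
    using assms unfolding stop_def not_le[symmetric] by blast
  then show ?thesis
    using clock_nbr[of \<alpha> \<beta>] nbr_fst[of \<alpha> \<beta>] anc_self[of \<beta>] by fastforce
qed

lemma tiles_clock_ge: "\<alpha> \<in> tiles s \<Longrightarrow> 8 * d * s - d \<le> clock \<alpha>"
  by (simp add: tiles_def stop_clock)

text \<open>
  The parent of a tile does not stop, so a neighbour of the parent is below the level; passing to the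
  neighbour and to the child costs \<open>2 * d\<close> each.
\<close>

lemma tiles_clock_less:
  assumes "\<alpha> \<in> tiles s" shows "clock \<alpha> < 8 * d * s + 4 * d"
proof (cases "fst \<alpha>")
  case 0
  then show ?thesis using d_ge_1 by (simp add: clock_0 add_nonneg_pos)
next
  case (Suc k)
  then have "\<not> stop s (anc k \<alpha>)" using assms by (simp add: tiles_def)
  then show ?thesis using not_stop_clock clock_child[OF Suc] by fastforce
qed

text \<open>
  The clock of a tile of number \<open>s\<close> lies in the window from \<open>8 * d * s - d\<close> to \<open>8 * d * s + 4 * d\<close>,
  and these windows are disjoint.
\<close>

lemma tiles_disjoint:
  assumes "\<alpha> \<in> tiles s" "\<alpha> \<in> tiles s'" shows "s = s'"
proof -
  have "\<not> s < s'" if "\<alpha> \<in> tiles s" "\<alpha> \<in> tiles s'" for s s'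
  proof
    assume "s < s'"
    then have "8 * d * (real s + 1) \<le> 8 * d * s'"
      using d_ge_1 by (intro mult_left_mono) auto
    then show False
      using tiles_clock_less[OF that(1)] tiles_clock_ge[OF that(2)] d_ge_1 by (simp add: algebra_simps)
  qed
  then show ?thesis using assms by (meson linorder_neqE_nat)
qed

text \<open>
  The scales alone drive the clock to infinity, because the growth of \<open>v\<close> is bounded below by \<open>- d\<close>.
\<close>

lemma stop_if_level:
  assumes "8 * s + 1 \<le> N (fst \<alpha>)" shows "stop s \<alpha>"
  unfolding stop_def
proof (intro allI impI)
  fix \<beta> assume nb: "nbr \<alpha> \<beta>"
  have "d * real (8 * s + 1) \<le> d * N (fst \<beta>)"
    using assms nbr_fst[OF nb] d_ge_1 by (intro mult_left_mono) (auto simp del: of_nat_add of_nat_mult)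
  then have "8 * d * s \<le> clock \<beta>"
    using v_anc[of 0 \<beta>] by (simp add: clock_def algebra_simps)
  then show "\<exists>j\<le>fst \<alpha>. 8 * d * s \<le> clock (anc j \<beta>)"
    using nbr_fst[OF nb] by (intro exI[of _ "fst \<alpha>"]) simp
qed

lemma tiles_level_le: "\<alpha> \<in> tiles s \<Longrightarrow> 8 * s + 1 \<le> N k \<Longrightarrow> fst \<alpha> \<le> k"
  using stop_if_level[of s "anc k \<alpha>"] unfolding tiles_def by (metis (lifting) fst_anc mem_Collect_eq not_le)

lemma tiles_0: "\<alpha> \<in> tiles 0 \<longleftrightarrow> fst \<alpha> = 0"
proof -
  have st: "stop 0 \<beta>" if "fst \<beta> = 0" for \<beta>
    using that by (auto simp: stop_def clock_0)
  show ?thesis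
    using st[of \<alpha>] st[of "anc 0 \<alpha>"] by (force simp: tiles_def)
qed

lemma ex_tile:
  assumes "stop s \<alpha>" shows "\<exists>j\<le>fst \<alpha>. anc j \<alpha> \<in> tiles s"
proof -
  let ?P = "\<lambda>j. j \<le> fst \<alpha> \<and> stop s (anc j \<alpha>)"
  have "?P (fst \<alpha>)" using assms by simp
  then have 1: "?P (LEAST j. ?P j)" by (rule LeastI)
  have "\<not> stop s (anc j \<alpha>)" if "j < (LEAST j. ?P j)" for j
    using not_less_Least[OF that] that 1 by (meson less_imp_le order_trans)
  then have "anc (LEAST j. ?P j) \<alpha> \<in> tiles s"
    using 1 unfolding tiles_def mem_Collect_eq fst_anc
    by (metis (no_types, lifting) anc_anc less_imp_le)
  then show ?thesis using conjunct1[OF 1] by blast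
qed

lemma ex_tile_at: "\<exists>k. cube_at k x \<in> tiles s"
proof -
  obtain k where "8 * s + 1 \<le> N k" using N_unbounded by blast
  then have "stop s (cube_at k x)" by (intro stop_if_level) simp
  then obtain j where "j \<le> k" "anc j (cube_at k x) \<in> tiles s" using ex_tile by fastforce
  then show ?thesis by (auto simp: anc_cube_at)
qed

lemma tiles_unique:
  assumes "cube_at j x \<in> tiles s" "cube_at k x \<in> tiles s" shows "j = k"
proof -
  have "\<not> j < k" if "cube_at j x \<in> tiles s" "cube_at k x \<in> tiles s" for j k
  proof
    assume "j < k"
    then have "anc j (cube_at k x) = cube_at j x" by (simp add: anc_cube_at)
    then show False using that \<open>j < k\<close> by (force simp: tiles_def)
  qed
  then show ?thesis using assms by (meson linorder_neqE_nat)
qed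

lemma is_tiling_tiles: "is_tiling (tiles s)"
  unfolding is_tiling_def interior_closure_dyadic
proof (intro conjI ballI impI)
  fix \<alpha> \<beta> assume *: "\<alpha> \<in> tiles s" "\<beta> \<in> tiles s" "\<alpha> \<noteq> \<beta>"
  show "dyadic \<alpha> \<inter> dyadic \<beta> = {}"
  proof (rule ccontr)
    assume "dyadic \<alpha> \<inter> dyadic \<beta> \<noteq> {}"
    then obtain x where "\<alpha> = cube_at (fst \<alpha>) x" "\<beta> = cube_at (fst \<beta>) x"
      using mem_dyadic_imp_cube_at by blast
    then show False using * tiles_unique by metis
  qed
next
  have "x \<in> (\<Union>\<alpha>\<in>tiles s. closure (dyadic \<alpha>))" for x
    using ex_tile_at[where x = x and s = s] mem_closure_cube_at by blast
  then show "(\<Union>\<alpha>\<in>tiles s. closure (dyadic \<alpha>)) = UNIV" by blast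
qed

lemma closure_dyadic_anc:
  assumes "j \<le> fst \<alpha>" shows "closure (dyadic \<alpha>) \<subseteq> closure (dyadic (anc j \<alpha>))"
proof -
  have "dyadic \<alpha> \<subseteq> dyadic (anc j \<alpha>)"
    using dilate_anc[of _ 1 \<alpha> j] assms by (auto simp: dilate_1)
  then show ?thesis by (rule closure_mono)
qed

lemma succeeds_tiles: "succeeds (tiles (Suc s)) (tiles s)"
  unfolding succeeds_def
proof
  fix \<alpha> assume a: "\<alpha> \<in> tiles (Suc s)"
  have "stop s \<alpha>"
    unfolding stop_def
  proof (intro allI impI)
    fix \<beta> assume "nbr \<alpha> \<beta>"
    then obtain j where "j \<le> fst \<alpha>" "8 * d * Suc s \<le> clock (anc j \<beta>)"
      using a unfolding tiles_def stop_def by blast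
    moreover have "8 * d * s \<le> 8 * d * Suc s" using d_ge_1 by (intro mult_left_mono) auto
    ultimately show "\<exists>j\<le>fst \<alpha>. 8 * d * s \<le> clock (anc j \<beta>)" by force
  qed
  then obtain j where "j \<le> fst \<alpha>" "anc j \<alpha> \<in> tiles s" using ex_tile by blast
  then show "\<exists>\<alpha>'\<in>tiles s. closure (dyadic \<alpha>) \<subseteq> closure (dyadic \<alpha>')"
    using closure_dyadic_anc by blast
qed

lemma system_of_tilings_tiles: "system_of_tilings tiles"
  by (simp add: system_of_tilings_def is_tiling_tiles succeeds_tiles)

text \<open>
  If the tile of the later tiling were not smaller, the ancestor of \<open>\<beta>\<close> at its level would be a neighbour
  of it, and the clock of \<open>\<beta>\<close> would be too far advanced for the tiling number \<open>s\<close>.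
\<close>

lemma tiles_Suc_finer:
  assumes "\<alpha> \<in> tiles (Suc s)" "\<beta> \<in> tiles s" "x \<in> dilate c \<alpha>" "x \<in> dilate c \<beta>" "1 \<le> c" "c \<le> 2"
  shows "fst \<beta> < fst \<alpha>"
proof (rule ccontr)
  assume "\<not> fst \<beta> < fst \<alpha>"
  then have le: "fst \<alpha> \<le> fst \<beta>" by simp
  have "clock \<alpha> \<le> clock (anc (fst \<alpha>) \<beta>) + 2 * d"
    using assms le by (intro clock_nbr dilate_nbr_anc)
  also have "\<dots> \<le> clock \<beta> + 3 * d" using clock_anc[OF le] by simp
  also have "\<dots> < 8 * d * s + 7 * d" using tiles_clock_less[OF assms(2)] by simp
  finally show False using tiles_clock_ge[OF assms(1)] by (simp add: algebra_simps)
qed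

text \<open>
  If \<open>\<alpha>\<close> stops, then so does every cube two levels below that is close to \<open>\<alpha>\<close>: its neighbours descend
  from neighbours of \<open>\<alpha>\<close>. Two levels are needed because the dilates may reach half a side length
  beyond the cubes.
\<close>

lemma tiles_graded:
  assumes "\<alpha> \<in> tiles s" "\<beta> \<in> tiles s" "x \<in> dilate c \<alpha>" "x \<in> dilate c \<beta>" "1 \<le> c" "c \<le> 2"
  shows "fst \<beta> \<le> fst \<alpha> + 2"
proof (rule ccontr)
  assume "\<not> fst \<beta> \<le> fst \<alpha> + 2"
  then have k: "fst \<alpha> + 2 < fst \<beta>" by simp
  define p where "p = anc (fst \<alpha> + 2) \<beta>"
  have np: "\<not> stop s p" using assms(2) k by (simp add: tiles_def p_def)
  have "nbr \<alpha> (anc (fst \<alpha>) q)" if q: "nbr p q" for q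
    unfolding nbr_def
  proof safe
    fix i
    define m where "m = snd \<alpha> $ i"
    define b where "b = snd (anc (fst \<alpha> + 3) \<beta>) $ i"
    define y where "y = x $ i * 2 ^ fst \<alpha>"
    have "x \<in> dilate c (anc (fst \<alpha> + 3) \<beta>)"
      using assms k by (intro dilate_anc) auto
    then have 1: "\<bar>8 * y - (b + 1/2)\<bar> < 1"
      using assms(6) dilateD[of x c "anc (fst \<alpha> + 3) \<beta>" i]
      by (simp add: y_def b_def power_add mult.commute mult.left_commute)
    have 2: "\<bar>y - (m + 1/2)\<bar> < 1"
      using assms(6) dilateD[OF assms(3), of i] by (simp add: y_def m_def)
    have pb: "snd p $ i = b div 2"
    proof -
      have "p = anc (fst \<alpha> + 2) (anc (fst \<alpha> + 3) \<beta>)" using k by (simp add: p_def anc_anc)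
      then show ?thesis by (simp add: b_def anc_def)
    qed
    have qp: "\<bar>snd p $ i - snd q $ i\<bar> \<le> 1" using q by (simp add: nbr_def)
    have qa: "snd (anc (fst \<alpha>) q) $ i = snd q $ i div 4"
    proof -
      have "fst q - fst \<alpha> = 2" using nbr_fst[OF q] by (simp add: p_def)
      then show ?thesis by (simp add: anc_def)
    qed
    \<comment> \<open>in units of an eighth of the side of \<open>\<alpha>\<close>: the dilate extends by 4, and \<open>b\<close> belongs to an ancestor of \<open>\<beta>\<close> of side 1\<close>
    have "8 * m - 6 \<le> b" "b \<le> 8 * m + 12" using 1 2 by linarith+
    then have "4 * m - 4 \<le> snd q $ i" "snd q $ i \<le> 4 * m + 7" using pb qp by linarith+
    then have "\<bar>m - snd q $ i div 4\<bar> \<le> 1" by linarith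
    then show "\<bar>snd \<alpha> $ i - snd (anc (fst \<alpha>) q) $ i\<bar> \<le> 1" by (simp add: qa m_def)
  qed simp
  note nb = this
  have "stop s p"
    unfolding stop_def
  proof (intro allI impI)
    fix q assume q: "nbr p q"
    then have "fst q = fst \<alpha> + 2" using nbr_fst[OF q] by (simp add: p_def)
    moreover obtain j where "j \<le> fst \<alpha>" "8 * d * s \<le> clock (anc j (anc (fst \<alpha>) q))"
      using nb[OF q] assms(1) unfolding tiles_def stop_def by blast
    ultimately show "\<exists>j\<le>fst p. 8 * d * s \<le> clock (anc j q)"
      using nbr_fst[OF q] by (intro exI[of _ j]) (auto simp: anc_anc)
  qed
  then show False using np by blast
qed

text \<open>
  The larger weight can belong to either tile. If it belongs to the smaller one, the comparison goes up
  through at most two generations by \<open>tiles_graded\<close>.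
\<close>

lemma tiles_comparable:
  assumes "\<alpha> \<in> tiles s" "\<beta> \<in> tiles s" "x \<in> dilate c \<alpha>" "x \<in> dilate c \<beta>" "1 \<le> c" "c \<le> 2"
  shows "v \<alpha> \<le> v \<beta> + 3 * d"
proof (cases "fst \<alpha> \<le> fst \<beta>")
  case True
  then have "v \<alpha> \<le> v (anc (fst \<alpha>) \<beta>) + d" using assms by (intro v_nbr dilate_nbr_anc)
  then show ?thesis using v_anc[OF True] d_ge_1 by simp
next
  case False
  then have *: "v (anc (fst \<beta>) \<alpha>) \<le> v \<beta> + d"
    using assms by (intro v_nbr nbr_sym[OF dilate_nbr_anc]) auto
  have **: "v \<alpha> \<le> v (anc (fst \<alpha> - j) \<alpha>) + j * d" if "j \<le> fst \<alpha>" for j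
    using that
  proof (induction j)
    case (Suc j)
    have "v (anc (fst \<alpha> - j) \<alpha>) \<le> v (anc (fst \<alpha> - Suc j) (anc (fst \<alpha> - j) \<alpha>)) + d"
      using Suc.prems by (intro v_child) simp
    then show ?case using Suc by (simp add: anc_anc algebra_simps)
  qed simp
  have "fst \<alpha> - fst \<beta> \<le> 2" using tiles_graded[OF assms(2,1,4,3,5,6)] by simp
  then have "real (fst \<alpha> - fst \<beta>) * d \<le> 2 * d" using d_ge_1 by (intro mult_right_mono) auto
  then show ?thesis using **[of "fst \<alpha> - fst \<beta>"] * False by simp
qed

text \<open>
  The clocks of consecutive tilings differ by at most \<open>13 * d\<close>, and the clock advances at least as much
  as \<open>v\<close>.
\<close>

lemma tiles_nested_comparable:
  assumes "\<alpha> \<in> tiles s" "\<alpha>' \<in> tiles (Suc s)" "dyadic \<alpha>' \<subseteq> dyadic \<alpha>"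
  shows "v \<alpha> \<le> v \<alpha>' + 13 * d" "v \<alpha>' \<le> v \<alpha> + 13 * d"
proof -
  obtain x where x: "x \<in> dyadic \<alpha>'" "x \<in> dyadic \<alpha>" using dyadic_nonempty assms(3) by blast
  have lt: "fst \<alpha> < fst \<alpha>'"
    using tiles_Suc_finer[OF assms(2,1), of x 1] x by (simp add: dilate_1)
  have an: "anc (fst \<alpha>) \<alpha>' = \<alpha>"
    using mem_dyadic_imp_cube_at[OF x(1)] mem_dyadic_imp_cube_at[OF x(2)] lt
    by (metis anc_cube_at less_imp_le)
  show "v \<alpha> \<le> v \<alpha>' + 13 * d" using v_anc[of "fst \<alpha>" \<alpha>'] lt an d_ge_1 by simp
  have "v (anc 0 \<alpha>') = v (anc 0 \<alpha>)" using an anc_anc[of 0 "fst \<alpha>" \<alpha>'] lt by simp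
  moreover have "d * N (fst \<alpha>) \<le> d * N (fst \<alpha>')"
    using d_ge_1 N_mono lt by (intro mult_left_mono) auto
  ultimately have "v \<alpha>' - v \<alpha> \<le> clock \<alpha>' - clock \<alpha>" by (simp add: clock_def)
  also have "\<dots> \<le> 8 * d * Suc s + 4 * d - (8 * d * s - d)"
    using tiles_clock_less[OF assms(2)] tiles_clock_ge[OF assms(1)] by linarith
  finally show "v \<alpha>' \<le> v \<alpha> + 13 * d" by (simp add: algebra_simps)
qed

end

lemma sum_powers_le:
  fixes q L :: real
  assumes "finite S" "2 \<le> q" "0 \<le> L" "\<And>s. s \<in> S \<Longrightarrow> q ^ s \<le> L"
  shows "(\<Sum>s\<in>S. q ^ s) \<le> 2 * L"
proof (cases "S = {}")
  case False
  have *: "(\<Sum>s\<le>m. q ^ s) \<le> 2 * q ^ m" for m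
  proof (induction m)
    case (Suc m)
    have "2 * q ^ m \<le> q * q ^ m" using assms(2) by (intro mult_right_mono) auto
    then show ?case using Suc by simp
  qed simp
  have "(\<Sum>s\<in>S. q ^ s) \<le> (\<Sum>s\<le>Max S. q ^ s)"
    using assms(1,2) by (intro sum_mono2) auto
  also have "\<dots> \<le> 2 * q ^ Max S" by (rule *)
  also have "\<dots> \<le> 2 * L" using assms(1,4) False by simp
  finally show ?thesis .
qed (use assms in simp)

context dyadic_clock
begin

text \<open>
  By \<open>tiles_graded\<close> only three levels occur among the tiles whose dilates contain \<open>x\<close>.
\<close>

lemma tiles_card:
  assumes "1 \<le> c" "c \<le> 2"
  shows "finite {\<alpha> \<in> tiles s. x \<in> dilate c \<alpha>}"
    "card {\<alpha> \<in> tiles s. x \<in> dilate c \<alpha>} \<le> 3 * nbr_count TYPE('n)"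
proof -
  let ?A = "{\<alpha> \<in> tiles s. x \<in> dilate c \<alpha>}"
  have "finite ?A \<and> card ?A \<le> 3 * nbr_count TYPE('n)"
  proof (cases "?A = {}")
    case False
    define k where "k = (LEAST k. \<exists>\<alpha>\<in>?A. fst \<alpha> = k)"
    have ex: "\<exists>k. \<exists>\<alpha>\<in>?A. fst \<alpha> = k" using False by blast
    obtain \<alpha> where \<alpha>: "\<alpha> \<in> ?A" "fst \<alpha> = k" using LeastI_ex[OF ex] unfolding k_def by blast
    let ?L = "\<lambda>j. {\<beta> :: 'n idx. fst \<beta> = j \<and> x \<in> dilate c \<beta>}"
    have sub: "?A \<subseteq> ?L k \<union> ?L (k + 1) \<union> ?L (k + 2)"
    proof
      fix \<beta> assume \<beta>: "\<beta> \<in> ?A"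
      then have "k \<le> fst \<beta>" unfolding k_def by (intro Least_le) blast
      moreover have "fst \<beta> \<le> k + 2"
        using \<alpha> \<beta> tiles_graded[OF _ _ _ _ assms, of \<alpha> s \<beta> x] by simp
      ultimately have "fst \<beta> = k \<or> fst \<beta> = k + 1 \<or> fst \<beta> = k + 2" by linarith
      then show "\<beta> \<in> ?L k \<union> ?L (k + 1) \<union> ?L (k + 2)" using \<beta> by blast
    qed
    have fin: "finite (?L k \<union> ?L (k + 1) \<union> ?L (k + 2))"
      using dilate_level_card(1)[OF assms(2)] by blast
    have "card (?L k \<union> ?L (k + 1) \<union> ?L (k + 2)) \<le> 3 * nbr_count TYPE('n)"
      using card_Un_le[of "?L k \<union> ?L (k + 1)" "?L (k + 2)"] card_Un_le[of "?L k" "?L (k + 1)"]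
        dilate_level_card(2)[OF assms(2), of k x] dilate_level_card(2)[OF assms(2), of "k + 1" x]
        dilate_level_card(2)[OF assms(2), of "k + 2" x] by linarith
    then show ?thesis
      using finite_subset[OF sub fin] card_mono[OF fin sub] by linarith
  next
    case True
    show ?thesis unfolding True by simp
  qed
  then show "finite ?A" "card ?A \<le> 3 * nbr_count TYPE('n)" by blast+
qed

text \<open>
  The sum over all tilings is grouped by the value \<open>\<nu>\<close> of \<open>N\<close>. In one group \<open>v\<close> equals
  \<open>8 * d * s - d * \<nu>\<close> up to a bounded error and a constant that depends only on \<open>x\<close>, so the weights
  grow geometrically in \<open>s\<close>. As \<open>v\<close> is almost increasing, none of them exceeds the weight of the
  cube of level \<open>K\<close> at \<open>x\<close> by more than a factor \<open>exp (2 * d)\<close>, hence neither does the sum, up to a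
  constant. There are \<open>N K + 1\<close> groups.
\<close>

lemma clock_sum_bound:
  fixes K :: nat and x :: "real^'n" and c :: real
  assumes c: "1 \<le> c" "c \<le> 2"
  defines "A \<equiv> {\<alpha> \<in> (\<Union>s. tiles s). fst \<alpha> \<le> K \<and> x \<in> dilate c \<alpha>}"
  shows "finite A"
    and "(\<Sum>\<alpha>\<in>A. exp (v \<alpha>)) \<le>
      6 * nbr_count TYPE('n) * exp (9 * d) * (N K + 1) * exp (v (cube_at K x))"
proof -
  have "A \<subseteq> (\<Union>k\<le>K. {\<alpha>. fst \<alpha> = k \<and> x \<in> dilate c \<alpha>})" by (auto simp: A_def)
  then show fin: "finite A"
    by (rule finite_subset) (intro finite_UN_I finite_atMost dilate_level_card(1)[OF c(2)])
  define M where "M = real (3 * nbr_count TYPE('n))"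
  define R where "R = v (cube_at K x)"
  define y where "y = v (cube_at 0 x)"
  have v_le_R: "v \<alpha> \<le> R + 2 * d" if "\<alpha> \<in> A" for \<alpha>
  proof -
    have "v \<alpha> \<le> v (cube_at (fst \<alpha>) x) + d"
      using that c by (intro v_nbr dilate_nbr_cube_at) (auto simp: A_def)
    also have "\<dots> \<le> R + 2 * d"
      using v_anc[of "fst \<alpha>" "cube_at K x"] that by (simp add: A_def R_def anc_cube_at)
    finally show ?thesis .
  qed
  \<comment> \<open>the unit cubes of \<open>\<alpha>\<close> and of \<open>x\<close> are neighbours\<close>
  have v0: "\<bar>v (anc 0 \<alpha>) - y\<bar> \<le> d" if "\<alpha> \<in> A" for \<alpha>
  proof -
    have "nbr (anc 0 \<alpha>) (cube_at 0 x)"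
      using dilate_nbr_cube_at[OF dilate_anc[OF _ c(1), of x \<alpha> 0] c(2)] that by (simp add: A_def)
    then show ?thesis
      using v_nbr[of "anc 0 \<alpha>" "cube_at 0 x"] v_nbr[OF nbr_sym, of "anc 0 \<alpha>" "cube_at 0 x"]
      by (simp add: y_def abs_le_iff)
  qed
  define B where "B \<nu> = {\<alpha>\<in>A. N (fst \<alpha>) = \<nu>}" for \<nu>
  have B_sum: "(\<Sum>\<alpha>\<in>B \<nu>. exp (v \<alpha>)) \<le> 2 * M * exp (9 * d) * exp R" for \<nu>
  proof -
    define S where "S = {s. \<exists>\<alpha>\<in>B \<nu>. \<alpha> \<in> tiles s}"
    have finB: "finite (B \<nu>)" using fin by (simp add: B_def)
    have "S \<subseteq> (\<lambda>\<alpha>. THE s. \<alpha> \<in> tiles s) ` B \<nu>"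
    proof
      fix s assume "s \<in> S"
      then obtain \<alpha> where "\<alpha> \<in> B \<nu>" "\<alpha> \<in> tiles s" by (auto simp: S_def)
      moreover from this have "(THE s. \<alpha> \<in> tiles s) = s" using tiles_disjoint by blast
      ultimately show "s \<in> (\<lambda>\<alpha>. THE s. \<alpha> \<in> tiles s) ` B \<nu>" by force
    qed
    then have finS: "finite S" using finB finite_surj by blast
    have "\<exists>s\<in>S. \<alpha> \<in> tiles s" if "\<alpha> \<in> B \<nu>" for \<alpha>
      using that unfolding S_def B_def A_def by blast
    then have BU: "B \<nu> = (\<Union>s\<in>S. B \<nu> \<inter> tiles s)" by blast
    \<comment> \<open>the clock window of \<open>\<alpha>\<close>, with the unit cube of \<open>\<alpha>\<close> replaced by that of \<open>x\<close>\<close>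
    have upper: "v \<alpha> \<le> 8 * d * s + (5 * d + y - d * \<nu>)"
      and lower: "8 * d * s - (2 * d - y + d * \<nu>) \<le> v \<alpha>" if "\<alpha> \<in> B \<nu>" "\<alpha> \<in> tiles s" for \<alpha> s
      using tiles_clock_less[OF that(2)] tiles_clock_ge[OF that(2)] v0[of \<alpha>] that(1)
      by (auto simp: clock_def B_def abs_le_iff)
    have card: "real (card (B \<nu> \<inter> tiles s)) \<le> M" for s
    proof -
      have "B \<nu> \<inter> tiles s \<subseteq> {\<alpha> \<in> tiles s. x \<in> dilate c \<alpha>}" by (auto simp: B_def A_def)
      from card_mono[OF tiles_card(1)[OF c] this] tiles_card(2)[OF c, of s x]
      show ?thesis unfolding M_def by linarith
    qed
    have geom: "(\<Sum>s\<in>S. exp (8 * d) ^ s) \<le> 2 * exp (R + 4 * d - y + d * \<nu>)"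
    proof (rule sum_powers_le[OF finS])
      show "2 \<le> exp (8 * d)" using d_ge_1 exp_ge_add_one_self[of "8 * d"] by linarith
      show "exp (8 * d) ^ s \<le> exp (R + 4 * d - y + d * \<nu>)" if s: "s \<in> S" for s
      proof -
        obtain \<alpha> where \<alpha>: "\<alpha> \<in> B \<nu>" "\<alpha> \<in> tiles s" using s unfolding S_def by blast
        then have "8 * d * s \<le> R + 4 * d - y + d * \<nu>"
          using lower[OF \<alpha>] v_le_R[of \<alpha>] by (simp add: B_def)
        then show ?thesis by (simp add: exp_of_nat_mult[symmetric] mult.commute)
      qed
    qed simp
    have "(\<Sum>\<alpha>\<in>B \<nu>. exp (v \<alpha>)) = (\<Sum>s\<in>S. \<Sum>\<alpha>\<in>B \<nu> \<inter> tiles s. exp (v \<alpha>))"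
      by (subst BU, rule sum.UNION_disjoint) (use finS finB tiles_disjoint in auto)
    also have "\<dots> \<le> (\<Sum>s\<in>S. M * (exp (8 * d) ^ s * exp (5 * d + y - d * \<nu>)))"
    proof (rule sum_mono)
      fix s
      have "exp (8 * d * s) = exp (8 * d) ^ s" by (simp add: exp_of_nat_mult[symmetric] mult.commute)
      then have "exp (v \<alpha>) \<le> exp (8 * d) ^ s * exp (5 * d + y - d * \<nu>)" if "\<alpha> \<in> B \<nu> \<inter> tiles s" for \<alpha>
        using upper[of \<alpha> s] that by (metis IntD1 IntD2 exp_add exp_le_cancel_iff)
      then have "(\<Sum>\<alpha>\<in>B \<nu> \<inter> tiles s. exp (v \<alpha>)) \<le> card (B \<nu> \<inter> tiles s) * (exp (8 * d) ^ s * exp (5 * d + y - d * \<nu>))"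
        by (intro sum_bounded_above)
      also have "\<dots> \<le> M * (exp (8 * d) ^ s * exp (5 * d + y - d * \<nu>))"
        using card by (intro mult_right_mono) auto
      finally show "(\<Sum>\<alpha>\<in>B \<nu> \<inter> tiles s. exp (v \<alpha>)) \<le> M * (exp (8 * d) ^ s * exp (5 * d + y - d * \<nu>))" .
    qed
    also have "\<dots> = (M * exp (5 * d + y - d * \<nu>)) * (\<Sum>s\<in>S. exp (8 * d) ^ s)"
      unfolding sum_distrib_left by (intro sum.cong refl) (simp only: mult_ac)
    also have "\<dots> \<le> (M * exp (5 * d + y - d * \<nu>)) * (2 * exp (R + 4 * d - y + d * \<nu>))"
      by (intro mult_left_mono geom) (simp add: M_def)
    also have "\<dots> = 2 * M * exp ((5 * d + y - d * \<nu>) + (R + 4 * d - y + d * \<nu>))"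
      by (simp only: exp_add)
    also have "(5 * d + y - d * \<nu>) + (R + 4 * d - y + d * \<nu>) = 9 * d + R" by simp
    also have "2 * M * exp (9 * d + R) = 2 * M * exp (9 * d) * exp R" by (simp add: exp_add)
    finally show ?thesis .
  qed
  have AU: "A = (\<Union>\<nu>\<le>N K. B \<nu>)" using N_mono by (auto simp: B_def A_def)
  have "(\<Sum>\<alpha>\<in>A. exp (v \<alpha>)) = (\<Sum>\<nu>\<le>N K. \<Sum>\<alpha>\<in>B \<nu>. exp (v \<alpha>))"
    by (subst AU, rule sum.UNION_disjoint) (use fin in \<open>auto simp: B_def\<close>)
  also have "\<dots> \<le> (\<Sum>\<nu>\<le>N K. 2 * M * exp (9 * d) * exp R)"
    by (intro sum_mono B_sum)
  finally show "(\<Sum>\<alpha>\<in>A. exp (v \<alpha>)) \<le>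
      6 * nbr_count TYPE('n) * exp (9 * d) * (N K + 1) * exp (v (cube_at K x))"
    by (simp add: M_def R_def mult_ac add.commute)
qed

text \<open>
  The index \<open>9 * s\<close> bounds the levels of the tiling number \<open>s\<close>: for \<open>s \<ge> 1\<close> at least \<open>8 * s + 1\<close> scales have
  been passed at the level \<open>l (9 * s)\<close>, and for \<open>s = 0\<close> all tiles are unit cubes.
\<close>

lemma admissible_tiles:
  fixes l :: "nat \<Rightarrow> nat"
  assumes lam: "0 < lam" "lam \<le> 1" and l: "strict_mono l" "l 0 = 0" "\<And>j. j \<le> N (l j)"
    and w: "\<And>\<alpha>. 0 < weight_mean \<gamma> \<alpha>" "\<And>\<alpha>. v \<alpha> = ln (weight_mean \<gamma> \<alpha>)"
    and c: "exp (3 * d) \<le> c1" "exp (13 * d) \<le> c2"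
  shows "admissible lam c1 c2 \<gamma> tiles"
proof -
  have lam': "1 \<le> 1 + lam" "1 + lam \<le> 2" "1 < 1 + lam" using lam by auto
  have wle: "weight_mean \<gamma> \<alpha> \<le> c * weight_mean \<gamma> \<beta>" if "v \<alpha> \<le> v \<beta> + e" "exp e \<le> c" for \<alpha> \<beta> e c
  proof -
    have eq: "weight_mean \<gamma> \<alpha> = exp (v \<alpha>)" "weight_mean \<gamma> \<beta> = exp (v \<beta>)" using w by simp_all
    have "exp (v \<alpha>) \<le> exp (v \<beta> + e)" using that by simp
    also have "\<dots> \<le> c * exp (v \<beta>)" using that by (simp add: exp_add)
    finally show ?thesis by (simp only: eq)
  qed
  have level: "fst \<alpha> \<le> l (9 * s)" if "\<alpha> \<in> tiles s" for \<alpha> s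
  proof (cases "s = 0")
    case True
    then show ?thesis using that tiles_0 by simp
  next
    case False
    then have "8 * s + 1 \<le> N (l (9 * s))" using l(3)[of "9 * s"] by linarith
    then show ?thesis using that tiles_level_le by blast
  qed
  have c1: "\<forall>s. \<forall>\<alpha>\<in>tiles s. \<forall>\<alpha>'\<in>tiles s. dilate (1 + lam) \<alpha> \<inter> dilate (1 + lam) \<alpha>' \<noteq> {} \<longrightarrow>
        weight_mean \<gamma> \<alpha> \<le> c1 * weight_mean \<gamma> \<alpha>'"
    using tiles_comparable[OF _ _ _ _ lam'(1,2)] wle[OF _ c(1)] by blast
  have c2: "\<forall>s. \<forall>\<alpha>\<in>tiles s. \<forall>\<alpha>'\<in>tiles (Suc s). dyadic \<alpha>' \<subseteq> dyadic \<alpha> \<longrightarrow>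
        weight_mean \<gamma> \<alpha> \<le> c2 * weight_mean \<gamma> \<alpha>' \<and> weight_mean \<gamma> \<alpha>' \<le> c2 * weight_mean \<gamma> \<alpha>"
    using tiles_nested_comparable wle[OF _ c(2)] by blast
  have c3: "Max {side \<alpha>' |\<alpha>'. \<alpha>' \<in> tiles (Suc s) \<and> x \<in> dilate (1 + lam) \<alpha>'}
        \<le> 1 / 2 * Min {side \<alpha> |\<alpha>. \<alpha> \<in> tiles s \<and> x \<in> dilate (1 + lam) \<alpha>}" for s x
  proof -
    define S where "S s = {side \<alpha> |\<alpha>. \<alpha> \<in> tiles s \<and> x \<in> dilate (1 + lam) \<alpha>}" for s
    have S_im: "S s = side ` {\<alpha> \<in> tiles s. x \<in> dilate (1 + lam) \<alpha>}" for s by (auto simp: S_def)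
    have fin: "finite (S s)" for s unfolding S_im by (intro finite_imageI tiles_card(1) lam')
    have ne: "S s \<noteq> {}" for s
    proof -
      obtain k where "cube_at k x \<in> tiles s" using ex_tile_at by blast
      moreover have "x \<in> dilate (1 + lam) (cube_at k x)"
        using mem_closure_cube_at closure_dyadic_subset_dilate[OF lam'(3)] by blast
      ultimately show ?thesis unfolding S_def by blast
    qed
    have "r' \<le> 1 / 2 * r" if rr: "r' \<in> S (Suc s)" "r \<in> S s" for r r'
    proof -
      obtain \<alpha>' where \<alpha>': "r' = side \<alpha>'" "\<alpha>' \<in> tiles (Suc s)" "x \<in> dilate (1 + lam) \<alpha>'"
        using rr(1) unfolding S_def by blast
      obtain \<alpha> where \<alpha>: "r = side \<alpha>" "\<alpha> \<in> tiles s" "x \<in> dilate (1 + lam) \<alpha>"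
        using rr(2) unfolding S_def by blast
      have "Suc (fst \<alpha>) \<le> fst \<alpha>'"
        using tiles_Suc_finer[OF \<alpha>'(2) \<alpha>(2) \<alpha>'(3) \<alpha>(3) lam'(1,2)] by simp
      then have "(2::real) ^ Suc (fst \<alpha>) \<le> 2 ^ fst \<alpha>'" by (intro power_increasing) auto
      then show ?thesis unfolding \<alpha>(1) \<alpha>'(1) side_def by (simp add: field_simps)
    qed
    then show ?thesis unfolding S_def[symmetric] using fin ne by (meson Max_in Min_in)
  qed
  have c4: "strict_mono (\<lambda>s. l (9 * s)) \<and> l (9 * 0) = 0 \<and> (\<forall>s. \<forall>\<alpha>\<in>tiles s. 1 / 2 ^ l (9 * s) \<le> side \<alpha>)"
  proof (intro conjI allI ballI)
    show "strict_mono (\<lambda>s. l (9 * s))" using l(1) by (auto simp: strict_mono_def)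
    show "1 / 2 ^ l (9 * s) \<le> side \<alpha>" if "\<alpha> \<in> tiles s" for s \<alpha>
      using level[OF that] unfolding side_def by (intro divide_left_mono power_increasing) auto
  qed (use l in simp)
  show ?thesis
    unfolding admissible_def
    by (intro conjI system_of_tilings_tiles c1 c2 allI c3) (use c4 in blast)
qed

end


section \<open>Local A1 weights\<close>

lemma measure_open_cube:
  "0 < r \<Longrightarrow> measure lebesgue (open_cube c r :: 'a::euclidean_space set) = r ^ DIM('a)"
  unfolding open_cube_def
  by (subst measure_completion) (auto simp: measure_lborel_box_eq inner_diff_left inner_add_left)

lemma open_cube_lmeasurable [simp]: "open_cube c r \<in> lmeasurable"
  by (simp add: open_cube_def)

lemma mem_open_cube:
  fixes z c :: "'a::euclidean_space"
  shows "z \<in> open_cube c r \<longleftrightarrow> (\<forall>i\<in>Basis. \<bar>(z - c) \<bullet> i\<bar> < r / 2)"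
proof -
  have "(p - r / 2 < y \<and> y < p + r / 2) \<longleftrightarrow> \<bar>y - p\<bar> < r / 2" for p y :: real
    unfolding abs_less_iff by linarith
  note * = this
  have "One \<bullet> i = (1 :: real)" if "i \<in> Basis" for i :: 'a
    using that by simp
  then show ?thesis
    unfolding open_cube_def mem_box
    by (intro ball_cong refl) (simp only: inner_diff_left inner_add_left inner_scaleR_left mult_1_right *)
qed

lemma open_cube_prod:
  "open_cube (c, s) r = open_cube c r \<times> {s - r / 2<..<s + r / (2::real)}"
proof -
  have "\<bar>y - s\<bar> < r / 2 \<longleftrightarrow> y \<in> {s - r / 2<..<s + r / 2}" for y
    unfolding abs_less_iff greaterThanLessThan_iff by linarith
  moreover have "(x, y) \<in> open_cube (c, s) r \<longleftrightarrow> x \<in> open_cube c r \<and> \<bar>y - s\<bar> < r / 2" for x y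
    unfolding mem_open_cube Basis_prod_def by auto
  ultimately show ?thesis by auto
qed

lemma weight_integrable:
  assumes "weight \<gamma>" shows "integrable lebesgue (\<lambda>z. indicator (open_cube c r) z * \<gamma> z)"
proof -
  let ?K = "cbox (c - (r / 2) *\<^sub>R One) (c + (r / 2) *\<^sub>R One)"
  have "set_integrable lebesgue ?K \<gamma>"
    using assms by (simp add: weight_def locally_L1_def)
  then have "set_integrable lebesgue (open_cube c r) \<gamma>"
    by (rule set_integrable_subset) (auto simp: open_cube_def box_subset_cbox[THEN subsetD])
  then show ?thesis by (simp add: set_integrable_def)
qed

lemma mean_weight_pos:
  assumes w: "weight \<gamma>" and r: "0 < r"
  shows "0 < mean (open_cube c r) \<gamma>"
proof -
  let ?K = "open_cube c r"
  have pos: "AE z in lebesgue. 0 < \<gamma> z" using w by (simp add: weight_def)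
  then have nn: "AE z in lebesgue. 0 \<le> indicator ?K z * \<gamma> z"
    by eventually_elim (auto simp: indicator_def)
  have "(\<integral>z. indicator ?K z * \<gamma> z \<partial>lebesgue) \<noteq> 0"
  proof
    assume "(\<integral>z. indicator ?K z * \<gamma> z \<partial>lebesgue) = 0"
    then have "AE z in lebesgue. indicator ?K z * \<gamma> z = 0"
      using integral_nonneg_eq_0_iff_AE[OF weight_integrable[OF w] nn] by simp
    then have "AE z in lebesgue. z \<notin> ?K"
      using pos by eventually_elim (auto simp: indicator_def)
    then have "emeasure lebesgue ?K = 0"
      by (subst (asm) AE_iff_measurable[of ?K]) (auto simp: open_cube_def)
    then have "measure lebesgue ?K = 0" by (simp add: measure_def)
    then show False using r by (simp add: measure_open_cube)
  qed
  moreover have "0 \<le> (\<integral>z. indicator ?K z * \<gamma> z \<partial>lebesgue)"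
    using nn by (rule integral_nonneg_AE)
  ultimately show ?thesis
    using r by (simp add: mean_def set_lebesgue_integral_def measure_open_cube)
qed

text \<open>
  This is the only form in which the A1 inequality enters the proof: the essential infimum is replaced by
  the values of \<open>\<gamma>\<close> almost everywhere.
\<close>

lemma A1_AE:
  assumes A1: "A1_loc C \<gamma>" and r: "0 < r" "r \<le> 1"
  shows "AE z in lebesgue. z \<in> open_cube c r \<longrightarrow> mean (open_cube c r) \<gamma> \<le> C * \<gamma> z"
proof -
  let ?K = "open_cube c r"
  have C: "1 \<le> C" and le: "ereal (mean ?K \<gamma>) \<le> ereal C * ess_inf ?K \<gamma>"
    using A1 r by (auto simp: A1_loc_def)
  have "AE z in lebesgue_on ?K. - ereal (\<gamma> z) \<le> esssup (lebesgue_on ?K) (\<lambda>z. - ereal (\<gamma> z))"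
    by (rule esssup_AE)
  then have "AE z in lebesgue. z \<in> ?K \<longrightarrow> - ereal (\<gamma> z) \<le> esssup (lebesgue_on ?K) (\<lambda>z. - ereal (\<gamma> z))"
    by (subst (asm) AE_restrict_space_iff) (auto simp: open_cube_def)
  then show ?thesis
  proof eventually_elim
    case (elim z)
    show ?case
    proof
      assume "z \<in> ?K"
      then have "ess_inf ?K \<gamma> \<le> ereal (\<gamma> z)"
        using elim ereal_uminus_le_reorder unfolding ess_inf_def by blast
      then have "ereal C * ess_inf ?K \<gamma> \<le> ereal C * ereal (\<gamma> z)"
        using C by (intro ereal_mult_left_mono) auto
      then have "ereal (mean ?K \<gamma>) \<le> ereal (C * \<gamma> z)" using le by (metis order_trans times_ereal.simps(1))
      then show "mean ?K \<gamma> \<le> C * \<gamma> z" by simp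
    qed
  qed
qed

text \<open>
  Two cubes that share a smaller cube of comparable size have comparable means: integrate the pointwise
  bound over the common cube, then enlarge it to the second cube.
\<close>

lemma A1_overlap:
  fixes \<gamma> :: "'a::euclidean_space \<Rightarrow> real"
  assumes A1: "A1_loc C \<gamma>" and r: "0 < r" "r \<le> 1" and p: "0 < p" "0 < q"
    and sub: "open_cube b p \<subseteq> open_cube c r" "open_cube b p \<subseteq> open_cube a q"
    and ratio: "q \<le> 2 * p"
  shows "mean (open_cube c r) \<gamma> \<le> C * 2 ^ DIM('a) * mean (open_cube a q) \<gamma>"
proof -
  let ?S = "open_cube b p"
  have w: "weight \<gamma>" and C: "1 \<le> C" using A1 by (auto simp: A1_loc_def)
  have pos: "AE z in lebesgue. 0 < \<gamma> z" using w by (simp add: weight_def)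
  have "mean (open_cube c r) \<gamma> * p ^ DIM('a) = (\<integral>z. indicator ?S z * mean (open_cube c r) \<gamma> \<partial>lebesgue)"
    using p by (simp add: measure_open_cube mult.commute)
  also have "\<dots> \<le> (\<integral>z. C * (indicator ?S z * \<gamma> z) \<partial>lebesgue)"
  proof (rule integral_mono_AE)
    show "AE z in lebesgue. indicator ?S z * mean (open_cube c r) \<gamma> \<le> C * (indicator ?S z * \<gamma> z)"
      using A1_AE[OF A1 r, of c] by eventually_elim (use sub in \<open>auto simp: indicator_def\<close>)
    have "?S \<in> sets lebesgue" "emeasure lebesgue ?S < \<infinity>"
      using open_cube_lmeasurable[of b p] unfolding fmeasurable_def by blast+
    from integrable_real_indicator[OF this]
    show "integrable lebesgue (\<lambda>z. indicator ?S z * mean (open_cube c r) \<gamma>)"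
      by (intro integrable_mult_left)
    show "integrable lebesgue (\<lambda>z. C * (indicator ?S z * \<gamma> z))"
      using weight_integrable[OF w] by simp
  qed
  also have "\<dots> = C * (\<integral>z. indicator ?S z * \<gamma> z \<partial>lebesgue)" by simp
  also have "\<dots> \<le> C * (\<integral>z. indicator (open_cube a q) z * \<gamma> z \<partial>lebesgue)"
  proof (intro mult_left_mono integral_mono_AE weight_integrable[OF w])
    show "AE z in lebesgue. indicator ?S z * \<gamma> z \<le> indicator (open_cube a q) z * \<gamma> z"
      using pos by eventually_elim (use sub in \<open>auto simp: indicator_def\<close>)
  qed (use C in simp)
  also have "(\<integral>z. indicator (open_cube a q) z * \<gamma> z \<partial>lebesgue) = mean (open_cube a q) \<gamma> * q ^ DIM('a)"
    using p by (simp add: mean_def set_lebesgue_integral_def measure_open_cube)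
  also have "C * \<dots> \<le> C * (mean (open_cube a q) \<gamma> * (2 * p) ^ DIM('a))"
    using C ratio p mean_weight_pos[OF w p(2), of a]
    by (intro mult_left_mono power_mono) auto
  finally have "mean (open_cube c r) \<gamma> * p ^ DIM('a) \<le> (C * 2 ^ DIM('a) * mean (open_cube a q) \<gamma>) * p ^ DIM('a)"
    by (simp add: power_mult_distrib mult_ac)
  then show ?thesis using p(1) by simp
qed

lemma side_bounds: "0 < side \<alpha>" "side \<alpha> \<le> 1"
  by (auto simp: side_def)

text \<open>
  The cube over which \<open>weight_mean\<close> averages; it has the same side in all \<open>n + 1\<close> directions.
\<close>

definition weight_cube :: "'n idx \<Rightarrow> ((real^'n::finite) \<times> real) set" where
  "weight_cube \<alpha> = dyadic \<alpha> \<times> {0<..<side \<alpha>}"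

definition weight_centre :: "'n idx \<Rightarrow> (real^'n::finite) \<times> real" where
  "weight_centre \<alpha> = (\<chi> i. (of_int (snd \<alpha> $ i) + 1 / 2) / 2 ^ fst \<alpha>, side \<alpha> / 2)"

lemma weight_cube_eq: "weight_cube \<alpha> = open_cube (weight_centre \<alpha>) (side \<alpha>)"
  unfolding weight_cube_def weight_centre_def open_cube_prod dilate_1[symmetric] dilate_def by simp

lemma weight_mean_eq: "weight_mean \<gamma> \<alpha> = mean (weight_cube \<alpha>) \<gamma>"
  by (simp add: weight_mean_def weight_cube_def)

lemma weight_mean_pos: "weight \<gamma> \<Longrightarrow> 0 < weight_mean \<gamma> \<alpha>"
  unfolding weight_mean_eq weight_cube_eq by (rule mean_weight_pos[OF _ side_bounds(1)])

section \<open>Scales and the growth of a local A1 weight\<close>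

lemma lower_strip_sets: "{z :: 'a::euclidean_space \<times> real. snd z < c} \<in> sets lebesgue"
proof -
  have "open {z :: 'a \<times> real. snd z < c}"
    by (intro open_Collect_less continuous_intros)
  then have "{z :: 'a \<times> real. snd z < c} \<in> sets borel" by simp
  then show ?thesis by simp
qed

text \<open>
  The integrals of \<open>H\<close> over the strips \<open>0 < t < 2^(- p)\<close> tend to 0 by dominated convergence, so a strictly
  increasing sequence of scales can be chosen recursively. The bounds are relative to the whole
  integral, which makes the statement trivial when that integral vanishes.
\<close>

lemma vanishing_tails:
  fixes H :: "'a::euclidean_space \<times> real \<Rightarrow> ennreal"
  assumes H[measurable]: "H \<in> borel_measurable lebesgue" and fin: "(\<integral>\<^sup>+z. H z \<partial>lebesgue) < \<infinity>"
    and pos: "\<And>z. snd z \<le> 0 \<Longrightarrow> H z = 0"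
  obtains l :: "nat \<Rightarrow> nat" where "strict_mono l" "l 0 = 0"
    "\<And>j. (\<integral>\<^sup>+z. H z * indicator {z. snd z < 1 / 2 ^ l (Suc j)} z \<partial>lebesgue)
      \<le> ennreal ((1/2) ^ Suc j) * (\<integral>\<^sup>+z. H z \<partial>lebesgue)"
proof -
  define T where "T = (\<integral>\<^sup>+z. H z \<partial>lebesgue)"
  define tail where "tail p = (\<integral>\<^sup>+z. H z * indicator {z. snd z < 1 / 2 ^ p} z \<partial>lebesgue)" for p :: nat
  note lower_strip_sets[measurable]
  have mono: "tail q \<le> tail p" if "p \<le> q" for p q
    unfolding tail_def
  proof (intro nn_integral_mono mult_left_mono)
    fix z :: "'a \<times> real"
    have "(1::real) / 2 ^ q \<le> 1 / 2 ^ p"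
      using that by (intro divide_left_mono power_increasing) auto
    then show "indicator {z. snd z < 1 / 2 ^ q} z \<le> (indicator {z. snd z < 1 / 2 ^ p} z :: ennreal)"
      by (auto simp: indicator_def)
  qed simp
  have lim: "tail \<longlonglongrightarrow> (\<integral>\<^sup>+z. 0 \<partial>(lebesgue :: ('a \<times> real) measure))"
    unfolding tail_def
  proof (rule nn_integral_dominated_convergence[where w = H])
    show "AE z in lebesgue. (\<lambda>p. H z * indicator {z. snd z < 1 / 2 ^ p} z) \<longlonglongrightarrow> 0"
    proof (intro AE_I2)
      fix z :: "'a \<times> real"
      show "(\<lambda>p. H z * indicator {z. snd z < 1 / 2 ^ p} z) \<longlonglongrightarrow> 0"
      proof (cases "snd z \<le> 0")
        case False
        then obtain p where p: "(1/2::real) ^ p < snd z"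
          using real_arch_pow_inv[of "snd z" "1/2"] by auto
        have "H z * indicator {z. snd z < 1 / 2 ^ q} z = 0" if "p \<le> q" for q
        proof -
          have "(1/2::real) ^ q \<le> (1/2) ^ p" using that by (intro power_decreasing) auto
          then show ?thesis using p by (simp add: indicator_def power_one_over)
        qed
        then have "\<forall>\<^sub>F q in sequentially. 0 = H z * indicator {z. snd z < 1 / 2 ^ q} z"
          unfolding eventually_sequentially by (intro exI[of _ p]) simp
        then show ?thesis by (rule Lim_transform_eventually[OF tendsto_const])
      qed (simp add: pos)
    qed
    show "AE z in lebesgue. H z * indicator {z. snd z < 1 / 2 ^ p} z \<le> H z" for p
      by (intro AE_I2) (simp add: indicator_def)
  qed (use fin in \<open>simp_all\<close>)
  have "\<exists>p. tail p \<le> ennreal ((1/2) ^ j) * T" for j :: nat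
  proof (cases "T = 0")
    case True
    have "tail 0 \<le> T" unfolding tail_def T_def
      by (intro nn_integral_mono) (simp add: indicator_def)
    then have "tail 0 \<le> ennreal ((1/2) ^ j) * T" unfolding True mult_zero_right .
    then show ?thesis ..
  next
    case False
    then have "0 < ennreal ((1/2) ^ j) * T" unfolding ennreal_zero_less_mult_iff by (auto intro: gr_zeroI)
    then have "\<forall>\<^sub>F p in sequentially. tail p < ennreal ((1/2) ^ j) * T"
      using order_tendstoD(2)[OF lim] by simp
    then obtain p where "tail p < ennreal ((1/2) ^ j) * T"
      using eventually_happens'[OF sequentially_bot] by blast
    then show ?thesis by (intro exI[of _ p] less_imp_le)
  qed
  then obtain p where p: "\<And>j. tail (p j) \<le> ennreal ((1/2) ^ j) * T" by metis
  define l where "l = rec_nat 0 (\<lambda>j m. max (Suc m) (p (Suc j)))"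
  have l: "l 0 = 0" "l (Suc j) = max (Suc (l j)) (p (Suc j))" for j by (simp_all add: l_def)
  show ?thesis
  proof (rule that[of l])
    show "strict_mono l" by (rule strict_monoI_Suc) (simp add: l)
    show "(\<integral>\<^sup>+z. H z * indicator {z. snd z < 1 / 2 ^ l (Suc j)} z \<partial>lebesgue)
      \<le> ennreal ((1/2) ^ Suc j) * (\<integral>\<^sup>+z. H z \<partial>lebesgue)" for j
      unfolding tail_def[symmetric] T_def[symmetric]
      by (rule order_trans[OF mono p]) (simp add: l)
  qed (rule l)
qed

definition scale_count :: "(nat \<Rightarrow> nat) \<Rightarrow> nat \<Rightarrow> nat" where
  "scale_count l k = card {j. 1 \<le> j \<and> l j \<le> k}"

lemma scale_count:
  assumes "strict_mono l" "l 0 = 0"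
  shows "finite {j. 1 \<le> j \<and> l j \<le> k}" "scale_count l 0 = 0" "j \<le> k \<Longrightarrow> scale_count l j \<le> scale_count l k"
    "scale_count l (Suc k) \<le> Suc (scale_count l k)" "i \<le> scale_count l (l i)"
proof -
  have ge: "j \<le> l j" for j using assms(1) by (rule strict_mono_imp_increasing)
  show fin: "finite {j. 1 \<le> j \<and> l j \<le> k}" for k
    by (rule finite_subset[of _ "{..k}"]) (use ge order_trans in auto)
  have "\<not> l j \<le> 0" if "1 \<le> j" for j using ge[of j] that by simp
  then show "scale_count l 0 = 0" unfolding scale_count_def by (metis (no_types, lifting) card.empty empty_Collect_eq)
  show "scale_count l j \<le> scale_count l k" if "j \<le> k" for j k
    unfolding scale_count_def by (rule card_mono[OF fin]) (use that in auto)
  show "scale_count l (Suc k) \<le> Suc (scale_count l k)"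
  proof (cases "\<exists>i. l i = Suc k")
    case True
    then obtain i where i: "l i = Suc k" by blast
    have "j = i" if "l j = Suc k" for j using that i strict_mono_eq[OF assms(1)] by metis
    then have "{j. 1 \<le> j \<and> l j \<le> Suc k} \<subseteq> insert i {j. 1 \<le> j \<and> l j \<le> k}" by (auto simp: le_Suc_eq)
    then have "scale_count l (Suc k) \<le> card (insert i {j. 1 \<le> j \<and> l j \<le> k})"
      unfolding scale_count_def by (rule card_mono[rotated]) (use fin in simp)
    also have "\<dots> \<le> Suc (scale_count l k)"
      unfolding scale_count_def by (rule card_insert_le_m1[rotated]) simp_all
    finally show ?thesis .
  next
    case False
    then have "{j. 1 \<le> j \<and> l j \<le> Suc k} = {j. 1 \<le> j \<and> l j \<le> k}" by (auto simp: le_Suc_eq)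
    then show ?thesis by (simp add: scale_count_def)
  qed
  have "card {1..i} \<le> scale_count l (l i)"
    unfolding scale_count_def by (rule card_mono[OF fin]) (use strict_mono_less_eq[OF assms(1)] in auto)
  then show "i \<le> scale_count l (l i)" by simp
qed

text \<open>
  Rewrites the number of groups in \<open>clock_sum_bound\<close> as a series of indicators of strips, ready for
  integration.
\<close>

lemma scale_count_le_suminf:
  fixes t :: real
  assumes l: "strict_mono l" "l 0 = 0" and t: "t < 1 / 2 ^ K"
  shows "of_nat (scale_count l K) \<le> (\<Sum>j. indicator {t. t < 1 / 2 ^ l (Suc j)} t :: ennreal)"
proof -
  let ?J = "{j. 1 \<le> j \<and> l j \<le> K}"
  let ?f = "\<lambda>j. indicator {t. t < 1 / 2 ^ l (Suc j)} t :: ennreal"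
  have fin: "finite ?J" by (rule scale_count(1)[OF l])
  have one: "?f (j - 1) = 1" if "j \<in> ?J" for j
  proof -
    have "(1::real) / 2 ^ K \<le> 1 / 2 ^ l j" using that by (intro divide_left_mono power_increasing) auto
    then show ?thesis using t that by simp
  qed
  have "of_nat (scale_count l K) = (\<Sum>j\<in>?J. ?f (j - 1))"
    unfolding scale_count_def using one by simp
  also have "\<dots> = (\<Sum>i\<in>(\<lambda>j. j - 1) ` ?J. ?f i)"
    by (subst sum.reindex) (auto simp: inj_on_def)
  also have "\<dots> \<le> (\<Sum>j. ?f j)"
    by (rule sum_le_suminf) (use fin in auto)
  finally show ?thesis .
qed


lemma weight_cube_anc:
  assumes "j \<le> fst \<alpha>" shows "weight_cube \<alpha> \<subseteq> weight_cube (anc j \<alpha>)"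
proof -
  have "dyadic \<alpha> \<subseteq> dyadic (anc j \<alpha>)"
    using dilate_anc[of _ 1 \<alpha> j] assms by (auto simp: dilate_1)
  moreover have "side \<alpha> \<le> side (anc j \<alpha>)"
    using assms unfolding side_def by (intro divide_left_mono power_increasing) auto
  ultimately show ?thesis by (auto simp: weight_cube_def)
qed

lemma DIM_half_space: "DIM((real^'n) \<times> real) = CARD('n) + 1"
  by simp

lemma A1_anc:
  fixes \<gamma> :: "(real^'n) \<times> real \<Rightarrow> real"
  assumes "A1_loc C \<gamma>" "j \<le> fst \<alpha>"
  shows "weight_mean \<gamma> (anc j \<alpha>) \<le> C * 2 ^ (CARD('n) + 1) * weight_mean \<gamma> \<alpha>"
  using A1_overlap[OF assms(1) side_bounds[of "anc j \<alpha>"] side_bounds(1)[of \<alpha>] side_bounds(1)[of \<alpha>],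
      of "weight_centre \<alpha>" "weight_centre (anc j \<alpha>)" "weight_centre \<alpha>"]
    weight_cube_anc[OF assms(2)] side_bounds(1)[of \<alpha>]
  unfolding weight_mean_eq weight_cube_eq DIM_half_space by simp

lemma A1_child:
  fixes \<gamma> :: "(real^'n) \<times> real \<Rightarrow> real"
  assumes "A1_loc C \<gamma>" "fst \<alpha> = Suc k"
  shows "weight_mean \<gamma> \<alpha> \<le> C * 2 ^ (CARD('n) + 1) * weight_mean \<gamma> (anc k \<alpha>)"
proof -
  have "side (anc k \<alpha>) \<le> 2 * side \<alpha>" using assms(2) by (simp add: side_def)
  then show ?thesis
    using A1_overlap[OF assms(1) side_bounds[of \<alpha>] side_bounds(1)[of \<alpha>] side_bounds(1)[of "anc k \<alpha>"],
      of "weight_centre \<alpha>" "weight_centre \<alpha>" "weight_centre (anc k \<alpha>)"] weight_cube_anc[of k \<alpha>] assms(2)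
    unfolding weight_mean_eq weight_cube_eq DIM_half_space by simp
qed

text \<open>
  The two cubes share the cube of half the side around the midpoint of their centres.
\<close>

lemma A1_half_shift:
  fixes \<gamma> :: "'a::euclidean_space \<Rightarrow> real"
  assumes A1: "A1_loc C \<gamma>" and r: "0 < r" "r \<le> 1" and close: "\<And>i. i \<in> Basis \<Longrightarrow> \<bar>(c - c') \<bullet> i\<bar> \<le> r / 2"
  shows "mean (open_cube c r) \<gamma> \<le> C * 2 ^ DIM('a) * mean (open_cube c' r) \<gamma>"
proof (rule A1_overlap[OF A1 r, where b = "(1/2) *\<^sub>R (c + c')" and p = "r / 2"])
  have *: "\<bar>(z - c) \<bullet> i\<bar> < r / 2 \<and> \<bar>(z - c') \<bullet> i\<bar> < r / 2"
    if "z \<in> open_cube ((1/2) *\<^sub>R (c + c')) (r / 2)" "i \<in> Basis" for z i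
  proof -
    have a: "\<bar>z \<bullet> i - (c \<bullet> i + c' \<bullet> i) / 2\<bar> < r / 4"
      using that unfolding mem_open_cube by (simp add: inner_diff_left inner_add_left)
    have b: "\<bar>c \<bullet> i - c' \<bullet> i\<bar> \<le> r / 2"
      using close[OF that(2)] by (simp add: inner_diff_left)
    have key: "\<bar>y - p\<bar> < r / 2 \<and> \<bar>y - q\<bar> < r / 2"
      if "\<bar>y - (p + q) / 2\<bar> < r / 4" "\<bar>p - q\<bar> \<le> r / 2" for y p q :: real
      using that by argo
    from key[OF a b] show ?thesis by (simp add: inner_diff_left)
  qed
  then show "open_cube ((1/2) *\<^sub>R (c + c')) (r / 2) \<subseteq> open_cube c r"
    "open_cube ((1/2) *\<^sub>R (c + c')) (r / 2) \<subseteq> open_cube c' r"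
    unfolding mem_open_cube subset_iff by blast+
qed (use r in auto)

text \<open>
  Neighbouring cubes may be disjoint; the cube half way between them overlaps both.
\<close>

lemma A1_nbr:
  fixes \<gamma> :: "(real^'n) \<times> real \<Rightarrow> real"
  assumes A1: "A1_loc C \<gamma>" and nb: "nbr \<alpha> \<beta>"
  shows "weight_mean \<gamma> \<alpha> \<le> (C * 2 ^ (CARD('n) + 1))\<^sup>2 * weight_mean \<gamma> \<beta>"
proof -
  define r where "r = side \<alpha>"
  have r: "0 < r" "r \<le> 1" "side \<beta> = r"
    using side_bounds[of \<alpha>] nbr_fst[OF nb] by (auto simp: r_def side_def)
  define c c' where "c = weight_centre \<alpha>" and "c' = weight_centre \<beta>"
  define b where "b = (1/2) *\<^sub>R (c + c')"
  have C: "1 \<le> C" using A1 by (simp add: A1_loc_def)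
  have close: "\<bar>(c - c') \<bullet> i\<bar> \<le> r" if i: "i \<in> Basis" for i
  proof (cases "\<exists>j. i = (axis j 1, 0)")
    case True
    then obtain j where j: "i = (axis j 1, 0)" by blast
    have "\<bar>snd \<alpha> $ j - snd \<beta> $ j\<bar> \<le> 1" using nb by (simp add: nbr_def)
    then have "\<bar>real_of_int (snd \<alpha> $ j) - real_of_int (snd \<beta> $ j)\<bar> \<le> 1" by linarith
    then have "\<bar>real_of_int (snd \<alpha> $ j) - real_of_int (snd \<beta> $ j)\<bar> / 2 ^ fst \<alpha> \<le> 1 / 2 ^ fst \<alpha>"
      by (intro divide_right_mono) auto
    moreover have "(c - c') \<bullet> i = (real_of_int (snd \<alpha> $ j) - real_of_int (snd \<beta> $ j)) / 2 ^ fst \<alpha>"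
      using nbr_fst[OF nb]
      by (simp add: c_def c'_def weight_centre_def j inner_axis diff_divide_distrib[symmetric] algebra_simps)
    ultimately show ?thesis by (simp add: r_def side_def)
  next
    case False
    then have "i = (0, 1)" using i by (auto simp: Basis_prod_def Basis_vec_def)
    then show ?thesis using r by (simp add: c_def c'_def weight_centre_def r_def)
  qed
  have "\<bar>(c - b) \<bullet> i\<bar> \<le> r / 2" "\<bar>(b - c') \<bullet> i\<bar> \<le> r / 2" if "i \<in> Basis" for i
  proof -
    have "c - b = (1/2) *\<^sub>R (c - c')" "b - c' = (1/2) *\<^sub>R (c - c')"
      unfolding b_def by (simp_all add: algebra_simps scaleR_half_double flip: scaleR_left.add)
    then show "\<bar>(c - b) \<bullet> i\<bar> \<le> r / 2" "\<bar>(b - c') \<bullet> i\<bar> \<le> r / 2"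
      using close[OF that] by (simp_all add: abs_mult)
  qed
  note s = this
  define E where "E = C * 2 ^ (CARD('n) + 1)"
  have "mean (open_cube c r) \<gamma> \<le> E * mean (open_cube b r) \<gamma>"
    using A1_half_shift[OF A1 r(1,2) s(1)] unfolding E_def DIM_half_space .
  also have "\<dots> \<le> E * (E * mean (open_cube c' r) \<gamma>)"
    using A1_half_shift[OF A1 r(1,2) s(2)] C unfolding E_def DIM_half_space by (intro mult_left_mono) auto
  finally show ?thesis
    unfolding weight_mean_eq weight_cube_eq r(3) E_def[symmetric] c_def c'_def r_def[symmetric]
    by (simp add: power2_eq_square mult.assoc)
qed

text \<open>
  Writing \<open>E = C * 2 ^ (n + 1)\<close>, ancestors and children are compared with the constant \<open>E\<close> and neighbours
  with \<open>E\<^sup>2\<close>, so \<open>d = ln (E\<^sup>2)\<close> serves for all three; \<open>d \<ge> 1\<close> because \<open>E \<ge> 4\<close>.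
\<close>

lemma A1_dyadic_clock:
  fixes \<gamma> :: "(real^'n) \<times> real \<Rightarrow> real"
  assumes A1: "A1_loc C \<gamma>" and l: "strict_mono l" "l 0 = 0"
  shows "dyadic_clock (\<lambda>\<alpha>. ln (weight_mean \<gamma> \<alpha>)) (ln ((C * 2 ^ (CARD('n) + 1))\<^sup>2)) (scale_count l)"
proof -
  have w: "weight \<gamma>" and C: "1 \<le> C" using A1 by (auto simp: A1_loc_def)
  define E where "E = C * 2 ^ (CARD('n) + 1)"
  have "(2::real) ^ 2 \<le> 2 ^ (CARD('n) + 1)" by (intro power_increasing) (simp_all add: Suc_le_eq)
  then have E: "4 \<le> E" using C mult_mono[of 1 C 4 "2 ^ (CARD('n) + 1)"] by (simp add: E_def)
  have E2: "E * 1 \<le> E\<^sup>2" unfolding power2_eq_square using E by (intro mult_left_mono) auto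
  have pos: "0 < weight_mean \<gamma> \<alpha>" for \<alpha> by (rule weight_mean_pos[OF w])
  have ln_le: "ln (weight_mean \<gamma> \<alpha>) \<le> ln (weight_mean \<gamma> \<beta>) + ln (E\<^sup>2)"
    if "weight_mean \<gamma> \<alpha> \<le> E\<^sup>2 * weight_mean \<gamma> \<beta>" for \<alpha> \<beta>
  proof -
    have "ln (weight_mean \<gamma> \<alpha>) \<le> ln (E\<^sup>2 * weight_mean \<gamma> \<beta>)"
      using that pos[of \<alpha>] by (intro ln_mono) auto
    then show ?thesis using E pos[of \<beta>] by (simp add: ln_mult)
  qed
  have up: "weight_mean \<gamma> \<alpha> \<le> E\<^sup>2 * weight_mean \<gamma> \<beta>" if "weight_mean \<gamma> \<alpha> \<le> E * weight_mean \<gamma> \<beta>" for \<alpha> \<beta>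
  proof (rule order_trans[OF that mult_right_mono])
    show "E \<le> E\<^sup>2" using E2 by simp
  qed (use pos[of \<beta>] in simp)
  show ?thesis
    unfolding E_def[symmetric]
  proof unfold_locales
    have "exp 1 \<le> (3::real)" by (rule exp_le)
    then have "exp 1 \<le> E\<^sup>2" using E E2 by simp
    then show "1 \<le> ln (E\<^sup>2)" using E by (subst ln_ge_iff) auto
    show "ln (weight_mean \<gamma> (anc j \<alpha>)) - ln (E\<^sup>2) \<le> ln (weight_mean \<gamma> \<alpha>)" if "j \<le> fst \<alpha>" for j \<alpha>
      using ln_le[OF up[OF A1_anc[OF A1 that, folded E_def]]] by simp
    show "ln (weight_mean \<gamma> \<alpha>) \<le> ln (weight_mean \<gamma> \<beta>) + ln (E\<^sup>2)" if "nbr \<alpha> \<beta>" for \<alpha> \<beta>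
      using ln_le[OF A1_nbr[OF A1 that, folded E_def]] .
    show "ln (weight_mean \<gamma> \<alpha>) \<le> ln (weight_mean \<gamma> (anc k \<alpha>)) + ln (E\<^sup>2)" if "fst \<alpha> = Suc k" for k \<alpha>
      using ln_le[OF up[OF A1_child[OF A1 that, folded E_def]]] .
  qed (use scale_count[OF l] in blast)+
qed

definition good_point :: "real \<Rightarrow> ((real^'n) \<times> real \<Rightarrow> real) \<Rightarrow> (real^'n::finite) \<times> real \<Rightarrow> bool" where
  "good_point C \<gamma> z \<longleftrightarrow> 0 < \<gamma> z \<and>
    (\<forall>k. 0 < snd z \<and> snd z < 1 / 2 ^ k \<longrightarrow> weight_mean \<gamma> (cube_at k (fst z)) \<le> C * \<gamma> z)"

text \<open>
  There are countably many cubes, so the A1 bounds hold simultaneously off a null set. The boundaries of the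
  cubes are removed as well, since \<open>cube_at\<close> only yields a point of the closed cube.
\<close>

lemma A1_good_points:
  fixes \<gamma> :: "(real^'n) \<times> real \<Rightarrow> real"
  assumes A1: "A1_loc C \<gamma>"
  shows "AE z in lebesgue. good_point C \<gamma> z"
proof -
  have pos: "AE z in lebesgue. 0 < \<gamma> z" using A1 by (simp add: A1_loc_def weight_def)
  have "AE z in lebesgue. \<forall>\<alpha> :: 'n idx. z \<in> weight_cube \<alpha> \<longrightarrow> weight_mean \<gamma> \<alpha> \<le> C * \<gamma> z"
    unfolding AE_all_countable weight_mean_eq weight_cube_eq
    by (intro allI A1_AE[OF A1 side_bounds])
  moreover have "AE z in lebesgue. \<forall>\<alpha> :: 'n idx. z \<in> closure (dyadic \<alpha>) \<times> {0<..<side \<alpha>} \<longrightarrow> z \<in> weight_cube \<alpha>"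
    unfolding AE_all_countable
  proof
    fix \<alpha> :: "'n idx"
    define a b where "a = weight_centre \<alpha> - (side \<alpha> / 2) *\<^sub>R One" and "b = weight_centre \<alpha> + (side \<alpha> / 2) *\<^sub>R One"
    have box: "weight_cube \<alpha> = box a b" unfolding weight_cube_eq open_cube_def a_def b_def ..
    have "box a b \<noteq> {}"
      unfolding box[symmetric] weight_cube_def using dyadic_nonempty[of \<alpha>] side_bounds(1)[of \<alpha>] by auto
    then have "cbox a b = closure (weight_cube \<alpha>)" unfolding box by simp
    also have "\<dots> = closure (dyadic \<alpha>) \<times> closure {0<..<side \<alpha>}" unfolding weight_cube_def by (rule closure_Times)
    finally have sub: "closure (dyadic \<alpha>) \<times> {0<..<side \<alpha>} \<subseteq> cbox a b"
      using closure_subset by blast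
    have "cbox a b - box a b \<in> null_sets lebesgue"
      using negligible_frontier_interval[of a b] by (simp add: negligible_iff_null_sets)
    then have "AE z in lebesgue. z \<notin> cbox a b - box a b" by (rule AE_not_in)
    then show "AE z in lebesgue. z \<in> closure (dyadic \<alpha>) \<times> {0<..<side \<alpha>} \<longrightarrow> z \<in> weight_cube \<alpha>"
      by eventually_elim (use sub box in blast)
  qed
  ultimately show ?thesis
    using pos
  proof eventually_elim
    case (elim z)
    show ?case unfolding good_point_def
    proof (intro conjI allI impI)
      fix k assume "0 < snd z \<and> snd z < 1 / 2 ^ k"
      then have "z \<in> closure (dyadic (cube_at k (fst z))) \<times> {0<..<side (cube_at k (fst z))}"
        using mem_closure_cube_at[of "fst z" k] by (cases z) (auto simp: side_def)
      then show "weight_mean \<gamma> (cube_at k (fst z)) \<le> C * \<gamma> z" using elim(1,2) by blast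
    qed (rule elim(3))
  qed
qed


section \<open>Smooth approximation of boxes\<close>

text \<open>
  Replaces the Frechet derivative in the definition by an explicit one. The closure properties below then follow
  by induction on \<open>k\<close> from the rules for derivatives.
\<close>

lemma Ck_SucI:
  assumes "\<And>z. (\<psi> has_derivative D z) (at z)" "\<And>b. b \<in> Basis \<Longrightarrow> Ck k (\<lambda>z. D z b)"
  shows "Ck (Suc k) \<psi>"
proof -
  have "frechet_derivative \<psi> (at z) = D z" for z
    using frechet_derivative_at[OF assms(1)] by simp
  then show ?thesis using assms by (auto simp: differentiable_def)
qed

lemma Ck_SucD:
  assumes "Ck (Suc k) \<psi>"
  shows "(\<psi> has_derivative frechet_derivative \<psi> (at z)) (at z)"
    "b \<in> Basis \<Longrightarrow> Ck k (\<lambda>z. frechet_derivative \<psi> (at z) b)"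
  using assms by (auto simp: frechet_derivative_works)

lemma Ck_Suc_imp_Ck: "Ck (Suc k) \<psi> \<Longrightarrow> Ck k \<psi>"
proof (induction k arbitrary: \<psi>)
  case 0
  then show ?case
    by (auto intro!: continuous_at_imp_continuous_on differentiable_imp_continuous_within)
next
  case (Suc k)
  show ?case
    by (rule Ck_SucI[where D = "\<lambda>z. frechet_derivative \<psi> (at z)"])
      (use Suc Ck_SucD in blast)+
qed

lemma Ck_const [simp]: "Ck k (\<lambda>_. c)"
proof (induction k arbitrary: c)
  case (Suc k)
  then show ?case by (intro Ck_SucI[where D = "\<lambda>_ _. 0"]) (auto intro!: derivative_eq_intros)
qed simp

lemma Ck_add: "Ck k f \<Longrightarrow> Ck k g \<Longrightarrow> Ck k (\<lambda>z. f z + g z)"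
proof (induction k arbitrary: f g)
  case (Suc k)
  show ?case
  proof (rule Ck_SucI)
    show "((\<lambda>z. f z + g z) has_derivative
        (\<lambda>h. frechet_derivative f (at z) h + frechet_derivative g (at z) h)) (at z)" for z
      using Ck_SucD(1)[OF Suc.prems(1)] Ck_SucD(1)[OF Suc.prems(2)]
      by (intro has_derivative_add)
    show "Ck k (\<lambda>z. frechet_derivative f (at z) b + frechet_derivative g (at z) b)" if "b \<in> Basis" for b
      by (intro Suc.IH Ck_SucD(2) that Suc.prems)
  qed
qed (auto intro: continuous_intros)

lemma Ck_mult: "Ck k f \<Longrightarrow> Ck k g \<Longrightarrow> Ck k (\<lambda>z. f z * g z)"
proof (induction k arbitrary: f g)
  case (Suc k)
  show ?case
  proof (rule Ck_SucI)
    show "((\<lambda>z. f z * g z) has_derivative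
        (\<lambda>h. f z * frechet_derivative g (at z) h + frechet_derivative f (at z) h * g z)) (at z)" for z
      using Ck_SucD(1)[OF Suc.prems(1)] Ck_SucD(1)[OF Suc.prems(2)]
      by (intro has_derivative_mult)
    show "Ck k (\<lambda>z. f z * frechet_derivative g (at z) b + frechet_derivative f (at z) b * g z)" if "b \<in> Basis" for b
      by (intro Ck_add Suc.IH Ck_SucD(2) Suc.prems[THEN Ck_Suc_imp_Ck] that Suc.prems)
  qed
qed (auto intro: continuous_intros)

lemma Ck_prod: "finite A \<Longrightarrow> (\<And>a. a \<in> A \<Longrightarrow> Ck k (f a)) \<Longrightarrow> Ck k (\<lambda>z. \<Prod>a\<in>A. f a z)"
  by (induction A rule: finite_induct) (auto intro: Ck_mult)

lemma Ck_power: "Ck k f \<Longrightarrow> Ck k (\<lambda>z. f z ^ j)"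
  by (induction j) (auto intro: Ck_mult)

text \<open>
  The functions \<open>p(1/x) exp(-1/x)\<close>, extended by 0 to \<open>x \<le> 0\<close>. The family is closed under
  differentiation, because \<open>(p(1/x) exp(-1/x))' = q(1/x) exp(-1/x)\<close> with \<open>q(X) = X\<^sup>2 (p(X) - p'(X))\<close>. Hence
  its members are smooth.
\<close>

definition flat :: "real poly \<Rightarrow> real \<Rightarrow> real" where
  "flat p x = (if 0 < x then poly p (1 / x) * exp (- (1 / x)) else 0)"

lemma poly_exp_tendsto_0: "((\<lambda>u::real. poly p u * exp (- u)) \<longlongrightarrow> 0) at_top"
proof -
  have "((\<lambda>u. \<Sum>i\<le>degree p. coeff p i * (u ^ i / exp u)) \<longlongrightarrow> (\<Sum>i\<le>degree p. coeff p i * 0)) at_top"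
    by (intro tendsto_sum tendsto_mult tendsto_const tendsto_power_div_exp_0)
  then show ?thesis
    by (simp add: poly_altdef exp_minus sum_distrib_right divide_inverse mult.assoc)
qed

lemma flat_has_derivative:
  "(flat p has_real_derivative flat ([:0, 0, 1:] * (p - pderiv p)) x) (at x)"
proof -
  consider "x > 0" | "x < 0" | "x = 0" by linarith
  then show ?thesis
  proof cases
    case 1
    have "((\<lambda>x. poly p (1 / x) * exp (- (1 / x))) has_real_derivative
        flat ([:0, 0, 1:] * (p - pderiv p)) x) (at x)"
      using 1 by (auto intro!: derivative_eq_intros simp: flat_def power2_eq_square algebra_simps)
    then show ?thesis
      by (rule has_field_derivative_transform_within_open[where S = "{0<..}"])
        (use 1 in \<open>auto simp: flat_def\<close>)
  next
    case 2
    have "((\<lambda>x. 0) has_real_derivative flat ([:0, 0, 1:] * (p - pderiv p)) x) (at x)"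
      using 2 by (simp add: flat_def)
    then show ?thesis
      by (rule has_field_derivative_transform_within_open[where S = "{..<0}"])
        (use 2 in \<open>auto simp: flat_def\<close>)
  next
    case 3
    have "((\<lambda>h. flat p h / h) \<longlongrightarrow> 0) (at_right 0)"
    proof -
      have "((\<lambda>h. poly (pCons 0 p) (inverse h) * exp (- inverse h)) \<longlongrightarrow> 0) (at_right (0::real))"
        by (rule filterlim_compose[OF poly_exp_tendsto_0 filterlim_inverse_at_top_right])
      then show ?thesis
        by (rule Lim_transform_eventually)
          (auto simp: eventually_at_filter flat_def field_simps intro!: always_eventually)
    qed
    moreover have "((\<lambda>h. flat p h / h) \<longlongrightarrow> 0) (at_left 0)"
      by (rule Lim_transform_eventually[OF tendsto_const])
         (auto simp: eventually_at_filter flat_def intro!: always_eventually)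
    ultimately have "((\<lambda>h. flat p h / h) \<longlongrightarrow> 0) (at 0)"
      by (simp add: filterlim_at_split)
    then show ?thesis using 3 by (simp add: DERIV_def flat_def)
  qed
qed

lemma Ck_flat: "Ck k (\<lambda>z. flat p (c + z \<bullet> a))"
proof (induction k arbitrary: p)
  case 0
  have "continuous_on UNIV (flat p)"
    using flat_has_derivative[of p] by (meson DERIV_continuous_on has_field_derivative_at_within)
  then show ?case
    by (auto intro!: continuous_on_compose2[where f = "\<lambda>z. c + z \<bullet> a"] continuous_intros)
next
  case (Suc k)
  let ?q = "[:0, 0, 1:] * (p - pderiv p)"
  show ?case
  proof (rule Ck_SucI)
    show "((\<lambda>z. flat p (c + z \<bullet> a)) has_derivative (\<lambda>h. (h \<bullet> a) * flat ?q (c + z \<bullet> a))) (at z)" for z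
      by (rule has_derivative_eq_rhs, rule DERIV_compose_FDERIV[OF flat_has_derivative])
        (auto intro!: derivative_eq_intros)
    show "Ck k (\<lambda>z. (b \<bullet> a) * flat ?q (c + z \<bullet> a))" for b
      by (intro Ck_mult Suc.IH) simp
  qed
qed

lemma flat_1: "0 \<le> flat 1 x" "flat 1 x \<le> 1" "0 < flat 1 x \<longleftrightarrow> 0 < x"
  by (auto simp: flat_def)

definition box_profile :: "'a::euclidean_space \<Rightarrow> 'a \<Rightarrow> 'a \<Rightarrow> real" where
  "box_profile l u z = (\<Prod>b\<in>Basis. flat 1 (- (l \<bullet> b) + z \<bullet> b) * flat 1 (u \<bullet> b + z \<bullet> (- b)))"

lemma box_profile:
  "0 \<le> box_profile l u z" "box_profile l u z \<le> 1" "0 < box_profile l u z \<longleftrightarrow> z \<in> box l u"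
proof -
  show "0 \<le> box_profile l u z" "box_profile l u z \<le> 1"
    unfolding box_profile_def by (auto intro!: prod_nonneg prod_le_1 mult_le_one simp: flat_1)
  have "box_profile l u z \<noteq> 0 \<longleftrightarrow> z \<in> box l u"
    using flat_1(1,3) by (auto simp: box_profile_def mem_box less_le)
  then show "0 < box_profile l u z \<longleftrightarrow> z \<in> box l u"
    using \<open>0 \<le> box_profile l u z\<close> by linarith
qed

text \<open>
  Since the profile lies in \<open>(0, 1]\<close> on the box and vanishes off it, these functions converge to the
  indicator of the box; each is a polynomial in the profile and therefore smooth.
\<close>

definition box_bump :: "'a::euclidean_space \<Rightarrow> 'a \<Rightarrow> nat \<Rightarrow> 'a \<Rightarrow> real" where
  "box_bump l u j z = 1 - (1 - box_profile l u z) ^ j"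

lemma Ck_box_bump: "Ck k (box_bump l u j)"
proof -
  have "Ck k (\<lambda>z. 1 + (-1) * (1 + (-1) * box_profile l u z) ^ j)"
    unfolding box_profile_def by (intro Ck_add Ck_mult Ck_power Ck_prod Ck_const Ck_flat finite_Basis)
  then show ?thesis by (simp add: box_bump_def[abs_def])
qed

lemma box_bump_translate: "box_bump (l + w) (u + w) j z = box_bump l u j (z - w)"
  by (simp add: box_bump_def box_profile_def algebra_simps)

lemma box_bump_bounds: "0 \<le> box_bump l u j z" "box_bump l u j z \<le> 1"
  using box_profile[of l u z] by (auto simp: box_bump_def intro!: power_le_one)

lemma box_bump_outside: "z \<notin> box l u \<Longrightarrow> box_bump l u j z = 0"
  using box_profile[of l u z] by (simp add: box_bump_def)

lemma box_bump_tendsto: "(\<lambda>j. box_bump l u j z) \<longlonglongrightarrow> indicator (box l u) z"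
proof (cases "z \<in> box l u")
  case True
  have "(\<lambda>j. 1 - (1 - box_profile l u z) ^ j) \<longlonglongrightarrow> 1 - 0"
    by (intro tendsto_diff tendsto_const LIMSEQ_realpow_zero) (use True box_profile[of l u z] in auto)
  then show ?thesis using True by (simp add: box_bump_def)
qed (simp add: box_bump_outside)

lemma closure_box_bump_support: "closure {z. box_bump l u j z \<noteq> 0} \<subseteq> cbox l u"
  using box_bump_outside[of _ l u j] box_subset_cbox[of l u] by (intro closure_minimal) auto

lemma test_function_box_bump:
  assumes "cbox l u \<subseteq> U" shows "test_function U (box_bump l u j)"
  unfolding test_function_def
proof safe
  show "compact (closure {z. box_bump l u j z \<noteq> 0})"
    using closure_box_bump_support[of l u j] by (meson bounded_cbox bounded_subset closed_closure compact_eq_bounded_closed)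
qed (use Ck_box_bump closure_box_bump_support[of l u j] assms in auto)

lemma box_bump_has_derivative:
  "(box_bump l u j has_derivative frechet_derivative (box_bump l u j) (at z)) (at z)"
  using Ck_SucD(1)[OF Ck_box_bump] .

lemma box_bump_continuous: "continuous_on UNIV (box_bump l u j)"
  using Ck_box_bump[of 0 l u j] by simp

lemma frechet_derivative_expand:
  fixes \<psi> :: "'a::euclidean_space \<Rightarrow> real"
  assumes "\<psi> differentiable (at z)"
  shows "frechet_derivative \<psi> (at z) h = (\<Sum>b\<in>Basis. (h \<bullet> b) * frechet_derivative \<psi> (at z) b)"
proof -
  have "linear (frechet_derivative \<psi> (at z))"
    using assms by (rule linear_frechet_derivative)
  then have "frechet_derivative \<psi> (at z) (\<Sum>b\<in>Basis. (h \<bullet> b) *\<^sub>R b) =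
      (\<Sum>b\<in>Basis. (h \<bullet> b) * frechet_derivative \<psi> (at z) b)"
    by (simp add: linear_sum linear_cmul)
  then show ?thesis by (simp add: euclidean_representation)
qed

lemma box_bump_derivative_continuous:
  "continuous_on UNIV (\<lambda>z. frechet_derivative (box_bump l u j) (at z) h)"
proof -
  have "continuous_on UNIV (\<lambda>z. frechet_derivative (box_bump l u j) (at z) b)" if "b \<in> Basis" for b
    using Ck_SucD(2)[OF Ck_box_bump that, of 0 l u j] by simp
  moreover have "box_bump l u j differentiable at z" for z
    using box_bump_has_derivative unfolding differentiable_def by blast
  ultimately show ?thesis
    by (subst frechet_derivative_expand) (auto intro!: continuous_intros)
qed

section \<open>Weak derivatives and translations\<close>

lemma nn_integral_lborel_shift:
  fixes F :: "'a::euclidean_space \<Rightarrow> ennreal"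
  assumes [measurable]: "F \<in> borel_measurable borel"
  shows "(\<integral>\<^sup>+z. F (z + a) \<partial>lborel) = (\<integral>\<^sup>+z. F z \<partial>lborel)"
proof -
  have "(\<integral>\<^sup>+z. F z \<partial>lborel) = (\<integral>\<^sup>+z. F z \<partial>distr lborel borel ((+) a))"
    by (simp add: lborel_distr_plus)
  also have "\<dots> = (\<integral>\<^sup>+z. F (a + z) \<partial>lborel)"
    by (subst nn_integral_distr) auto
  finally show ?thesis by (simp add: add.commute)
qed

lemma integral_lborel_shift:
  fixes F :: "'a::euclidean_space \<Rightarrow> real"
  assumes [measurable]: "F \<in> borel_measurable borel"
  shows "(\<integral>z. F (z + a) \<partial>lborel) = (\<integral>z. F z \<partial>lborel)"
proof -
  have "(\<integral>z. F z \<partial>lborel) = (\<integral>z. F z \<partial>distr lborel borel ((+) a))"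
    by (simp add: lborel_distr_plus)
  also have "\<dots> = (\<integral>z. F (a + z) \<partial>lborel)"
    by (subst integral_distr) auto
  finally show ?thesis by (simp add: add.commute)
qed

lemma integrable_lborel_shift:
  fixes F :: "'a::euclidean_space \<Rightarrow> real"
  assumes "integrable lborel F"
  shows "integrable lborel (\<lambda>z. F (z + a))"
proof -
  have "integrable (distr lborel borel ((+) a)) F"
    using assms by (simp add: lborel_distr_plus)
  then have "integrable lborel (\<lambda>z. F (a + z))"
    by (intro integrable_distr[of "(+) a" lborel borel]) auto
  then show ?thesis by (simp add: add.commute)
qed

text \<open>
  The positive and the negative part of \<open>w\<close>, restricted to the box, are densities of two finite measures.
  They agree on boxes, which generate the Borel sets and are stable under intersection, so the densities
  are equal almost everywhere.
\<close>

lemma AE_zero_if_box_integrals_zero: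
  fixes w :: "'a::euclidean_space \<Rightarrow> real"
  assumes int: "integrable lborel w"
    and zero: "\<And>l' u'. cbox l' u' \<subseteq> cbox l u \<Longrightarrow> (\<integral>z. indicator (box l' u') z * w z \<partial>lborel) = 0"
  shows "AE z in lborel. z \<in> box l u \<longrightarrow> w z = 0"
proof -
  have [measurable]: "w \<in> borel_measurable borel" using int by simp
  define p where "p = (\<lambda>z. ennreal (max 0 (w z)) * indicator (box l u) z)"
  define q where "q = (\<lambda>z. ennreal (max 0 (- w z)) * indicator (box l u) z)"
  have [measurable]: "p \<in> borel_measurable borel" "q \<in> borel_measurable borel"
    by (simp_all add: p_def q_def)
  have intp: "integrable lborel (\<lambda>z. max 0 (w z) * indicator S z)"
    and intq: "integrable lborel (\<lambda>z. max 0 (- w z) * indicator S z)" if "S \<in> sets borel" for S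
    using int that by (auto intro!: integrable_real_mult_indicator)
  have eq: "emeasure (density lborel p) (box a b) = emeasure (density lborel q) (box a b)" for a b
  proof -
    let ?B = "box a b \<inter> box l u"
    have B: "(\<integral>z. indicator ?B z * w z \<partial>lborel) = 0"
    proof (cases "?B = {}")
      case False
      then obtain l' u' where *: "?B = box l' u'" "box l' u' \<noteq> {}" unfolding box_Int_box by blast
      then have "cbox l' u' \<subseteq> cbox l u"
        by (metis Int_lower2 box_subset_cbox closed_cbox closure_box closure_minimal order_trans)
      then show ?thesis using zero * by simp
    qed simp
    have "(\<integral>z. max 0 (w z) * indicator ?B z \<partial>lborel) - (\<integral>z. max 0 (- w z) * indicator ?B z \<partial>lborel)
        = (\<integral>z. indicator ?B z * w z \<partial>lborel)"
    proof -
      have "indicator ?B z * w z = max 0 (w z) * indicator ?B z - max 0 (- w z) * indicator ?B z" for z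
        by (auto split: split_indicator)
      moreover have "?B \<in> sets borel" by simp
      ultimately show ?thesis
        using Bochner_Integration.integral_diff[OF intp intq] by simp
    qed
    then have "(\<integral>z. max 0 (w z) * indicator ?B z \<partial>lborel) = (\<integral>z. max 0 (- w z) * indicator ?B z \<partial>lborel)"
      using B by simp
    then have "(\<integral>\<^sup>+z. ennreal (max 0 (w z) * indicator ?B z) \<partial>lborel) =
        (\<integral>\<^sup>+z. ennreal (max 0 (- w z) * indicator ?B z) \<partial>lborel)"
      by (subst (1 2) nn_integral_eq_integral) (auto intro!: intp intq)
    moreover have "p z * indicator (box a b) z = ennreal (max 0 (w z) * indicator ?B z)"
      "q z * indicator (box a b) z = ennreal (max 0 (- w z) * indicator ?B z)" for z
      by (auto simp: p_def q_def split: split_indicator)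
    ultimately show ?thesis by (simp add: emeasure_density)
  qed
  have "density lborel p = density lborel q"
  proof (rule measure_eqI_generator_eq)
    let ?E = "range (\<lambda>(a, b). box a b::'a set)"
    show "Int_stable ?E" by (auto simp: Int_stable_def box_Int_box)
    show "?E \<subseteq> Pow UNIV" "sets (density lborel p) = sigma_sets UNIV ?E"
      "sets (density lborel q) = sigma_sets UNIV ?E"
      by (simp_all add: borel_eq_box)
    let ?A = "\<lambda>n::nat. box (- (real n *\<^sub>R One)) (real n *\<^sub>R One) :: 'a set"
    show "range ?A \<subseteq> ?E" "(\<Union>i. ?A i) = UNIV"
      unfolding UN_box_eq_UNIV by auto
    show "emeasure (density lborel p) X = emeasure (density lborel q) X" if "X \<in> ?E" for X
      using that eq by auto
    show "emeasure (density lborel p) (?A i) \<noteq> \<infinity>" for i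
    proof -
      have "emeasure (density lborel p) (?A i) \<le> (\<integral>\<^sup>+z. ennreal (norm (w z)) \<partial>lborel)"
        by (simp add: emeasure_density)
          (auto intro!: nn_integral_mono ennreal_leI simp: p_def split: split_indicator)
      also have "\<dots> < \<infinity>" using int by (simp add: integrable_iff_bounded)
      finally show ?thesis by simp
    qed
  qed
  then have "AE z in lborel. p z = q z"
    by (intro sigma_finite_measure.density_unique[OF sigma_finite_lborel]) auto
  then show ?thesis
    by eventually_elim (auto simp: p_def q_def max_def split: if_splits)
qed

lemma integrable_mult_bounded:
  fixes F P :: "'a::euclidean_space \<Rightarrow> real"
  assumes "integrable lborel F" "P \<in> borel_measurable borel" "\<And>z. \<bar>P z\<bar> \<le> C"
  shows "integrable lborel (\<lambda>z. F z * P z)"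
proof (rule Bochner_Integration.integrable_bound)
  show "integrable lborel (\<lambda>z. \<bar>C\<bar> * F z)" using assms(1) by simp
  show "(\<lambda>z. F z * P z) \<in> borel_measurable lborel" using assms(1,2) by simp
  have "\<bar>F z\<bar> * \<bar>P z\<bar> \<le> \<bar>F z\<bar> * \<bar>C\<bar>" for z
    using assms(3)[of z] by (intro mult_left_mono) auto
  then show "AE z in lborel. norm (F z * P z) \<le> norm (\<bar>C\<bar> * F z)"
    by (intro AE_I2) (simp add: abs_mult mult.commute)
qed

lemma frechet_derivative_shift:
  assumes "(\<psi> has_derivative frechet_derivative \<psi> (at (z - w))) (at (z - w))"
  shows "frechet_derivative (\<lambda>z. \<psi> (z - w)) (at z) = frechet_derivative \<psi> (at (z - w))"
proof -
  have "((\<lambda>z. z - w) has_derivative (\<lambda>h. h)) (at z)" by (auto intro!: derivative_eq_intros)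
  from has_derivative_compose[OF this assms]
  show ?thesis by (simp add: frechet_derivative_at[symmetric])
qed

lemma box_bump_derivative_outside:
  assumes "z \<notin> cbox l u" shows "frechet_derivative (box_bump l u j) (at z) h = 0"
proof -
  have "(box_bump l u j has_derivative (\<lambda>_. 0)) (at z)"
    by (rule has_derivative_transform_within_open[of "\<lambda>_. 0" _ _ _ "- cbox l u"])
      (use assms box_bump_outside box_subset_cbox in force)+
  then show ?thesis by (simp add: frechet_derivative_at[symmetric])
qed

lemma box_bump_derivative_bounded:
  "\<exists>B. \<forall>z. \<bar>frechet_derivative (box_bump l u j) (at z) h\<bar> \<le> B"
proof -
  let ?D = "\<lambda>z. frechet_derivative (box_bump l u j) (at z) h"
  have "compact (?D ` cbox l u)"
    by (intro compact_continuous_image continuous_on_subset[OF box_bump_derivative_continuous]) auto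
  then obtain B where B: "\<And>z. z \<in> cbox l u \<Longrightarrow> \<bar>?D z\<bar> \<le> B"
    by (meson bounded_real compact_imp_bounded imageI)
  have "?D z = 0" if "z \<notin> cbox l u" for z
    using that by (rule box_bump_derivative_outside)
  then have "\<bar>?D z\<bar> \<le> max B 0" for z using B[of z] by (cases "z \<in> cbox l u") auto
  then show ?thesis by blast
qed

text \<open>
  The fundamental theorem of calculus along the segment from \<open>z\<close> to \<open>z - h\<close>.
\<close>

lemma box_bump_line_integral:
  "(\<integral>\<theta>. indicator {0..1} \<theta> * frechet_derivative (box_bump l u j) (at (z - \<theta> *\<^sub>R h)) h \<partial>lborel)
    = box_bump l u j z - box_bump l u j (z - h)"
proof -
  let ?D = "\<lambda>z. frechet_derivative (box_bump l u j) (at z) h"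
  have "((\<lambda>\<theta>. - box_bump l u j (z - \<theta> *\<^sub>R h)) has_vector_derivative ?D (z - \<theta> *\<^sub>R h)) (at \<theta> within S)" for \<theta> S
  proof -
    let ?F = "frechet_derivative (box_bump l u j) (at (z - \<theta> *\<^sub>R h))"
    have lin: "linear ?F" using box_bump_has_derivative by (rule has_derivative_linear)
    have "((\<lambda>\<theta>. z - \<theta> *\<^sub>R h) has_derivative (\<lambda>t. - (t *\<^sub>R h))) (at \<theta>)"
      by (auto intro!: derivative_eq_intros)
    from has_derivative_compose[OF this box_bump_has_derivative]
    have "((\<lambda>\<theta>. - box_bump l u j (z - \<theta> *\<^sub>R h)) has_derivative (\<lambda>t. - ?F (- (t *\<^sub>R h)))) (at \<theta>)"
      by (intro has_derivative_minus)
    then have "((\<lambda>\<theta>. - box_bump l u j (z - \<theta> *\<^sub>R h)) has_vector_derivative ?F h) (at \<theta>)"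
      using lin by (simp add: has_vector_derivative_def linear_neg linear_cmul)
    then show ?thesis by (rule has_vector_derivative_at_within)
  qed
  then have "(\<integral>\<theta>. indicator {0..1} \<theta> *\<^sub>R ?D (z - \<theta> *\<^sub>R h) \<partial>lborel) =
      - box_bump l u j (z - 1 *\<^sub>R h) - - box_bump l u j (z - 0 *\<^sub>R h)"
    by (intro integral_FTC_atLeastAtMost)
      (auto intro!: continuous_on_compose2[OF box_bump_derivative_continuous] continuous_intros)
  then show ?thesis by simp
qed

lemma integrable_shift_product:
  fixes G :: "'a::euclidean_space \<Rightarrow> real"
  assumes G: "integrable lborel G"
    and P[measurable]: "P \<in> borel_measurable borel" and B: "\<And>z. \<bar>P z\<bar> \<le> B"
  shows "integrable (lborel \<Otimes>\<^sub>M lborel) (\<lambda>(z, \<theta>). indicator {0..1::real} \<theta> * (G z * P (z - \<theta> *\<^sub>R h)))"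
    "integrable (lborel \<Otimes>\<^sub>M lborel) (\<lambda>(z, \<theta>). indicator {0..1::real} \<theta> * (P z * G (z + \<theta> *\<^sub>R h)))"
proof -
  have [measurable]: "G \<in> borel_measurable borel" using G by simp
  define I where "I = (\<integral>\<^sup>+z. ennreal \<bar>G z\<bar> \<partial>lborel)"
  have I: "I < \<infinity>" using G by (simp add: I_def integrable_iff_bounded)
  have B0: "0 \<le> B" using B[of 0] by linarith
  have unit: "(\<integral>\<^sup>+\<theta>. c * indicator {0..1::real} \<theta> \<partial>lborel) = c" for c :: ennreal
    by (simp add: nn_integral_cmult_indicator)
  have fin: "I * ennreal B < \<infinity>" using I by (simp add: ennreal_mult_less_top)
  have e1: "(\<integral>\<^sup>+\<theta>. \<integral>\<^sup>+z. ennreal (norm (indicator {0..1::real} \<theta> * (G z * P (z - \<theta> *\<^sub>R h)))) \<partial>lborel \<partial>lborel) \<le> I * ennreal B"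
  proof -
    have "(\<integral>\<^sup>+z. ennreal (norm (indicator {0..1::real} \<theta> * (G z * P (z - \<theta> *\<^sub>R h)))) \<partial>lborel)
        \<le> (\<integral>\<^sup>+z. (ennreal B * indicator {0..1} \<theta>) * ennreal \<bar>G z\<bar> \<partial>lborel)" for \<theta>
      by (intro nn_integral_mono)
        (auto simp: abs_mult ennreal_mult'[symmetric] mult.commute[of "\<bar>G _\<bar>"] B B0 split: split_indicator
          intro!: ennreal_leI mult_right_mono)
    also have "\<dots> \<theta> = I * ennreal B * indicator {0..1} \<theta>" for \<theta>
      by (subst nn_integral_cmult) (auto simp: I_def mult_ac)
    finally show ?thesis
      by (intro order_trans[OF nn_integral_mono order.eq_iff[THEN iffD1, OF unit, THEN conjunct1]]) auto
  qed
  have e2: "(\<integral>\<^sup>+\<theta>. \<integral>\<^sup>+z. ennreal (norm (indicator {0..1::real} \<theta> * (P z * G (z + \<theta> *\<^sub>R h)))) \<partial>lborel \<partial>lborel) \<le> I * ennreal B"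
  proof -
    have "(\<integral>\<^sup>+z. ennreal (norm (indicator {0..1::real} \<theta> * (P z * G (z + \<theta> *\<^sub>R h)))) \<partial>lborel)
        \<le> (\<integral>\<^sup>+z. (ennreal B * indicator {0..1} \<theta>) * ennreal \<bar>G (z + \<theta> *\<^sub>R h)\<bar> \<partial>lborel)" for \<theta>
      by (intro nn_integral_mono)
        (auto simp: abs_mult ennreal_mult'[symmetric] mult.commute B B0 split: split_indicator
          intro!: ennreal_leI mult_right_mono)
    also have "\<dots> \<theta> = I * ennreal B * indicator {0..1} \<theta>" for \<theta>
      using nn_integral_lborel_shift[of "\<lambda>z. ennreal \<bar>G z\<bar>" "\<theta> *\<^sub>R h"]
      by (subst nn_integral_cmult) (auto simp: I_def mult_ac)
    finally show ?thesis
      by (intro order_trans[OF nn_integral_mono order.eq_iff[THEN iffD1, OF unit, THEN conjunct1]]) auto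
  qed
  show "integrable (lborel \<Otimes>\<^sub>M lborel) (\<lambda>(z, \<theta>). indicator {0..1::real} \<theta> * (G z * P (z - \<theta> *\<^sub>R h)))"
    unfolding integrable_iff_bounded
    using e1 fin by (subst lborel_pair.nn_integral_snd[symmetric]) auto
  show "integrable (lborel \<Otimes>\<^sub>M lborel) (\<lambda>(z, \<theta>). indicator {0..1::real} \<theta> * (P z * G (z + \<theta> *\<^sub>R h)))"
    unfolding integrable_iff_bounded
    using e2 fin by (subst lborel_pair.nn_integral_snd[symmetric]) auto
qed

text \<open>
  Integrating the weak derivative identity for the shifted test functions over \<open>\<theta>\<close> gives, by
  \<open>box_bump_line_integral\<close> and Fubini, the translation identity tested against \<open>box_bump l u j\<close>.
\<close>

lemma test_integral_translation:
  fixes F G :: "'a::euclidean_space \<Rightarrow> real"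
  assumes F: "integrable lborel F" and G: "integrable lborel G"
    and weak: "\<And>\<theta>. \<theta> \<in> {0..1} \<Longrightarrow>
      (\<integral>z. F z * frechet_derivative (box_bump (l + \<theta> *\<^sub>R h) (u + \<theta> *\<^sub>R h) j) (at z) h \<partial>lborel) =
      - (\<integral>z. G z * box_bump (l + \<theta> *\<^sub>R h) (u + \<theta> *\<^sub>R h) j z \<partial>lborel)"
  shows "(\<integral>z. (F (z + h) - F z - (\<integral>\<theta>. indicator {0..1} \<theta> * G (z + \<theta> *\<^sub>R h) \<partial>lborel)) * box_bump l u j z \<partial>lborel) = 0"
proof -
  have [measurable]: "F \<in> borel_measurable borel" "G \<in> borel_measurable borel" using F G by auto
  define \<psi> where "\<psi> = box_bump l u j"
  define D where "D z = frechet_derivative \<psi> (at z) h" for z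
  have \<psi>: "\<bar>\<psi> z\<bar> \<le> 1" for z using box_bump_bounds[of l u j z] by (simp add: \<psi>_def)
  obtain B where B: "\<And>z. \<bar>D z\<bar> \<le> B"
    using box_bump_derivative_bounded[of l u j h] by (auto simp: D_def \<psi>_def)
  have \<psi>_meas[measurable]: "\<psi> \<in> borel_measurable borel"
    unfolding \<psi>_def by (intro borel_measurable_continuous_onI box_bump_continuous)
  have D_meas[measurable]: "D \<in> borel_measurable borel"
    unfolding \<psi>_def D_def by (intro borel_measurable_continuous_onI box_bump_derivative_continuous)
  have weak': "(\<integral>z. F z * D (z - \<theta> *\<^sub>R h) \<partial>lborel) = - (\<integral>z. G (z + \<theta> *\<^sub>R h) * \<psi> z \<partial>lborel)"
    if "\<theta> \<in> {0..1}" for \<theta>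
  proof -
    have "box_bump (l + \<theta> *\<^sub>R h) (u + \<theta> *\<^sub>R h) j = (\<lambda>z. \<psi> (z - \<theta> *\<^sub>R h))"
      by (simp add: box_bump_translate \<psi>_def fun_eq_iff)
    then have "(\<integral>z. F z * D (z - \<theta> *\<^sub>R h) \<partial>lborel) = - (\<integral>z. G z * \<psi> (z - \<theta> *\<^sub>R h) \<partial>lborel)"
      using weak[OF that] by (simp add: D_def \<psi>_def frechet_derivative_shift[OF box_bump_has_derivative])
    also have "(\<integral>z. G z * \<psi> (z - \<theta> *\<^sub>R h) \<partial>lborel) = (\<integral>z. G (z + \<theta> *\<^sub>R h) * \<psi> z \<partial>lborel)"
      using integral_lborel_shift[of "\<lambda>z. G z * \<psi> (z - \<theta> *\<^sub>R h)" "\<theta> *\<^sub>R h"] by simp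
    finally show ?thesis .
  qed
  have Fh: "integrable lborel (\<lambda>z. F (z + h))" by (rule integrable_lborel_shift[OF F])
  have "(\<integral>z. F (z + h) * \<psi> z \<partial>lborel) - (\<integral>z. F z * \<psi> z \<partial>lborel)
      = - (\<integral>z. F z * (\<psi> z - \<psi> (z - h)) \<partial>lborel)"
  proof -
    have "(\<integral>z. F (z + h) * \<psi> z \<partial>lborel) = (\<integral>z. F z * \<psi> (z - h) \<partial>lborel)"
      using integral_lborel_shift[of "\<lambda>z. F z * \<psi> (z - h)" h] by simp
    moreover have "integrable lborel (\<lambda>z. F z * \<psi> (z - h))" "integrable lborel (\<lambda>z. F z * \<psi> z)"
      by (rule integrable_mult_bounded[where C = 1]; use F \<psi> in simp)+
    ultimately show ?thesis by (simp add: right_diff_distrib)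
  qed
  also have "(\<integral>z. F z * (\<psi> z - \<psi> (z - h)) \<partial>lborel)
      = (\<integral>z. (\<integral>\<theta>. indicator {0..1} \<theta> * (F z * D (z - \<theta> *\<^sub>R h)) \<partial>lborel) \<partial>lborel)"
    using box_bump_line_integral[where l = l and u = u and j = j and h = h]
    by (simp add: mult.left_commute[of "indicator _ _"] \<psi>_def D_def)
  also have "\<dots> = (\<integral>\<theta>. (\<integral>z. indicator {0..1} \<theta> * (F z * D (z - \<theta> *\<^sub>R h)) \<partial>lborel) \<partial>lborel)"
    using integrable_shift_product(1)[OF F D_meas B]
    by (intro lborel_pair.Fubini_integral[symmetric]) (simp add: split_def)
  also have "\<dots> = (\<integral>\<theta>. - (\<integral>z. indicator {0..1} \<theta> * (\<psi> z * G (z + \<theta> *\<^sub>R h)) \<partial>lborel) \<partial>lborel)"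
    using weak' by (intro Bochner_Integration.integral_cong) (auto simp: mult.commute split: split_indicator)
  also have "\<dots> = - (\<integral>\<theta>. (\<integral>z. indicator {0..1} \<theta> * (\<psi> z * G (z + \<theta> *\<^sub>R h)) \<partial>lborel) \<partial>lborel)"
    by simp
  also have "(\<integral>\<theta>. (\<integral>z. indicator {0..1} \<theta> * (\<psi> z * G (z + \<theta> *\<^sub>R h)) \<partial>lborel) \<partial>lborel)
      = (\<integral>z. (\<integral>\<theta>. indicator {0..1} \<theta> * (\<psi> z * G (z + \<theta> *\<^sub>R h)) \<partial>lborel) \<partial>lborel)"
    using integrable_shift_product(2)[OF G \<psi>_meas \<psi>]
    by (intro lborel_pair.Fubini_integral) (simp add: split_def)
  also have "\<dots> = (\<integral>z. (\<integral>\<theta>. indicator {0..1} \<theta> * G (z + \<theta> *\<^sub>R h) \<partial>lborel) * \<psi> z \<partial>lborel)"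
  proof -
    have "(\<integral>\<theta>. indicator {0..1} \<theta> * (\<psi> z * G (z + \<theta> *\<^sub>R h)) \<partial>lborel)
        = (\<integral>\<theta>. (indicator {0..1} \<theta> * G (z + \<theta> *\<^sub>R h)) * \<psi> z \<partial>lborel)" for z
      by (simp add: mult_ac)
    then show ?thesis by simp
  qed
  finally have eq: "(\<integral>z. F (z + h) * \<psi> z \<partial>lborel) - (\<integral>z. F z * \<psi> z \<partial>lborel)
      = (\<integral>z. (\<integral>\<theta>. indicator {0..1} \<theta> * G (z + \<theta> *\<^sub>R h) \<partial>lborel) * \<psi> z \<partial>lborel)" by simp
  have "integrable lborel (\<lambda>z. \<integral>\<theta>. indicator {0..1} \<theta> * (1 * G (z + \<theta> *\<^sub>R h)) \<partial>lborel)"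
    using lborel_pair.integrable_fst'[OF integrable_shift_product(2)[OF G, of "\<lambda>_. 1" 1 h]] by simp
  then have "integrable lborel (\<lambda>z. (\<integral>\<theta>. indicator {0..1} \<theta> * G (z + \<theta> *\<^sub>R h) \<partial>lborel) * \<psi> z)"
    using \<psi> by (intro integrable_mult_bounded) auto
  moreover have "integrable lborel (\<lambda>z. F (z + h) * \<psi> z)" "integrable lborel (\<lambda>z. F z * \<psi> z)"
    by (rule integrable_mult_bounded[where C = 1]; use F Fh \<psi> in simp)+
  ultimately show ?thesis
    using eq unfolding \<psi>_def[symmetric] by (simp add: left_diff_distrib)
qed

text \<open>
  Letting \<open>j\<close> tend to infinity turns the tested identity into one integrated over boxes, which
  determines the integrand almost everywhere.
\<close>

lemma translation_identity:
  fixes F G :: "'a::euclidean_space \<Rightarrow> real"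
  assumes F: "integrable lborel F" and G: "integrable lborel G"
    and weak: "\<And>l' u' j \<theta>. \<theta> \<in> {0..1} \<Longrightarrow> cbox l' u' \<subseteq> cbox l u \<Longrightarrow>
      (\<integral>z. F z * frechet_derivative (box_bump (l' + \<theta> *\<^sub>R h) (u' + \<theta> *\<^sub>R h) j) (at z) h \<partial>lborel) =
      - (\<integral>z. G z * box_bump (l' + \<theta> *\<^sub>R h) (u' + \<theta> *\<^sub>R h) j z \<partial>lborel)"
  shows "AE z in lborel. z \<in> box l u \<longrightarrow>
    F (z + h) - F z = (\<integral>\<theta>. indicator {0..1} \<theta> * G (z + \<theta> *\<^sub>R h) \<partial>lborel)"
proof -
  define w where "w z = F (z + h) - F z - (\<integral>\<theta>. indicator {0..1} \<theta> * G (z + \<theta> *\<^sub>R h) \<partial>lborel)" for z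
  have "integrable lborel (\<lambda>z. \<integral>\<theta>. indicator {0..1} \<theta> * (1 * G (z + \<theta> *\<^sub>R h)) \<partial>lborel)"
    using lborel_pair.integrable_fst'[OF integrable_shift_product(2)[OF G, of "\<lambda>_. 1" 1 h]] by simp
  then have w: "integrable lborel w"
    using F integrable_lborel_shift[OF F, of h] unfolding w_def[abs_def] by simp
  then have [measurable]: "w \<in> borel_measurable borel" by simp
  have "AE z in lborel. z \<in> box l u \<longrightarrow> w z = 0"
  proof (rule AE_zero_if_box_integrals_zero[OF w])
    fix l' u' assume sub: "cbox l' u' \<subseteq> cbox l u"
    have "(\<lambda>j. \<integral>z. w z * box_bump l' u' j z \<partial>lborel) \<longlonglongrightarrow> (\<integral>z. w z * indicator (box l' u') z \<partial>lborel)"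
    proof (rule integral_dominated_convergence[where w = "\<lambda>z. \<bar>w z\<bar>"])
      show "(\<lambda>z. w z * box_bump l' u' j z) \<in> borel_measurable lborel" for j
        by (simp add: borel_measurable_times borel_measurable_continuous_onI[OF box_bump_continuous])
      show "AE z in lborel. (\<lambda>j. w z * box_bump l' u' j z) \<longlonglongrightarrow> w z * indicator (box l' u') z"
        by (intro AE_I2 tendsto_mult tendsto_const box_bump_tendsto)
      show "AE z in lborel. norm (w z * box_bump l' u' j z) \<le> \<bar>w z\<bar>" for j
        using box_bump_bounds[of l' u' j] by (intro AE_I2) (auto simp: abs_mult intro!: mult_left_le)
    qed (use w in auto)
    moreover have "(\<integral>z. w z * box_bump l' u' j z \<partial>lborel) = 0" for j
      unfolding w_def using weak sub by (intro test_integral_translation F G) blast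
    ultimately have "(\<integral>z. w z * indicator (box l' u') z \<partial>lborel) = 0"
      using LIMSEQ_unique[OF _ tendsto_const] by simp
    then show "(\<integral>z. indicator (box l' u') z * w z \<partial>lborel) = 0" by (simp add: mult.commute)
  qed
  then show ?thesis by eventually_elim (simp add: w_def)
qed

lemma locally_L1_measurable:
  fixes f :: "'a::euclidean_space \<Rightarrow> real"
  assumes "open U" "locally_L1 U f"
  shows "(\<lambda>z. indicator U z * f z) \<in> borel_measurable lebesgue"
proof -
  obtain K where K: "\<And>n. compact (K n)" "\<And>n. K n \<subseteq> U" "\<And>n. K n \<subseteq> interior (K (Suc n))" "\<Union> (range K) = U"
    using open_Union_compact_subsets[OF assms(1)] by metis
  have mono: "K m \<subseteq> K n" if "m \<le> n" for m n
    using lift_Suc_mono_le[of K m n] K(3) interior_subset that by blast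
  show ?thesis
  proof (rule borel_measurable_LIMSEQ_real)
    show "(\<lambda>z. indicator (K n) z * f z) \<in> borel_measurable lebesgue" for n
      using assms(2) K(1,2)[of n] unfolding locally_L1_def set_integrable_def real_scaleR_def by blast
    show "(\<lambda>n. indicator (K n) z * f z) \<longlonglongrightarrow> indicator U z * f z" for z
    proof (cases "z \<in> U")
      case True
      then obtain m where "z \<in> K m" using K(4) by blast
      then have "\<forall>\<^sub>F n in sequentially. indicator U z * f z = indicator (K n) z * f z"
        using True mono unfolding eventually_sequentially by (intro exI[of _ m]) (auto simp: indicator_def)
      then show ?thesis by (rule Lim_transform_eventually[OF tendsto_const])
    next
      case False
      then have "indicator (K n) z = (0::real)" for n using K(2)[of n] by (auto simp: indicator_def)
      then show ?thesis using False by simp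
    qed
  qed
qed

text \<open>
  Borel functions have measurable slices and obey the Tonelli theorem for \<open>lborel\<close>, whereas the product of
  two completed measures is not complete.
\<close>

lemma borel_representative:
  fixes f :: "'a::euclidean_space \<Rightarrow> real"
  assumes "open U" "locally_L1 U f"
  shows "\<exists>F\<in>borel_measurable borel. AE z in lborel. z \<in> U \<longrightarrow> f z = F z"
proof -
  obtain F where "F \<in> borel_measurable lborel" "AE z in lborel. indicator U z * f z = F z"
    using completion_ex_borel_measurable_real[OF locally_L1_measurable[OF assms]] by blast
  moreover from this(2) have "AE z in lborel. z \<in> U \<longrightarrow> f z = F z"
    by eventually_elim (auto simp: indicator_def)
  ultimately show ?thesis by auto
qed

lemma integrable_representative:
  fixes f F :: "'a::euclidean_space \<Rightarrow> real"
  assumes "locally_L1 U f" "compact K" "K \<subseteq> U" and F[measurable]: "F \<in> borel_measurable borel"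
    and AE: "AE z in lborel. z \<in> U \<longrightarrow> f z = F z"
  shows "integrable lborel (\<lambda>z. indicator K z * F z)"
proof -
  have K[measurable]: "K \<in> sets borel" using assms(2) by (simp add: borel_compact)
  have "integrable lebesgue (\<lambda>z. indicator K z * f z)"
    using assms(1-3) unfolding locally_L1_def set_integrable_def by auto
  moreover have "AE z in lebesgue. indicator K z * f z = indicator K z * F z"
    using AE_completion[OF AE] by eventually_elim (use assms(3) in \<open>auto simp: indicator_def\<close>)
  moreover have "(\<lambda>z. indicator K z * F z) \<in> borel_measurable lebesgue"
    by (intro measurable_completion) simp
  ultimately have "integrable lebesgue (\<lambda>z. indicator K z * F z)"
    using integrable_cong_AE[of "\<lambda>z. indicator K z * f z" lebesgue "\<lambda>z. indicator K z * F z"]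
    by (metis (no_types, lifting) borel_measurable_integrable)
  then show ?thesis by (subst (asm) integrable_completion) auto
qed

lemma integral_representative:
  fixes f F P :: "'a::euclidean_space \<Rightarrow> real"
  assumes U: "open U" "locally_L1 U f" "compact K" "K \<subseteq> U"
    and F[measurable]: "F \<in> borel_measurable borel" and P[measurable]: "P \<in> borel_measurable borel"
    and AE: "AE z in lborel. z \<in> U \<longrightarrow> f z = F z"
    and out: "\<And>z. z \<notin> K \<Longrightarrow> P z = 0"
  shows "(LINT z:U|lebesgue. f z * P z) = (\<integral>z. (indicator K z * F z) * P z \<partial>lborel)"
proof -
  have K[measurable]: "K \<in> sets borel" using assms(3) by (simp add: borel_compact)
  have "(LINT z:U|lebesgue. f z * P z) = (\<integral>z. (indicator K z * F z) * P z \<partial>lebesgue)"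
    unfolding set_lebesgue_integral_def
  proof (rule integral_cong_AE)
    have "P \<in> borel_measurable lebesgue" by (simp add: measurable_completion)
    then have "(\<lambda>z. (indicator U z * f z) * P z) \<in> borel_measurable lebesgue"
      by (rule borel_measurable_times[OF locally_L1_measurable[OF U(1,2)]])
    then show "(\<lambda>z. indicator U z *\<^sub>R (f z * P z)) \<in> borel_measurable lebesgue"
      by (simp add: mult.assoc)
    show "(\<lambda>z. (indicator K z * F z) * P z) \<in> borel_measurable lebesgue"
      by (intro measurable_completion) simp
    show "AE z in lebesgue. indicator U z *\<^sub>R (f z * P z) = (indicator K z * F z) * P z"
      using AE_completion[OF AE] by eventually_elim (use U(4) out in \<open>auto simp: indicator_def\<close>)
  qed
  then show ?thesis by (subst (asm) integral_completion) auto
qed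

text \<open>
  Both functions are cut off to a compact set \<open>K\<close> in \<open>U\<close> that contains all translates of the box, which
  makes them integrable on the whole space. The derivative in direction \<open>h\<close> is expanded in the
  coordinate directions.
\<close>

lemma weak_translation_identity:
  fixes f F :: "'a::euclidean_space \<Rightarrow> real"
  assumes U: "open U" "locally_L1 U f"
    and g: "\<And>b. b \<in> Basis \<Longrightarrow> is_weak_deriv U b f (g b)"
    and F: "F \<in> borel_measurable borel" "AE z in lborel. z \<in> U \<longrightarrow> f z = F z"
    and G: "\<And>b. b \<in> Basis \<Longrightarrow> G b \<in> borel_measurable borel"
      "\<And>b. b \<in> Basis \<Longrightarrow> AE z in lborel. z \<in> U \<longrightarrow> g b z = G b z"
    and K: "compact K" "K \<subseteq> U" "\<And>\<theta> z. \<theta> \<in> {0..1} \<Longrightarrow> z \<in> cbox l u \<Longrightarrow> z + \<theta> *\<^sub>R h \<in> K"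
  shows "AE z in lborel. z \<in> box l u \<longrightarrow>
    F (z + h) - F z = (\<integral>\<theta>. indicator {0..1} \<theta> * (\<Sum>b\<in>Basis. (h \<bullet> b) * G b (z + \<theta> *\<^sub>R h)) \<partial>lborel)"
proof -
  define F0 where "F0 z = indicator K z * F z" for z
  define H where "H b z = indicator K z * G b z" for b z
  define G0 where "G0 z = (\<Sum>b\<in>Basis. (h \<bullet> b) * H b z)" for z
  have g_loc: "locally_L1 U (g b)" if "b \<in> Basis" for b
    using g[OF that] by (simp add: is_weak_deriv_def)
  have F0: "integrable lborel F0"
    unfolding F0_def[abs_def] by (rule integrable_representative[OF U(2) K(1,2) F])
  have H: "integrable lborel (H b)" if "b \<in> Basis" for b
    unfolding H_def[abs_def] by (rule integrable_representative[OF g_loc K(1,2) G]) (rule that)+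
  have G0: "integrable lborel G0"
    unfolding G0_def[abs_def] using H by (intro Bochner_Integration.integrable_sum) simp
  have "AE z in lborel. z \<in> box l u \<longrightarrow>
    F0 (z + h) - F0 z = (\<integral>\<theta>. indicator {0..1} \<theta> * G0 (z + \<theta> *\<^sub>R h) \<partial>lborel)"
  proof (rule translation_identity[OF F0 G0])
    fix l' u' :: 'a and j :: nat and \<theta> :: real
    assume \<theta>: "\<theta> \<in> {0..1}" and sub: "cbox l' u' \<subseteq> cbox l u"
    let ?l = "l' + \<theta> *\<^sub>R h" and ?u = "u' + \<theta> *\<^sub>R h"
    let ?\<psi> = "box_bump ?l ?u j"
    let ?D = "\<lambda>b z. frechet_derivative ?\<psi> (at z) b"
    have subK: "cbox ?l ?u \<subseteq> K"
    proof
      fix z assume "z \<in> cbox ?l ?u"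
      then have "z - \<theta> *\<^sub>R h \<in> cbox l' u'" by (simp add: mem_box algebra_simps)
      then have "(z - \<theta> *\<^sub>R h) + \<theta> *\<^sub>R h \<in> K" using sub \<theta> by (intro K(3)) auto
      then show "z \<in> K" by simp
    qed
    have test: "test_function U ?\<psi>"
      using subK K(2) by (intro test_function_box_bump) blast
    have eq: "(\<integral>z. F0 z * ?D b z \<partial>lborel) = - (\<integral>z. H b z * ?\<psi> z \<partial>lborel)" if b: "b \<in> Basis" for b
    proof -
      have "(LINT z:U|lebesgue. f z * ?D b z) = - (LINT z:U|lebesgue. g b z * ?\<psi> z)"
        using g[OF b] test unfolding is_weak_deriv_def by blast
      moreover have "(LINT z:U|lebesgue. f z * ?D b z) = (\<integral>z. F0 z * ?D b z \<partial>lborel)"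
        unfolding F0_def
        by (rule integral_representative[OF U K(1,2) F(1) _ F(2)])
          (use subK in \<open>auto intro: borel_measurable_continuous_onI box_bump_derivative_continuous
            box_bump_derivative_outside\<close>)
      moreover have "(LINT z:U|lebesgue. g b z * ?\<psi> z) = (\<integral>z. H b z * ?\<psi> z \<partial>lborel)"
        unfolding H_def
        by (rule integral_representative[OF U(1) g_loc[OF b] K(1,2) G(1)[OF b] _ G(2)[OF b]])
          (use subK box_subset_cbox[of ?l ?u] in
            \<open>auto intro: borel_measurable_continuous_onI box_bump_continuous box_bump_outside\<close>)
      ultimately show ?thesis by simp
    qed
    have diff: "?\<psi> differentiable at z" for z
      using box_bump_has_derivative unfolding differentiable_def by blast
    have "(\<integral>z. F0 z * ?D h z \<partial>lborel) = (\<integral>z. (\<Sum>b\<in>Basis. (h \<bullet> b) * (F0 z * ?D b z)) \<partial>lborel)"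
      by (simp add: frechet_derivative_expand[OF diff, of _ h] sum_distrib_left mult_ac)
    also have "\<dots> = (\<Sum>b\<in>Basis. (h \<bullet> b) * (\<integral>z. F0 z * ?D b z \<partial>lborel))"
    proof (subst Bochner_Integration.integral_sum)
      fix b :: 'a
      obtain B where "\<And>z. \<bar>?D b z\<bar> \<le> B" using box_bump_derivative_bounded by blast
      then show "integrable lborel (\<lambda>z. (h \<bullet> b) * (F0 z * ?D b z))"
        using F0 box_bump_derivative_continuous by (intro integrable_mult_right integrable_mult_bounded borel_measurable_continuous_onI) auto
    qed simp
    also have "\<dots> = - (\<Sum>b\<in>Basis. (h \<bullet> b) * (\<integral>z. H b z * ?\<psi> z \<partial>lborel))"
      using eq by (simp add: sum_negf)
    also have "(\<Sum>b\<in>Basis. (h \<bullet> b) * (\<integral>z. H b z * ?\<psi> z \<partial>lborel))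
        = (\<integral>z. (\<Sum>b\<in>Basis. (h \<bullet> b) * (H b z * ?\<psi> z)) \<partial>lborel)"
    proof (subst Bochner_Integration.integral_sum)
      fix b :: 'a assume "b \<in> Basis"
      moreover have "\<bar>?\<psi> z\<bar> \<le> 1" for z using box_bump_bounds[of ?l ?u j z] by simp
      ultimately show "integrable lborel (\<lambda>z. (h \<bullet> b) * (H b z * ?\<psi> z))"
        using H box_bump_continuous by (intro integrable_mult_right integrable_mult_bounded borel_measurable_continuous_onI) auto
    qed simp
    also have "\<dots> = (\<integral>z. G0 z * ?\<psi> z \<partial>lborel)"
      by (simp add: G0_def sum_distrib_right mult.assoc)
    finally show "(\<integral>z. F0 z * ?D h z \<partial>lborel) = - (\<integral>z. G0 z * ?\<psi> z \<partial>lborel)" .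
  qed
  then show ?thesis
  proof eventually_elim
    case (elim z)
    show ?case
    proof
      assume z: "z \<in> box l u"
      then have zK: "z + \<theta> *\<^sub>R h \<in> K" if "\<theta> \<in> {0..1}" for \<theta>
        using K(3)[OF that] box_subset_cbox by blast
      have "F0 (z + h) - F0 z = F (z + h) - F z"
        using zK[of 0] zK[of 1] by (simp add: F0_def)
      moreover have "indicator {0..1} \<theta> * G0 (z + \<theta> *\<^sub>R h) =
          indicator {0..1} \<theta> * (\<Sum>b\<in>Basis. (h \<bullet> b) * G b (z + \<theta> *\<^sub>R h))" for \<theta> :: real
        using zK[of \<theta>] by (auto simp: G0_def H_def indicator_def)
      ultimately show "F (z + h) - F z =
          (\<integral>\<theta>. indicator {0..1} \<theta> * (\<Sum>b\<in>Basis. (h \<bullet> b) * G b (z + \<theta> *\<^sub>R h)) \<partial>lborel)"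
        using elim z by simp
    qed
  qed
qed

text \<open>
  The translation identity for Borel functions, taken as a definition: everything needed from a weak gradient
  follows from it.
\<close>

definition weak_grad :: "'a::euclidean_space set \<Rightarrow> ('a \<Rightarrow> real) \<Rightarrow> ('a \<Rightarrow> 'a \<Rightarrow> real) \<Rightarrow> bool" where
  "weak_grad U F G \<longleftrightarrow> F \<in> borel_measurable borel \<and> (\<forall>b\<in>Basis. G b \<in> borel_measurable borel) \<and>
    (\<forall>K l u h. compact K \<and> K \<subseteq> U \<and> (\<forall>\<theta>\<in>{0..1}. \<forall>z\<in>cbox l u. z + \<theta> *\<^sub>R h \<in> K) \<longrightarrow>
      (AE z in lborel. z \<in> box l u \<longrightarrow>
        F (z + h) - F z = (\<integral>\<theta>. indicator {0..1} \<theta> * (\<Sum>b\<in>Basis. (h \<bullet> b) * G b (z + \<theta> *\<^sub>R h)) \<partial>lborel)))"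

lemma ennreal_abs_integral_le: "ennreal \<bar>\<integral>x. f x \<partial>M\<bar> \<le> (\<integral>\<^sup>+x. ennreal \<bar>f x\<bar> \<partial>M)"
proof (cases "integrable M f")
  case True
  then show ?thesis using integral_norm_bound_ennreal by force
qed (simp add: not_integrable_integral_eq)

text \<open>
  Take absolute values in the translation identity, and exchange the integrals over \<open>z\<close> and \<open>\<theta>\<close>.
\<close>

lemma weak_grad_translation:
  assumes wg: "weak_grad U F G"
    and K: "compact K" "K \<subseteq> U" "\<And>\<theta> z. \<theta> \<in> {0..1} \<Longrightarrow> z \<in> cbox l u \<Longrightarrow> z + \<theta> *\<^sub>R h \<in> K"
  shows "(\<integral>\<^sup>+z\<in>box l u. ennreal \<bar>F (z + h) - F z\<bar> \<partial>lborel)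
    \<le> (\<integral>\<^sup>+\<theta>\<in>{0..1::real}. (\<integral>\<^sup>+z\<in>box l u. (\<Sum>b\<in>Basis. ennreal \<bar>h \<bullet> b\<bar> * ennreal \<bar>G b (z + \<theta> *\<^sub>R h)\<bar>) \<partial>lborel) \<partial>lborel)"
proof -
  define S where "S x = (\<Sum>b\<in>Basis. ennreal \<bar>h \<bullet> b\<bar> * ennreal \<bar>G b x\<bar>)" for x
  have [measurable]: "F \<in> borel_measurable borel" "\<And>b. b \<in> Basis \<Longrightarrow> G b \<in> borel_measurable borel"
    using wg by (auto simp: weak_grad_def)
  have [measurable]: "S \<in> borel_measurable borel" unfolding S_def[abs_def] by simp
  have "AE z in lborel. z \<in> box l u \<longrightarrow>
        F (z + h) - F z = (\<integral>\<theta>. indicator {0..1} \<theta> * (\<Sum>b\<in>Basis. (h \<bullet> b) * G b (z + \<theta> *\<^sub>R h)) \<partial>lborel)"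
    using wg K unfolding weak_grad_def by blast
  then have "AE z in lborel. ennreal \<bar>F (z + h) - F z\<bar> * indicator (box l u) z
      \<le> (\<integral>\<^sup>+\<theta>. S (z + \<theta> *\<^sub>R h) * indicator {0..1::real} \<theta> * indicator (box l u) z \<partial>lborel)"
  proof eventually_elim
    case (elim z)
    show ?case
    proof (cases "z \<in> box l u")
      case True
      have S: "ennreal \<bar>\<Sum>b\<in>Basis. (h \<bullet> b) * G b x\<bar> \<le> S x" for x
      proof -
        have "ennreal \<bar>\<Sum>b\<in>Basis. (h \<bullet> b) * G b x\<bar> \<le> ennreal (\<Sum>b\<in>Basis. \<bar>h \<bullet> b\<bar> * \<bar>G b x\<bar>)"
          by (intro ennreal_leI order_trans[OF sum_abs]) (simp add: abs_mult)
        then show ?thesis by (simp add: S_def sum_ennreal[symmetric] ennreal_mult)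
      qed
      have "ennreal \<bar>F (z + h) - F z\<bar>
          \<le> (\<integral>\<^sup>+\<theta>. ennreal \<bar>indicator {0..1} \<theta> * (\<Sum>b\<in>Basis. (h \<bullet> b) * G b (z + \<theta> *\<^sub>R h))\<bar> \<partial>lborel)"
        using elim True ennreal_abs_integral_le by simp
      also have "\<dots> \<le> (\<integral>\<^sup>+\<theta>. S (z + \<theta> *\<^sub>R h) * indicator {0..1::real} \<theta> \<partial>lborel)"
        using S by (intro nn_integral_mono) (auto simp: indicator_def)
      finally show ?thesis using True by simp
    qed simp
  qed
  then have "(\<integral>\<^sup>+z\<in>box l u. ennreal \<bar>F (z + h) - F z\<bar> \<partial>lborel)
      \<le> (\<integral>\<^sup>+z. (\<integral>\<^sup>+\<theta>. S (z + \<theta> *\<^sub>R h) * indicator {0..1::real} \<theta> * indicator (box l u) z \<partial>lborel) \<partial>lborel)"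
    by (rule nn_integral_mono_AE)
  also have "\<dots> = (\<integral>\<^sup>+\<theta>. (\<integral>\<^sup>+z. S (z + \<theta> *\<^sub>R h) * indicator {0..1::real} \<theta> * indicator (box l u) z \<partial>lborel) \<partial>lborel)"
    by (rule lborel_pair.Fubini') measurable
  also have "\<dots> = (\<integral>\<^sup>+\<theta>\<in>{0..1::real}. (\<integral>\<^sup>+z\<in>box l u. S (z + \<theta> *\<^sub>R h) \<partial>lborel) \<partial>lborel)"
    by (intro nn_integral_cong) (simp add: mult_ac nn_integral_cmult flip: nn_integral_cmult)
  finally show ?thesis unfolding S_def .
qed

lemma weak_grad_of_weak_deriv:
  fixes f :: "'a::euclidean_space \<Rightarrow> real"
  assumes U: "open U" "locally_L1 U f"
    and g: "\<And>b. b \<in> Basis \<Longrightarrow> is_weak_deriv U b f (g b)"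
  shows "\<exists>F G. weak_grad U F G \<and> (AE z in lborel. z \<in> U \<longrightarrow> f z = F z) \<and>
    (\<forall>b\<in>Basis. AE z in lborel. z \<in> U \<longrightarrow> g b z = G b z)"
proof -
  obtain F where F: "F \<in> borel_measurable borel" "AE z in lborel. z \<in> U \<longrightarrow> f z = F z"
    using borel_representative[OF U] by blast
  have "\<exists>Gb. b \<in> Basis \<longrightarrow> Gb \<in> borel_measurable borel \<and> (AE z in lborel. z \<in> U \<longrightarrow> g b z = Gb z)" for b
    using borel_representative[OF U(1)] g unfolding is_weak_deriv_def by blast
  then obtain G where G: "\<And>b. b \<in> Basis \<Longrightarrow> G b \<in> borel_measurable borel"
      "\<And>b. b \<in> Basis \<Longrightarrow> AE z in lborel. z \<in> U \<longrightarrow> g b z = G b z"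
    by metis
  have "weak_grad U F G"
    unfolding weak_grad_def
  proof (intro conjI ballI allI impI F(1))
    fix K h and l u :: 'a
    assume "compact K \<and> K \<subseteq> U \<and> (\<forall>\<theta>\<in>{0..1}. \<forall>z\<in>cbox l u. z + \<theta> *\<^sub>R h \<in> K)"
    then show "AE z in lborel. z \<in> box l u \<longrightarrow> F (z + h) - F z =
        (\<integral>\<theta>. indicator {0..1} \<theta> * (\<Sum>b\<in>Basis. (h \<bullet> b) * G b (z + \<theta> *\<^sub>R h)) \<partial>lborel)"
      by (intro weak_translation_identity[OF U g F G, of K]) auto
  qed (rule G(1))
  then show ?thesis using F G by blast
qed

lemma weak_grad_measurable:
  assumes "weak_grad U F G"
  shows "F \<in> borel_measurable borel" "b \<in> Basis \<Longrightarrow> G b \<in> borel_measurable borel"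
  using assms by (auto simp: weak_grad_def)

lemma nn_integral_lborel_prod:
  fixes f :: "'a::euclidean_space \<times> 'b::euclidean_space \<Rightarrow> ennreal"
  assumes "f \<in> borel_measurable borel"
  shows "(\<integral>\<^sup>+z. f z \<partial>lborel) = (\<integral>\<^sup>+x. (\<integral>\<^sup>+y. f (x, y) \<partial>lborel) \<partial>lborel)"
proof -
  have "f \<in> borel_measurable (lborel \<Otimes>\<^sub>M lborel)" using assms by (simp add: lborel_prod)
  from lborel.nn_integral_fst[OF this] show ?thesis by (simp add: lborel_prod)
qed

lemma box_segment:
  fixes z h :: "'a::euclidean_space"
  assumes "z \<in> S" "z + h \<in> S" "\<theta> \<in> {0..1::real}" "convex S"
  shows "z + \<theta> *\<^sub>R h \<in> S"
proof -
  have "z + \<theta> *\<^sub>R h = (1 - \<theta>) *\<^sub>R z + \<theta> *\<^sub>R (z + h)" by (simp add: algebra_simps)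
  then show ?thesis using assms by (simp add: convex_alt)
qed

text \<open>
  Substitute \<open>w = z + h\<close>. For fixed \<open>h\<close> the points \<open>z\<close> with both \<open>z\<close> and \<open>z + h\<close> in the box form a
  smaller box, the segments between them stay in the original box by convexity, and
  \<open>weak_grad_translation\<close> bounds the inner integral by that of the gradient. The vectors \<open>h\<close> range over
  the box of differences.
\<close>

lemma weak_poincare:
  fixes F :: "'a::euclidean_space \<Rightarrow> real"
  assumes wg: "weak_grad U F G" and sub: "cbox l u \<subseteq> U"
  shows "(\<integral>\<^sup>+z\<in>box l u. (\<integral>\<^sup>+w\<in>box l u. ennreal \<bar>F z - F w\<bar> \<partial>lborel) \<partial>lborel)
    \<le> emeasure lborel (box (l - u) (u - l)) *
      (\<Sum>b\<in>Basis. ennreal ((u - l) \<bullet> b) * (\<integral>\<^sup>+z\<in>box l u. ennreal \<bar>G b z\<bar> \<partial>lborel))"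
proof -
  note weak_grad_measurable[OF wg, measurable]
  define B where "B = box l u"
  have [measurable]: "B \<in> sets borel" by (simp add: B_def)
  have convB: "convex B" by (simp add: B_def)
  define R where "R = (\<Sum>b\<in>Basis. ennreal ((u - l) \<bullet> b) * (\<integral>\<^sup>+z\<in>B. ennreal \<bar>G b z\<bar> \<partial>lborel))"
  have inner: "(\<integral>\<^sup>+z. ennreal \<bar>F (z + h) - F z\<bar> * indicator B z * indicator B (z + h) \<partial>lborel)
      \<le> R * indicator (box (l - u) (u - l)) h" for h
  proof (cases "\<exists>z. z \<in> B \<and> z + h \<in> B")
    case False
    then have "(\<integral>\<^sup>+z. ennreal \<bar>F (z + h) - F z\<bar> * indicator B z * indicator B (z + h) \<partial>lborel) = (\<integral>\<^sup>+z. 0 \<partial>(lborel :: 'a measure))"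
      by (intro nn_integral_cong) (auto simp: indicator_def)
    then show ?thesis by simp
  next
    case True
    then obtain z0 where z0: "z0 \<in> B" "z0 + h \<in> B" by blast
    have hb: "l \<bullet> b - u \<bullet> b < h \<bullet> b" "h \<bullet> b < u \<bullet> b - l \<bullet> b" if "b \<in> Basis" for b
      using z0 that unfolding B_def mem_box by (smt (verit) inner_add_left)+
    then have h: "h \<in> box (l - u) (u - l)" by (simp add: mem_box inner_diff_left)
    obtain l' u' where B': "box l u \<inter> box (l - h) (u - h) = box l' u'"
      unfolding box_Int_box by blast
    \<comment> \<open>the box of those \<open>z\<close> for which both end points of the segment lie in \<open>B\<close>\<close>
    have B'_mem: "z \<in> box l' u' \<longleftrightarrow> z \<in> B \<and> z + h \<in> B" for z
      unfolding B'[symmetric] B_def by (auto simp: mem_box algebra_simps)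
    then have "z0 \<in> box l' u'" using z0 by simp
    then have cl: "cbox l' u' = closure (box l' u')" by (metis closure_box empty_iff)
    have "cbox l' u' \<subseteq> cbox l u"
      unfolding cl by (rule closure_minimal) (use B'_mem box_subset_cbox in \<open>auto simp: B_def\<close>)
    moreover have "cbox l' u' \<subseteq> {z. z + h \<in> cbox l u}"
      unfolding cl
    proof (rule closure_minimal)
      show "closed {z. z + h \<in> cbox l u}"
        using closed_vimage[OF closed_cbox, of "\<lambda>z. z + h" l u] by (simp add: vimage_def continuous_intros)
      show "box l' u' \<subseteq> {z. z + h \<in> cbox l u}"
        using B'_mem box_subset_cbox[of l u] by (auto simp: B_def)
    qed
    ultimately have K: "z + \<theta> *\<^sub>R h \<in> cbox l u" if "\<theta> \<in> {0..1}" "z \<in> cbox l' u'" for \<theta> :: real and z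
      using that by (intro box_segment) auto
    have "(\<integral>\<^sup>+z. ennreal \<bar>F (z + h) - F z\<bar> * indicator B z * indicator B (z + h) \<partial>lborel)
        = (\<integral>\<^sup>+z\<in>box l' u'. ennreal \<bar>F (z + h) - F z\<bar> \<partial>lborel)"
      by (intro nn_integral_cong) (simp add: B'_mem indicator_def)
    also have "\<dots> \<le> (\<integral>\<^sup>+\<theta>\<in>{0..1::real}. (\<integral>\<^sup>+z\<in>box l' u'. (\<Sum>b\<in>Basis. ennreal \<bar>h \<bullet> b\<bar> * ennreal \<bar>G b (z + \<theta> *\<^sub>R h)\<bar>) \<partial>lborel) \<partial>lborel)"
      by (rule weak_grad_translation[OF wg compact_cbox sub K])
    also have "\<dots> \<le> (\<integral>\<^sup>+\<theta>\<in>{0..1::real}. R \<partial>lborel)"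
    proof (rule nn_integral_mono)
      fix \<theta> :: real
      show "(\<integral>\<^sup>+z\<in>box l' u'. (\<Sum>b\<in>Basis. ennreal \<bar>h \<bullet> b\<bar> * ennreal \<bar>G b (z + \<theta> *\<^sub>R h)\<bar>) \<partial>lborel) * indicator {0..1} \<theta>
          \<le> R * indicator {0..1} \<theta>"
      proof (cases "\<theta> \<in> {0..1}")
        case True
        have "(\<integral>\<^sup>+z\<in>box l' u'. (\<Sum>b\<in>Basis. ennreal \<bar>h \<bullet> b\<bar> * ennreal \<bar>G b (z + \<theta> *\<^sub>R h)\<bar>) \<partial>lborel)
            \<le> (\<integral>\<^sup>+z. (\<Sum>b\<in>Basis. ennreal ((u - l) \<bullet> b) * (ennreal \<bar>G b (z + \<theta> *\<^sub>R h)\<bar> * indicator B (z + \<theta> *\<^sub>R h))) \<partial>lborel)"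
        proof (rule nn_integral_mono)
          fix z
          show "(\<Sum>b\<in>Basis. ennreal \<bar>h \<bullet> b\<bar> * ennreal \<bar>G b (z + \<theta> *\<^sub>R h)\<bar>) * indicator (box l' u') z
            \<le> (\<Sum>b\<in>Basis. ennreal ((u - l) \<bullet> b) * (ennreal \<bar>G b (z + \<theta> *\<^sub>R h)\<bar> * indicator B (z + \<theta> *\<^sub>R h)))"
          proof (cases "z \<in> box l' u'")
            case True2: True
            then have "z + \<theta> *\<^sub>R h \<in> B"
              using box_segment[OF _ _ True convB, of z h] B'_mem by blast
            moreover have "ennreal \<bar>h \<bullet> b\<bar> \<le> ennreal ((u - l) \<bullet> b)" if "b \<in> Basis" for b
              using hb[OF that] by (intro ennreal_leI) (auto simp: inner_diff_left)
            ultimately show ?thesis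
              using True2 by (auto intro!: sum_mono mult_right_mono)
          qed simp
        qed
        also have "\<dots> = (\<Sum>b\<in>Basis. ennreal ((u - l) \<bullet> b) * (\<integral>\<^sup>+z. ennreal \<bar>G b (z + \<theta> *\<^sub>R h)\<bar> * indicator B (z + \<theta> *\<^sub>R h) \<partial>lborel))"
          by (subst nn_integral_sum) (auto simp: nn_integral_cmult)
        also have "\<dots> = R"
          unfolding R_def
          by (intro sum.cong refl arg_cong2[where f = "(*)"] nn_integral_lborel_shift[of "\<lambda>z. ennreal \<bar>G _ z\<bar> * indicator B z"]) simp
        finally show ?thesis using True by simp
      qed simp
    qed
    also have "\<dots> = R" by (simp add: nn_integral_cmult_indicator)
    finally show ?thesis using h by simp
  qed
  have "(\<integral>\<^sup>+z\<in>B. (\<integral>\<^sup>+w\<in>B. ennreal \<bar>F z - F w\<bar> \<partial>lborel) \<partial>lborel)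
      = (\<integral>\<^sup>+z. (\<integral>\<^sup>+h. ennreal \<bar>F (z + h) - F z\<bar> * indicator B z * indicator B (z + h) \<partial>lborel) \<partial>lborel)"
  proof (rule nn_integral_cong)
    fix z
    have "(\<integral>\<^sup>+w\<in>B. ennreal \<bar>F z - F w\<bar> \<partial>lborel) = (\<integral>\<^sup>+h. ennreal \<bar>F z - F (h + z)\<bar> * indicator B (h + z) \<partial>lborel)"
      by (rule nn_integral_lborel_shift[symmetric]) simp
    also have "\<dots> * indicator B z = (\<integral>\<^sup>+h. ennreal \<bar>F z - F (h + z)\<bar> * indicator B (h + z) * indicator B z \<partial>lborel)"
      by (rule nn_integral_multc[symmetric]) simp
    finally show "(\<integral>\<^sup>+w\<in>B. ennreal \<bar>F z - F w\<bar> \<partial>lborel) * indicator B z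
        = (\<integral>\<^sup>+h. ennreal \<bar>F (z + h) - F z\<bar> * indicator B z * indicator B (z + h) \<partial>lborel)"
      by (simp add: mult_ac add.commute abs_minus_commute)
  qed
  also have "\<dots> = (\<integral>\<^sup>+h. (\<integral>\<^sup>+z. ennreal \<bar>F (z + h) - F z\<bar> * indicator B z * indicator B (z + h) \<partial>lborel) \<partial>lborel)"
    by (rule lborel_pair.Fubini') measurable
  also have "\<dots> \<le> (\<integral>\<^sup>+h. R * indicator (box (l - u) (u - l)) h \<partial>lborel)"
    by (intro nn_integral_mono inner)
  also have "\<dots> = R * emeasure lborel (box (l - u) (u - l))"
    by (simp add: nn_integral_cmult_indicator)
  finally show ?thesis unfolding R_def B_def by (simp add: mult.commute)
qed

section \<open>Traces\<close>

text \<open>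
  For almost every point the difference is at most the integral of the vertical derivative over the
  segment from \<open>(x, t)\<close> to \<open>(x, t + s)\<close>, which lies in the column below the height \<open>r\<close>. The
  set of heights has length \<open>\<delta>\<close>. It stays away from 0 so that all segments lie in a compact subset of the
  half-space.
\<close>

lemma weak_grad_vertical:
  fixes F :: "'a::euclidean_space \<times> real \<Rightarrow> real"
  assumes wg: "weak_grad (UNIV \<times> {0<..}) F G" and \<delta>: "0 < \<delta>" and s: "0 \<le> s" "s + 2 * \<delta> \<le> r"
  shows "(\<integral>\<^sup>+t\<in>{\<delta><..<2*\<delta>}. (\<integral>\<^sup>+x\<in>box a b. ennreal \<bar>F (x, t + s) - F (x, t)\<bar> \<partial>lborel) \<partial>lborel)
    \<le> ennreal \<delta> * (\<integral>\<^sup>+z\<in>box a b \<times> {0<..<r}. ennreal \<bar>G (0, 1) z\<bar> \<partial>lborel)"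
proof -
  define Q where "Q = box a b"
  define W where "W = (\<integral>\<^sup>+z\<in>Q \<times> {0<..<r}. ennreal \<bar>G (0, 1) z\<bar> \<partial>lborel)"
  have e1: "(0, 1) \<in> (Basis :: ('a \<times> real) set)" by (simp add: Basis_prod_def)
  have [measurable]: "F \<in> borel_measurable borel" "G (0, 1) \<in> borel_measurable borel" "Q \<in> sets borel"
    using weak_grad_measurable[OF wg] e1 by (auto simp: Q_def)
  have Fm[measurable]: "F \<in> borel_measurable (borel \<Otimes>\<^sub>M borel)" "G (0, 1) \<in> borel_measurable (borel \<Otimes>\<^sub>M borel)"
    by (simp_all add: borel_prod)
  have box_eq: "box (a, \<delta>) (b, 2 * \<delta>) = Q \<times> {\<delta><..<2*\<delta>}"
    by (auto simp: Q_def mem_box Basis_prod_def)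
  have slice: "ennreal s * (\<integral>\<^sup>+\<theta>\<in>{0..1}. ennreal \<bar>G (0, 1) (x, t + \<theta> * s)\<bar> \<partial>lborel)
      \<le> (\<integral>\<^sup>+\<tau>\<in>{0<..<r}. ennreal \<bar>G (0, 1) (x, \<tau>)\<bar> \<partial>lborel)" if t: "t \<in> {\<delta><..<2*\<delta>}" for x t
  proof (cases "s = 0")
    case False
    then have "s > 0" using s by simp
    have "(\<integral>\<^sup>+\<tau>. ennreal \<bar>G (0, 1) (x, \<tau>)\<bar> * indicator {t..t+s} \<tau> \<partial>lborel)
        = \<bar>s\<bar> * (\<integral>\<^sup>+\<theta>. ennreal \<bar>G (0, 1) (x, t + s * \<theta>)\<bar> * indicator {t..t+s} (t + s * \<theta>) \<partial>lborel)"
      by (rule nn_integral_real_affine) (use \<open>s > 0\<close> in auto)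
    also have "(\<integral>\<^sup>+\<theta>. ennreal \<bar>G (0, 1) (x, t + s * \<theta>)\<bar> * indicator {t..t+s} (t + s * \<theta>) \<partial>lborel)
        = (\<integral>\<^sup>+\<theta>\<in>{0..1}. ennreal \<bar>G (0, 1) (x, t + \<theta> * s)\<bar> \<partial>lborel)"
      by (intro nn_integral_cong) (use \<open>s > 0\<close> in \<open>auto simp: indicator_def mult.commute mult_le_cancel_left1 zero_le_mult_iff\<close>)
    finally have "ennreal s * (\<integral>\<^sup>+\<theta>\<in>{0..1}. ennreal \<bar>G (0, 1) (x, t + \<theta> * s)\<bar> \<partial>lborel)
        = (\<integral>\<^sup>+\<tau>\<in>{t..t+s}. ennreal \<bar>G (0, 1) (x, \<tau>)\<bar> \<partial>lborel)" using s by simp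
    also have "\<dots> \<le> (\<integral>\<^sup>+\<tau>\<in>{0<..<r}. ennreal \<bar>G (0, 1) (x, \<tau>)\<bar> \<partial>lborel)"
      by (intro nn_integral_mono) (use t s \<delta> in \<open>auto simp: indicator_def\<close>)
    finally show ?thesis .
  qed simp
  have "(\<integral>\<^sup>+t\<in>{\<delta><..<2*\<delta>}. (\<integral>\<^sup>+x\<in>Q. ennreal \<bar>F (x, t + s) - F (x, t)\<bar> \<partial>lborel) \<partial>lborel)
      = (\<integral>\<^sup>+x. (\<integral>\<^sup>+t. ennreal \<bar>F (x, t + s) - F (x, t)\<bar> * indicator Q x * indicator {\<delta><..<2*\<delta>} t \<partial>lborel) \<partial>lborel)"
    by (subst lborel_pair.Fubini'[symmetric]) (auto simp: nn_integral_multc)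
  also have "\<dots> = (\<integral>\<^sup>+z\<in>box (a, \<delta>) (b, 2 * \<delta>). ennreal \<bar>F (z + (0, s)) - F z\<bar> \<partial>lborel)"
    unfolding box_eq[symmetric]
    by (subst nn_integral_lborel_prod, measurable) (auto intro!: nn_integral_cong simp: indicator_def box_eq)
  also have "\<dots> \<le> (\<integral>\<^sup>+\<theta>\<in>{0..1::real}. (\<integral>\<^sup>+z\<in>box (a, \<delta>) (b, 2 * \<delta>).
      (\<Sum>e\<in>Basis. ennreal \<bar>(0, s) \<bullet> e\<bar> * ennreal \<bar>G e (z + \<theta> *\<^sub>R (0, s))\<bar>) \<partial>lborel) \<partial>lborel)"
  proof (rule weak_grad_translation[OF wg])
    show "compact (cbox (a, \<delta>) (b, r))" by (rule compact_cbox)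
    show "cbox (a, \<delta>) (b, r) \<subseteq> UNIV \<times> {0<..}" using \<delta> by (auto simp: cbox_Pair_eq)
    show "z + \<theta> *\<^sub>R (0, s) \<in> cbox (a, \<delta>) (b, r)"
      if "\<theta> \<in> {0..1}" "z \<in> cbox (a, \<delta>) (b, 2 * \<delta>)" for \<theta> z
    proof -
      have "0 \<le> \<theta> * s" "\<theta> * s \<le> s" using that s by (auto intro: mult_left_le_one_le)
      moreover obtain x t where "z = (x, t)" by fastforce
      ultimately show ?thesis using that s by simp
    qed
  qed
  also have "\<dots> = (\<integral>\<^sup>+\<theta>\<in>{0..1::real}. (\<integral>\<^sup>+z\<in>box (a, \<delta>) (b, 2 * \<delta>).
      (ennreal s * ennreal \<bar>G (0, 1) (z + \<theta> *\<^sub>R (0, s))\<bar>) \<partial>lborel) \<partial>lborel)"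
  proof -
    have "(\<Sum>e\<in>Basis. ennreal \<bar>(0::'a, s) \<bullet> e\<bar> * ennreal \<bar>G e w\<bar>) = ennreal s * ennreal \<bar>G (0, 1) w\<bar>" for w
    proof -
      have "(\<Sum>e\<in>Basis. ennreal \<bar>(0::'a, s) \<bullet> e\<bar> * ennreal \<bar>G e w\<bar>)
          = (\<Sum>e\<in>(Basis :: ('a \<times> real) set). if e = (0, 1) then ennreal s * ennreal \<bar>G (0, 1) w\<bar> else 0)"
        using s by (intro sum.cong) (auto simp: Basis_prod_def)
      then show ?thesis using e1 by (simp add: sum.delta)
    qed
    then show ?thesis by simp
  qed
  also have "\<dots> = (\<integral>\<^sup>+z\<in>box (a, \<delta>) (b, 2 * \<delta>).
      (\<integral>\<^sup>+\<theta>\<in>{0..1::real}. ennreal s * ennreal \<bar>G (0, 1) (z + \<theta> *\<^sub>R (0, s))\<bar> \<partial>lborel) \<partial>lborel)"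
  proof -
    have "(\<integral>\<^sup>+\<theta>\<in>{0..1::real}. (\<integral>\<^sup>+z\<in>box (a, \<delta>) (b, 2 * \<delta>).
        (ennreal s * ennreal \<bar>G (0, 1) (z + \<theta> *\<^sub>R (0, s))\<bar>) \<partial>lborel) \<partial>lborel)
      = (\<integral>\<^sup>+\<theta>. (\<integral>\<^sup>+z. ennreal s * ennreal \<bar>G (0, 1) (z + \<theta> *\<^sub>R (0, s))\<bar> *
          indicator (box (a, \<delta>) (b, 2 * \<delta>)) z * indicator {0..1::real} \<theta> \<partial>lborel) \<partial>lborel)"
      by (intro nn_integral_cong nn_integral_multc[symmetric]) simp
    also have "\<dots> = (\<integral>\<^sup>+z. (\<integral>\<^sup>+\<theta>. ennreal s * ennreal \<bar>G (0, 1) (z + \<theta> *\<^sub>R (0, s))\<bar> *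
          indicator (box (a, \<delta>) (b, 2 * \<delta>)) z * indicator {0..1::real} \<theta> \<partial>lborel) \<partial>lborel)"
      by (rule lborel_pair.Fubini') measurable
    also have "\<dots> = (\<integral>\<^sup>+z. (\<integral>\<^sup>+\<theta>. (ennreal s * ennreal \<bar>G (0, 1) (z + \<theta> *\<^sub>R (0, s))\<bar> * indicator {0..1::real} \<theta>) *
          indicator (box (a, \<delta>) (b, 2 * \<delta>)) z \<partial>lborel) \<partial>lborel)"
      by (simp add: mult_ac)
    also have "\<dots> = (\<integral>\<^sup>+z\<in>box (a, \<delta>) (b, 2 * \<delta>).
      (\<integral>\<^sup>+\<theta>\<in>{0..1::real}. ennreal s * ennreal \<bar>G (0, 1) (z + \<theta> *\<^sub>R (0, s))\<bar> \<partial>lborel) \<partial>lborel)"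
      by (intro nn_integral_cong nn_integral_multc) simp
    finally show ?thesis .
  qed
  also have "\<dots> \<le> (\<integral>\<^sup>+z. (\<integral>\<^sup>+\<tau>\<in>{0<..<r}. ennreal \<bar>G (0, 1) (fst z, \<tau>)\<bar> \<partial>lborel) *
      (indicator Q (fst z) * indicator {\<delta><..<2*\<delta>} (snd z)) \<partial>lborel)"
  proof (rule nn_integral_mono)
    fix z :: "'a \<times> real"
    obtain x t where z: "z = (x, t)" by fastforce
    have "(\<integral>\<^sup>+\<theta>\<in>{0..1::real}. ennreal s * ennreal \<bar>G (0, 1) (z + \<theta> *\<^sub>R (0, s))\<bar> \<partial>lborel)
       = ennreal s * (\<integral>\<^sup>+\<theta>\<in>{0..1}. ennreal \<bar>G (0, 1) (x, t + \<theta> * s)\<bar> \<partial>lborel)"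
      unfolding z by (subst nn_integral_cmult[symmetric]) (auto simp: mult_ac)
    then show "(\<integral>\<^sup>+\<theta>\<in>{0..1::real}. ennreal s * ennreal \<bar>G (0, 1) (z + \<theta> *\<^sub>R (0, s))\<bar> \<partial>lborel) *
        indicator (box (a, \<delta>) (b, 2 * \<delta>)) z
      \<le> (\<integral>\<^sup>+\<tau>\<in>{0<..<r}. ennreal \<bar>G (0, 1) (fst z, \<tau>)\<bar> \<partial>lborel) *
      (indicator Q (fst z) * indicator {\<delta><..<2*\<delta>} (snd z))"
      using slice[of t x] unfolding box_eq z by (auto simp: indicator_def)
  qed
  also have "\<dots> = (\<integral>\<^sup>+x. (\<integral>\<^sup>+t. (\<integral>\<^sup>+\<tau>\<in>{0<..<r}. ennreal \<bar>G (0, 1) (x, \<tau>)\<bar> \<partial>lborel) *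
      (indicator Q x * indicator {\<delta><..<2*\<delta>} t) \<partial>lborel) \<partial>lborel)"
    by (subst nn_integral_lborel_prod) (auto simp: borel_prod[symmetric])
  also have "\<dots> = (\<integral>\<^sup>+x. ennreal \<delta> * (\<integral>\<^sup>+\<tau>. ennreal \<bar>G (0, 1) (x, \<tau>)\<bar> * indicator {0<..<r} \<tau> * indicator Q x \<partial>lborel) \<partial>lborel)"
  proof (rule nn_integral_cong)
    fix x
    let ?I = "\<integral>\<^sup>+\<tau>\<in>{0<..<r}. ennreal \<bar>G (0, 1) (x, \<tau>)\<bar> \<partial>lborel"
    have "(\<integral>\<^sup>+t. ?I * (indicator Q x * indicator {\<delta><..<2*\<delta>} t) \<partial>lborel)
        = (\<integral>\<^sup>+t. (?I * indicator Q x) * indicator {\<delta><..<2*\<delta>} t \<partial>lborel)" by (simp add: mult_ac)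
    also have "\<dots> = (?I * indicator Q x) * emeasure lborel {\<delta><..<2*\<delta>}"
      by (rule nn_integral_cmult_indicator) simp
    also have "\<dots> = ennreal \<delta> * (?I * indicator Q x)" using \<delta> by (simp add: mult.commute)
    also have "?I * indicator Q x = (\<integral>\<^sup>+\<tau>. ennreal \<bar>G (0, 1) (x, \<tau>)\<bar> * indicator {0<..<r} \<tau> * indicator Q x \<partial>lborel)"
      by (rule nn_integral_multc[symmetric]) simp
    finally show "(\<integral>\<^sup>+t. ?I * (indicator Q x * indicator {\<delta><..<2*\<delta>} t) \<partial>lborel) =
        ennreal \<delta> * (\<integral>\<^sup>+\<tau>. ennreal \<bar>G (0, 1) (x, \<tau>)\<bar> * indicator {0<..<r} \<tau> * indicator Q x \<partial>lborel)" .
  qed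
  also have "\<dots> = ennreal \<delta> * W"
  proof -
    have "W = (\<integral>\<^sup>+x. (\<integral>\<^sup>+\<tau>. ennreal \<bar>G (0, 1) (x, \<tau>)\<bar> * indicator {0<..<r} \<tau> * indicator Q x \<partial>lborel) \<partial>lborel)"
      unfolding W_def
      by (subst nn_integral_lborel_prod)
        (auto intro!: nn_integral_cong borel_measurable_times_ennreal simp: indicator_def borel_prod[symmetric])
    then show ?thesis by (simp add: nn_integral_cmult)
  qed
  finally show ?thesis unfolding W_def Q_def .
qed

lemma nn_integral_windows:
  fixes E :: "real \<Rightarrow> ennreal"
  assumes [measurable]: "E \<in> borel_measurable borel" and "0 < \<delta>"
    and window: "\<And>i::nat. i < N \<Longrightarrow> (\<integral>\<^sup>+t\<in>{c + real i * \<delta><..<c + (real i + 1) * \<delta>}. E t \<partial>lborel) \<le> M"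
  shows "(\<integral>\<^sup>+t\<in>{c..<c + N * \<delta>}. E t \<partial>lborel) \<le> of_nat N * M"
  using window
proof (induction N)
  case (Suc N)
  have "(\<integral>\<^sup>+t\<in>{c..<c + Suc N * \<delta>}. E t \<partial>lborel)
      = (\<integral>\<^sup>+t. E t * indicator {c..<c + N * \<delta>} t + E t * indicator {c + real N * \<delta><..<c + (real N + 1) * \<delta>} t \<partial>lborel)"
  proof (rule nn_integral_cong_AE)
    define p where "p = real N * \<delta>"
    have p: "0 \<le> p" "c + Suc N * \<delta> = c + p + \<delta>" "c + (real N + 1) * \<delta> = c + p + \<delta>" "c + N * \<delta> = c + p"
      using assms(2) by (simp_all add: p_def algebra_simps)
    show "AE t in lborel. E t * indicator {c..<c + Suc N * \<delta>} t =
        E t * indicator {c..<c + N * \<delta>} t + E t * indicator {c + real N * \<delta><..<c + (real N + 1) * \<delta>} t"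
      unfolding p(2-) using AE_lborel_singleton[of "c + p"]
      by eventually_elim (use assms(2) p(1) in \<open>auto simp: indicator_def\<close>)
  qed
  also have "\<dots> = (\<integral>\<^sup>+t\<in>{c..<c + N * \<delta>}. E t \<partial>lborel) + (\<integral>\<^sup>+t\<in>{c + real N * \<delta><..<c + (real N + 1) * \<delta>}. E t \<partial>lborel)"
    by (rule nn_integral_add) auto
  also have "\<dots> \<le> of_nat N * M + M"
    using Suc.IH Suc.prems by (intro add_mono) auto
  finally show ?case by (simp add: distrib_right add.commute)
qed simp

text \<open>
  The interval from \<open>r/2\<close> to \<open>r\<close> is divided into windows of length \<open>\<delta>\<close>, and each is a translate
  of the interval from \<open>\<delta>\<close> to \<open>2 * \<delta>\<close>. On the latter \<open>F\<close> is close to its trace if \<open>\<delta>\<close> is small, and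
  the translation costs at most \<open>\<delta>\<close> times the integral over the column. Averaging over
  windows avoids any choice of good heights.
\<close>

lemma boundary_layer:
  fixes F :: "'a::euclidean_space \<times> real \<Rightarrow> real" and \<Phi> :: "'a \<Rightarrow> real"
  assumes wg: "weak_grad (UNIV \<times> {0<..}) F G" and \<Phi>[measurable]: "\<Phi> \<in> borel_measurable borel"
    and r: "0 < r"
    and trace: "\<And>\<epsilon>. 0 < \<epsilon> \<Longrightarrow> \<exists>\<delta>>0. AE t in lborel. t \<in> {0<..<\<delta>} \<longrightarrow>
      (\<integral>\<^sup>+x\<in>box a b. ennreal \<bar>\<Phi> x - F (x, t)\<bar> \<partial>lborel) \<le> ennreal \<epsilon>"
  shows "(\<integral>\<^sup>+t\<in>{r/2<..<r}. (\<integral>\<^sup>+x\<in>box a b. ennreal \<bar>\<Phi> x - F (x, t)\<bar> \<partial>lborel) \<partial>lborel)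
    \<le> ennreal (r / 2) * (\<integral>\<^sup>+z\<in>box a b \<times> {0<..<r}. ennreal \<bar>G (0, 1) z\<bar> \<partial>lborel)"
proof -
  define Q where "Q = box a b"
  define W where "W = (\<integral>\<^sup>+z\<in>Q \<times> {0<..<r}. ennreal \<bar>G (0, 1) z\<bar> \<partial>lborel)"
  define E where "E t = (\<integral>\<^sup>+x\<in>Q. ennreal \<bar>\<Phi> x - F (x, t)\<bar> \<partial>lborel)" for t
  have [measurable]: "F \<in> borel_measurable (borel \<Otimes>\<^sub>M borel)" "Q \<in> sets borel"
    using weak_grad_measurable[OF wg] by (simp_all add: borel_prod Q_def)
  have [measurable]: "E \<in> borel_measurable borel"
    unfolding E_def[abs_def] by measurable
  have "(\<integral>\<^sup>+t\<in>{r/2<..<r}. E t \<partial>lborel) \<le> ennreal (r / 2) * W + ennreal e" if e: "0 < e" for e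
  proof -
    \<comment> \<open>chosen so that the total error \<open>\<epsilon> * (r / 2)\<close> of all windows is \<open>e\<close>\<close>
    define \<epsilon> where "\<epsilon> = 2 * e / r"
    have \<epsilon>: "0 < \<epsilon>" using e r by (simp add: \<epsilon>_def)
    obtain \<delta>0 where \<delta>0: "\<delta>0 > 0" "AE t in lborel. t \<in> {0<..<\<delta>0} \<longrightarrow> E t \<le> ennreal \<epsilon>"
      using trace[OF \<epsilon>] unfolding E_def Q_def by blast
    obtain N :: nat where N: "r / \<delta>0 < N" using reals_Archimedean2 by blast
    have N0: "0 < real N" using N r \<delta>0(1) by (meson divide_pos_pos less_trans)
    define \<delta> where "\<delta> = r / (2 * N)"
    have \<delta>: "0 < \<delta>" "2 * \<delta> < \<delta>0" "N * \<delta> = r / 2"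
      using N N0 r \<delta>0(1) by (auto simp: \<delta>_def field_simps)
    have near: "(\<integral>\<^sup>+t\<in>{\<delta><..<2*\<delta>}. E t \<partial>lborel) \<le> ennreal \<delta> * ennreal \<epsilon>"
    proof -
      have "(\<integral>\<^sup>+t\<in>{\<delta><..<2*\<delta>}. E t \<partial>lborel) \<le> (\<integral>\<^sup>+t\<in>{\<delta><..<2*\<delta>}. ennreal \<epsilon> \<partial>lborel)"
        by (rule nn_integral_mono_AE, use \<delta>0(2) in eventually_elim)
          (use \<delta> in \<open>auto simp: indicator_def\<close>)
      then show ?thesis using \<delta>(1) by (simp add: nn_integral_cmult_indicator mult.commute)
    qed
    have window: "(\<integral>\<^sup>+t\<in>{r/2 + real i * \<delta><..<r/2 + (real i + 1) * \<delta>}. E t \<partial>lborel) \<le> ennreal \<delta> * (ennreal \<epsilon> + W)"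
      if i: "i < N" for i :: nat
    proof -
      \<comment> \<open>the shift that carries the reference interval onto the window number \<open>i\<close>\<close>
      define s where "s = r / 2 - \<delta> + i * \<delta>"
      have "\<delta> * 1 \<le> \<delta> * N" using N0 \<delta>(1) by (intro mult_left_mono) auto
      moreover have "0 \<le> i * \<delta>" using \<delta>(1) by simp
      ultimately have s0: "0 \<le> s" using \<delta>(3) unfolding s_def by (simp add: mult.commute)
      have "(real i + 1) * \<delta> \<le> N * \<delta>" using i \<delta>(1) by (intro mult_right_mono) auto
      then have s1: "s + 2 * \<delta> \<le> r" using \<delta>(3) by (simp add: s_def algebra_simps)
      have "(\<integral>\<^sup>+t\<in>{r/2 + real i * \<delta><..<r/2 + (real i + 1) * \<delta>}. E t \<partial>lborel)
          = (\<integral>\<^sup>+t. E (t + s) * indicator {r/2 + real i * \<delta><..<r/2 + (real i + 1) * \<delta>} (t + s) \<partial>lborel)"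
        by (rule nn_integral_lborel_shift[symmetric]) measurable
      also have "\<dots> = (\<integral>\<^sup>+t\<in>{\<delta><..<2*\<delta>}. E (t + s) \<partial>lborel)"
        by (intro nn_integral_cong) (auto simp: indicator_def s_def algebra_simps)
      also have "\<dots> \<le> (\<integral>\<^sup>+t. E t * indicator {\<delta><..<2*\<delta>} t +
          (\<integral>\<^sup>+x\<in>Q. ennreal \<bar>F (x, t + s) - F (x, t)\<bar> \<partial>lborel) * indicator {\<delta><..<2*\<delta>} t \<partial>lborel)"
      proof (rule nn_integral_mono)
        fix t
        have "E (t + s) \<le> (\<integral>\<^sup>+x. ennreal \<bar>\<Phi> x - F (x, t)\<bar> * indicator Q x + ennreal \<bar>F (x, t + s) - F (x, t)\<bar> * indicator Q x \<partial>lborel)"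
          unfolding E_def
          by (intro nn_integral_mono) (auto simp: indicator_def ennreal_plus[symmetric] simp del: ennreal_plus intro!: ennreal_leI)
        also have "\<dots> = E t + (\<integral>\<^sup>+x\<in>Q. ennreal \<bar>F (x, t + s) - F (x, t)\<bar> \<partial>lborel)"
          unfolding E_def by (rule nn_integral_add) measurable
        finally show "E (t + s) * indicator {\<delta><..<2*\<delta>} t \<le> E t * indicator {\<delta><..<2*\<delta>} t +
          (\<integral>\<^sup>+x\<in>Q. ennreal \<bar>F (x, t + s) - F (x, t)\<bar> \<partial>lborel) * indicator {\<delta><..<2*\<delta>} t"
          by (simp add: indicator_def)
      qed
      also have "\<dots> = (\<integral>\<^sup>+t\<in>{\<delta><..<2*\<delta>}. E t \<partial>lborel) +
          (\<integral>\<^sup>+t\<in>{\<delta><..<2*\<delta>}. (\<integral>\<^sup>+x\<in>Q. ennreal \<bar>F (x, t + s) - F (x, t)\<bar> \<partial>lborel) \<partial>lborel)"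
        by (rule nn_integral_add) measurable
      also have "\<dots> \<le> ennreal \<delta> * ennreal \<epsilon> + ennreal \<delta> * W"
        using weak_grad_vertical[OF wg \<delta>(1) s0 s1, of a b] near unfolding W_def Q_def by (intro add_mono)
      finally show ?thesis by (simp only: distrib_left)
    qed
    have "(\<integral>\<^sup>+t\<in>{r/2<..<r}. E t \<partial>lborel) \<le> (\<integral>\<^sup>+t\<in>{r/2..<r/2 + N * \<delta>}. E t \<partial>lborel)"
      by (intro nn_integral_mono) (auto simp: indicator_def \<delta>(3))
    also have "\<dots> \<le> of_nat N * (ennreal \<delta> * (ennreal \<epsilon> + W))"
      using window by (intro nn_integral_windows \<delta>(1)) auto
    also have "\<dots> = ennreal (N * \<delta>) * (ennreal \<epsilon> + W)"
      using \<delta>(1) by (simp add: ennreal_mult ennreal_of_nat_eq_real_of_nat mult.assoc)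
    also have "\<dots> = ennreal (r / 2) * W + ennreal e"
      unfolding \<delta>(3) using r e by (simp add: distrib_left ennreal_mult[symmetric] \<epsilon>_def add.commute)
    finally show ?thesis .
  qed
  then have "(\<integral>\<^sup>+t\<in>{r/2<..<r}. E t \<partial>lborel) \<le> ennreal (r / 2) * W"
    by (rule ennreal_le_epsilon)
  then show ?thesis unfolding E_def W_def Q_def .
qed

text \<open>
  Average \<open>\<bar>\<Phi> x - k\<bar> \<le> \<bar>\<Phi> x - F (x, t)\<bar> + \<bar>F (x, t) - k\<bar>\<close> over the heights between \<open>r/2\<close> and \<open>r\<close>.
\<close>

lemma layer_comparison:
  fixes F :: "'a::euclidean_space \<times> real \<Rightarrow> real" and \<Phi> :: "'a \<Rightarrow> real"
  assumes wg: "weak_grad (UNIV \<times> {0<..}) F G" and \<Phi>[measurable]: "\<Phi> \<in> borel_measurable borel"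
    and r: "0 < r"
    and trace: "\<And>\<epsilon>. 0 < \<epsilon> \<Longrightarrow> \<exists>\<delta>>0. AE t in lborel. t \<in> {0<..<\<delta>} \<longrightarrow>
      (\<integral>\<^sup>+x\<in>box a b. ennreal \<bar>\<Phi> x - F (x, t)\<bar> \<partial>lborel) \<le> ennreal \<epsilon>"
  shows "ennreal (r / 2) * (\<integral>\<^sup>+x\<in>box a b. ennreal \<bar>\<Phi> x - k\<bar> \<partial>lborel) \<le>
    ennreal (r / 2) * (\<integral>\<^sup>+z\<in>box a b \<times> {0<..<r}. ennreal \<bar>G (0, 1) z\<bar> \<partial>lborel) +
    (\<integral>\<^sup>+z\<in>box a b \<times> {r/2<..<r}. ennreal \<bar>k - F z\<bar> \<partial>lborel)"
proof -
  define Q where "Q = box a b"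
  define B where "B = Q \<times> {r/2<..<r}"
  define W where "W = (\<integral>\<^sup>+z\<in>Q \<times> {0<..<r}. ennreal \<bar>G (0, 1) z\<bar> \<partial>lborel)"
  define E where "E t = (\<integral>\<^sup>+x\<in>Q. ennreal \<bar>\<Phi> x - F (x, t)\<bar> \<partial>lborel)" for t
  have [measurable]: "F \<in> borel_measurable borel" "F \<in> borel_measurable (borel \<Otimes>\<^sub>M borel)" "Q \<in> sets borel"
    using weak_grad_measurable[OF wg] by (simp_all add: borel_prod Q_def)
  have [measurable]: "B \<in> sets borel"
    unfolding B_def Q_def by (intro borel_open open_Times open_box open_greaterThanLessThan)
  have layer: "(\<integral>\<^sup>+t\<in>{r/2<..<r}. E t \<partial>lborel) \<le> ennreal (r / 2) * W"
    using boundary_layer[OF wg \<Phi> r trace] unfolding E_def W_def Q_def by blast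
  have "ennreal (r / 2) * (\<integral>\<^sup>+x\<in>Q. ennreal \<bar>\<Phi> x - k\<bar> \<partial>lborel)
      = (\<integral>\<^sup>+t\<in>{r/2<..<r}. (\<integral>\<^sup>+x\<in>Q. ennreal \<bar>\<Phi> x - k\<bar> \<partial>lborel) \<partial>lborel)"
    using r by (subst nn_integral_cmult_indicator) (auto simp: mult.commute)
  also have "\<dots> \<le> (\<integral>\<^sup>+t. E t * indicator {r/2<..<r} t +
      (\<integral>\<^sup>+x\<in>Q. ennreal \<bar>k - F (x, t)\<bar> \<partial>lborel) * indicator {r/2<..<r} t \<partial>lborel)"
  proof (rule nn_integral_mono)
    fix t
    have "(\<integral>\<^sup>+x\<in>Q. ennreal \<bar>\<Phi> x - k\<bar> \<partial>lborel) \<le>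
      (\<integral>\<^sup>+x. ennreal \<bar>\<Phi> x - F (x, t)\<bar> * indicator Q x + ennreal \<bar>k - F (x, t)\<bar> * indicator Q x \<partial>lborel)"
      by (intro nn_integral_mono) (auto simp: indicator_def ennreal_plus[symmetric] simp del: ennreal_plus intro!: ennreal_leI)
    also have "\<dots> = E t + (\<integral>\<^sup>+x\<in>Q. ennreal \<bar>k - F (x, t)\<bar> \<partial>lborel)"
      unfolding E_def by (rule nn_integral_add) measurable
    finally show "(\<integral>\<^sup>+x\<in>Q. ennreal \<bar>\<Phi> x - k\<bar> \<partial>lborel) * indicator {r/2<..<r} t \<le> E t * indicator {r/2<..<r} t +
      (\<integral>\<^sup>+x\<in>Q. ennreal \<bar>k - F (x, t)\<bar> \<partial>lborel) * indicator {r/2<..<r} t"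
      by (simp add: indicator_def)
  qed
  also have "\<dots> = (\<integral>\<^sup>+t\<in>{r/2<..<r}. E t \<partial>lborel) +
      (\<integral>\<^sup>+t\<in>{r/2<..<r}. (\<integral>\<^sup>+x\<in>Q. ennreal \<bar>k - F (x, t)\<bar> \<partial>lborel) \<partial>lborel)"
    unfolding E_def by (rule nn_integral_add) measurable
  also have "(\<integral>\<^sup>+t\<in>{r/2<..<r}. (\<integral>\<^sup>+x\<in>Q. ennreal \<bar>k - F (x, t)\<bar> \<partial>lborel) \<partial>lborel)
      = (\<integral>\<^sup>+t. (\<integral>\<^sup>+x. ennreal \<bar>k - F (x, t)\<bar> * indicator Q x * indicator {r/2<..<r} t \<partial>lborel) \<partial>lborel)"
    by (intro nn_integral_cong nn_integral_multc[symmetric]) measurable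
  also have "\<dots> = (\<integral>\<^sup>+x. (\<integral>\<^sup>+t. ennreal \<bar>k - F (x, t)\<bar> * indicator Q x * indicator {r/2<..<r} t \<partial>lborel) \<partial>lborel)"
    by (rule lborel_pair.Fubini'[symmetric]) measurable
  also have "\<dots> = (\<integral>\<^sup>+z\<in>B. ennreal \<bar>k - F z\<bar> \<partial>lborel)"
    by (subst nn_integral_lborel_prod, measurable) (auto intro!: nn_integral_cong simp: indicator_def B_def)
  finally have "ennreal (r / 2) * (\<integral>\<^sup>+x\<in>Q. ennreal \<bar>\<Phi> x - k\<bar> \<partial>lborel)
      \<le> ennreal (r / 2) * W + (\<integral>\<^sup>+z\<in>B. ennreal \<bar>k - F z\<bar> \<partial>lborel)"
    using add_right_mono[OF layer] order_trans by blast
  then show ?thesis unfolding W_def B_def Q_def .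
qed

text \<open>
  The mean is within the average of \<open>\<bar>\<Phi> - c\<bar>\<close> of every constant \<open>c\<close>.
\<close>

lemma mean_oscillation_le:
  fixes \<Phi> :: "'a::euclidean_space \<Rightarrow> real"
  assumes int: "integrable lborel (\<lambda>x. indicator Q x * \<Phi> x)" and Q[measurable]: "Q \<in> sets borel"
    and fin: "emeasure lborel Q < \<infinity>" "0 < measure lborel Q"
    and m: "m * measure lborel Q = (\<integral>x. indicator Q x * \<Phi> x \<partial>lborel)"
  shows "(\<integral>\<^sup>+x\<in>Q. ennreal \<bar>m - \<Phi> x\<bar> \<partial>lborel) \<le> 2 * (\<integral>\<^sup>+x\<in>Q. ennreal \<bar>\<Phi> x - c\<bar> \<partial>lborel)"
proof -
  have "(\<lambda>x. indicator Q x * \<Phi> x) \<in> borel_measurable lborel" using int by (rule borel_measurable_integrable)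
  then have [measurable]: "(\<lambda>x. indicator Q x * \<Phi> x) \<in> borel_measurable borel" by simp
  have intc: "integrable lborel (\<lambda>x. indicator Q x * c)" for c :: real
    using fin by (intro integrable_mult_left) auto
  have "(m - c) * measure lborel Q = (\<integral>x. indicator Q x * \<Phi> x - indicator Q x * c \<partial>lborel)"
    using int intc[of c] m by (simp add: left_diff_distrib mult.commute)
  then have "ennreal (\<bar>m - c\<bar> * measure lborel Q) = ennreal \<bar>\<integral>x. indicator Q x * \<Phi> x - indicator Q x * c \<partial>lborel\<bar>"
    using fin(2) by (metis abs_mult abs_of_pos)
  also have "\<dots> \<le> (\<integral>\<^sup>+x. ennreal \<bar>indicator Q x * \<Phi> x - indicator Q x * c\<bar> \<partial>lborel)"
    by (rule ennreal_abs_integral_le)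
  also have "\<dots> = (\<integral>\<^sup>+x\<in>Q. ennreal \<bar>\<Phi> x - c\<bar> \<partial>lborel)"
    by (intro nn_integral_cong) (auto simp: indicator_def)
  finally have 1: "ennreal \<bar>m - c\<bar> * emeasure lborel Q \<le> (\<integral>\<^sup>+x\<in>Q. ennreal \<bar>\<Phi> x - c\<bar> \<partial>lborel)"
    using fin by (simp add: ennreal_mult emeasure_eq_ennreal_measure)
  have "(\<integral>\<^sup>+x\<in>Q. ennreal \<bar>m - \<Phi> x\<bar> \<partial>lborel)
      \<le> (\<integral>\<^sup>+x. ennreal \<bar>m - c\<bar> * indicator Q x + ennreal \<bar>indicator Q x * \<Phi> x - indicator Q x * c\<bar> \<partial>lborel)"
    by (intro nn_integral_mono) (auto simp: indicator_def ennreal_plus[symmetric] simp del: ennreal_plus intro!: ennreal_leI)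
  also have "\<dots> = ennreal \<bar>m - c\<bar> * emeasure lborel Q + (\<integral>\<^sup>+x. ennreal \<bar>indicator Q x * \<Phi> x - indicator Q x * c\<bar> \<partial>lborel)"
    by (subst nn_integral_add) (auto simp: nn_integral_cmult_indicator)
  also have "(\<integral>\<^sup>+x. ennreal \<bar>indicator Q x * \<Phi> x - indicator Q x * c\<bar> \<partial>lborel) = (\<integral>\<^sup>+x\<in>Q. ennreal \<bar>\<Phi> x - c\<bar> \<partial>lborel)"
    by (intro nn_integral_cong) (auto simp: indicator_def)
  also have "ennreal \<bar>m - c\<bar> * emeasure lborel Q + \<dots> \<le> \<dots> + \<dots>" using 1 by (rule add_right_mono)
  finally show ?thesis by (simp add: mult_2)
qed

text \<open>
  The mean is compared with the constants \<open>F w\<close>, for \<open>w\<close> in the layer \<open>B\<close>, and the resulting inequality is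
  averaged over \<open>w\<close>; the Poincare inequality on \<open>B\<close> bounds the average of \<open>\<bar>F w - F z\<bar>\<close>.
\<close>

lemma trace_oscillation:
  fixes F :: "'a::euclidean_space \<times> real \<Rightarrow> real" and \<Phi> :: "'a \<Rightarrow> real"
  assumes wg: "weak_grad (UNIV \<times> {0<..}) F G" and \<Phi>[measurable]: "\<Phi> \<in> borel_measurable borel"
    and r: "0 < r"
    and trace: "\<And>\<epsilon>. 0 < \<epsilon> \<Longrightarrow> \<exists>\<delta>>0. AE t in lborel. t \<in> {0<..<\<delta>} \<longrightarrow>
      (\<integral>\<^sup>+x\<in>box a b. ennreal \<bar>\<Phi> x - F (x, t)\<bar> \<partial>lborel) \<le> ennreal \<epsilon>"
    and ab: "\<And>i. i \<in> Basis \<Longrightarrow> a \<bullet> i < b \<bullet> i \<and> (b - a) \<bullet> i \<le> 2 * r"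
    and int: "integrable lborel (\<lambda>x. indicator (box a b) x * \<Phi> x)"
    and m: "m * measure lborel (box a b) = (\<integral>x. indicator (box a b) x * \<Phi> x \<partial>lborel)"
  shows "(\<integral>\<^sup>+x\<in>box a b. ennreal \<bar>m - \<Phi> x\<bar> \<partial>lborel) \<le>
    2 * (\<integral>\<^sup>+z\<in>box a b \<times> {0<..<r}. ennreal \<bar>G (0, 1) z\<bar> \<partial>lborel) +
    ennreal (16 * 2 ^ DIM('a)) * (\<Sum>e\<in>Basis. (\<integral>\<^sup>+z\<in>box a b \<times> {r/2<..<r}. ennreal \<bar>G e z\<bar> \<partial>lborel))"
proof -
  define Q where "Q = box a b"
  define B where "B = Q \<times> {r/2<..<r}"
  define W where "W = (\<integral>\<^sup>+z\<in>Q \<times> {0<..<r}. ennreal \<bar>G (0, 1) z\<bar> \<partial>lborel)"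
  define X where "X = (\<integral>\<^sup>+x\<in>Q. ennreal \<bar>m - \<Phi> x\<bar> \<partial>lborel)"
  define S where "S = (\<Sum>e\<in>Basis. (\<integral>\<^sup>+z\<in>B. ennreal \<bar>G e z\<bar> \<partial>lborel))"
  define l where "l = (a, r / 2)"
  define u where "u = (b, r)"
  define V where "V = (\<Prod>i\<in>Basis. (b - a) \<bullet> i)"
  have B: "B = box l u" by (auto simp: B_def Q_def l_def u_def mem_box Basis_prod_def)
  have [measurable]: "F \<in> borel_measurable borel" "F \<in> borel_measurable (borel \<Otimes>\<^sub>M borel)" "Q \<in> sets borel" "B \<in> sets borel"
    using weak_grad_measurable[OF wg] by (simp_all add: borel_prod Q_def B)
  have V: "0 < V" using ab unfolding V_def by (intro prod_pos) (auto simp: inner_diff_left)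
  have eQ: "emeasure lborel Q = ennreal V"
    unfolding Q_def V_def by (rule emeasure_lborel_box) (use ab in \<open>auto simp: less_imp_le\<close>)
  have lu: "l \<bullet> i < u \<bullet> i \<and> (u - l) \<bullet> i \<le> 2 * r" if "i \<in> Basis" for i
    using that ab r by (auto simp: l_def u_def Basis_prod_def)
  have prod_lu: "(\<Prod>i\<in>Basis. (u - l) \<bullet> i) = V * (r / 2)"
  proof -
    have "(\<Prod>i\<in>(Basis :: ('a \<times> real) set). (u - l) \<bullet> i) =
        (\<Prod>i\<in>(\<lambda>u. (u, 0)) ` Basis. (u - l) \<bullet> i) * (\<Prod>i\<in>{(0, 1)}. (u - l) \<bullet> i)"
      unfolding Basis_prod_def by (subst prod.union_disjoint) auto
    also have "(\<Prod>i\<in>(\<lambda>u. (u, 0)) ` Basis. (u - l) \<bullet> i) = V"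
      by (subst prod.reindex) (auto simp: inj_on_def V_def l_def u_def)
    finally show ?thesis by (simp add: l_def u_def)
  qed
  have eB: "emeasure lborel B = ennreal (V * (r / 2))"
    unfolding B prod_lu[symmetric] by (rule emeasure_lborel_box) (use lu in \<open>auto simp: less_imp_le\<close>)
  have eD: "emeasure lborel (box (l - u) (u - l)) = ennreal (2 ^ DIM('a) * V * r)"
  proof -
    have "emeasure lborel (box (l - u) (u - l)) = ennreal (\<Prod>i\<in>Basis. ((u - l) - (l - u)) \<bullet> i)"
      by (rule emeasure_lborel_box) (use lu in \<open>force simp: inner_diff_left\<close>)
    also have "(\<Prod>i\<in>Basis. ((u - l) - (l - u)) \<bullet> i) = (\<Prod>i\<in>Basis. 2 * ((u - l) \<bullet> i))"
      by (intro prod.cong) (auto simp: inner_diff_left)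
    also have "\<dots> = 2 ^ DIM('a \<times> real) * (V * (r / 2))"
      by (simp add: prod.distrib prod_lu)
    finally show ?thesis by (simp add: mult.assoc)
  qed
  have C: "ennreal (r / 2) * (\<integral>\<^sup>+x\<in>Q. ennreal \<bar>\<Phi> x - F w\<bar> \<partial>lborel)
      \<le> ennreal (r / 2) * W + (\<integral>\<^sup>+z\<in>B. ennreal \<bar>F w - F z\<bar> \<partial>lborel)" for w
    unfolding W_def B_def Q_def by (rule layer_comparison[OF wg \<Phi> r trace])
  have A: "X \<le> 2 * (\<integral>\<^sup>+x\<in>Q. ennreal \<bar>\<Phi> x - F w\<bar> \<partial>lborel)" for w
    unfolding X_def using int m V eQ unfolding Q_def
    by (intro mean_oscillation_le) (auto simp: measure_def)
  have D: "ennreal (r / 2) * X \<le> 2 * (ennreal (r / 2) * W + (\<integral>\<^sup>+z\<in>B. ennreal \<bar>F w - F z\<bar> \<partial>lborel))" for w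
  proof -
    have "ennreal (r / 2) * X \<le> ennreal (r / 2) * (2 * (\<integral>\<^sup>+x\<in>Q. ennreal \<bar>\<Phi> x - F w\<bar> \<partial>lborel))"
      by (rule mult_left_mono[OF A]) simp
    also have "\<dots> = 2 * (ennreal (r / 2) * (\<integral>\<^sup>+x\<in>Q. ennreal \<bar>\<Phi> x - F w\<bar> \<partial>lborel))"
      by (simp add: mult_ac)
    also have "\<dots> \<le> 2 * (ennreal (r / 2) * W + (\<integral>\<^sup>+z\<in>B. ennreal \<bar>F w - F z\<bar> \<partial>lborel))"
      by (rule mult_left_mono[OF C]) simp
    finally show ?thesis .
  qed
  define I where "I = (\<integral>\<^sup>+w\<in>B. (\<integral>\<^sup>+z\<in>B. ennreal \<bar>F w - F z\<bar> \<partial>lborel) \<partial>lborel)"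
  have I: "I \<le> ennreal (2 ^ DIM('a) * V * r) * (ennreal (2 * r) * S)"
  proof -
    have "cbox l u \<subseteq> UNIV \<times> {0<..}" using r by (auto simp: l_def u_def cbox_Pair_eq)
    from weak_poincare[OF wg this]
    have "I \<le> ennreal (2 ^ DIM('a) * V * r) * (\<Sum>e\<in>Basis. ennreal ((u - l) \<bullet> e) * (\<integral>\<^sup>+z\<in>B. ennreal \<bar>G e z\<bar> \<partial>lborel))"
      unfolding I_def B eD .
    also have "(\<Sum>e\<in>Basis. ennreal ((u - l) \<bullet> e) * (\<integral>\<^sup>+z\<in>B. ennreal \<bar>G e z\<bar> \<partial>lborel)) \<le> ennreal (2 * r) * S"
      unfolding S_def sum_distrib_left using lu by (intro sum_mono mult_right_mono ennreal_leI) auto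
    finally show ?thesis by (simp add: mult_left_mono)
  qed
  have "ennreal (V * (r / 2)) * (ennreal (r / 2) * X) = (\<integral>\<^sup>+w\<in>B. ennreal (r / 2) * X \<partial>lborel)"
    by (subst nn_integral_cmult_indicator) (auto simp: eB mult.commute)
  also have "\<dots> \<le> (\<integral>\<^sup>+w. 2 * (ennreal (r / 2) * W * indicator B w + (\<integral>\<^sup>+z\<in>B. ennreal \<bar>F w - F z\<bar> \<partial>lborel) * indicator B w) \<partial>lborel)"
    using D by (intro nn_integral_mono) (auto simp: indicator_def)
  also have "\<dots> = 2 * (ennreal (r / 2) * W * ennreal (V * (r / 2)) + I)"
    unfolding I_def by (simp add: nn_integral_cmult nn_integral_add nn_integral_cmult_indicator eB)
  also have "\<dots> \<le> 2 * (ennreal (r / 2) * W * ennreal (V * (r / 2)) + ennreal (2 ^ DIM('a) * V * r) * (ennreal (2 * r) * S))"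
    using I by (intro mult_left_mono add_left_mono) auto
  also have "\<dots> = ennreal (V * (r / 2)) * (ennreal (r / 2) * (2 * W + ennreal (16 * 2 ^ DIM('a)) * S))"
  proof -
    have *: "ennreal (2 ^ DIM('a) * V * r) * (ennreal (2 * r) * S) =
        ennreal (V * (r / 2)) * (ennreal (r / 2) * (ennreal (8 * 2 ^ DIM('a)) * S))"
    proof -
      have "ennreal (2 ^ DIM('a) * V * r) * ennreal (2 * r) = ennreal ((2 ^ DIM('a) * V * r) * (2 * r))"
        by (rule ennreal_mult[symmetric]) (use V r in simp_all)
      also have "(2 ^ DIM('a) * V * r) * (2 * r) = (V * (r / 2)) * ((r / 2) * (8 * 2 ^ DIM('a)))"
        by simp
      also have "ennreal \<dots> = ennreal (V * (r / 2)) * ennreal ((r / 2) * (8 * 2 ^ DIM('a)))"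
        by (rule ennreal_mult) (use V r in simp_all)
      also have "ennreal ((r / 2) * (8 * 2 ^ DIM('a))) = ennreal (r / 2) * ennreal (8 * 2 ^ DIM('a))"
        by (rule ennreal_mult) (use V r in simp_all)
      finally show ?thesis by (simp only: mult.assoc[symmetric])
    qed
    have "(2::ennreal) * ennreal (8 * 2 ^ DIM('a)) = ennreal (16 * 2 ^ DIM('a))"
      by (subst ennreal_numeral[symmetric], subst ennreal_mult[symmetric]) auto
    note e = this[symmetric]
    show ?thesis unfolding * e
      by (simp only: distrib_left mult_ac)
  qed
  finally have "ennreal (V * (r / 2)) * (ennreal (r / 2) * X)
      \<le> ennreal (V * (r / 2)) * (ennreal (r / 2) * (2 * W + ennreal (16 * 2 ^ DIM('a)) * S))" .
  then have "X \<le> 2 * W + ennreal (16 * 2 ^ DIM('a)) * S"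
    using V r by (simp add: ennreal_mult_le_mult_iff)
  then show ?thesis unfolding X_def W_def S_def B_def Q_def .
qed

lemma trace_size:
  fixes F :: "'a::euclidean_space \<times> real \<Rightarrow> real" and \<Phi> :: "'a \<Rightarrow> real"
  assumes wg: "weak_grad (UNIV \<times> {0<..}) F G" and \<Phi>[measurable]: "\<Phi> \<in> borel_measurable borel"
    and r: "0 < r"
    and trace: "\<And>\<epsilon>. 0 < \<epsilon> \<Longrightarrow> \<exists>\<delta>>0. AE t in lborel. t \<in> {0<..<\<delta>} \<longrightarrow>
      (\<integral>\<^sup>+x\<in>box a b. ennreal \<bar>\<Phi> x - F (x, t)\<bar> \<partial>lborel) \<le> ennreal \<epsilon>"
  shows "ennreal (r / 2) * (\<integral>\<^sup>+x\<in>box a b. ennreal \<bar>\<Phi> x\<bar> \<partial>lborel) \<le>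
    ennreal (r / 2) * (\<integral>\<^sup>+z\<in>box a b \<times> {0<..<r}. ennreal \<bar>G (0, 1) z\<bar> \<partial>lborel) +
    (\<integral>\<^sup>+z\<in>box a b \<times> {0<..<r}. ennreal \<bar>F z\<bar> \<partial>lborel)"
proof -
  have "(\<integral>\<^sup>+z\<in>box a b \<times> {r/2<..<r}. ennreal \<bar>0 - F z\<bar> \<partial>lborel) \<le>
      (\<integral>\<^sup>+z\<in>box a b \<times> {0<..<r}. ennreal \<bar>F z\<bar> \<partial>lborel)"
    using r by (intro nn_integral_mono) (auto simp: indicator_def)
  then show ?thesis
    using order_trans[OF layer_comparison[OF wg \<Phi> r trace, where k = 0] add_left_mono] by simp
qed

lemma upper_half_open: "open upper_half"
  unfolding upper_half_def by (intro open_Times) auto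

lemma L1_norm_lborel: "L1_norm S f = (\<integral>\<^sup>+z\<in>S. ennreal \<bar>f z\<bar> \<partial>lborel)"
  by (simp add: L1_norm_def nn_integral_completion)

lemma L1_norm_cong:
  assumes "AE z in lborel. z \<in> U \<longrightarrow> f z = F z" "S \<subseteq> U"
  shows "L1_norm S f = (\<integral>\<^sup>+z\<in>S. ennreal \<bar>F z\<bar> \<partial>lborel)"
  unfolding L1_norm_lborel
  by (rule nn_integral_cong_AE, use assms(1) in eventually_elim) (use assms(2) in \<open>auto simp: indicator_def\<close>)

text \<open>
  The trace is defined through slices of some representative of \<open>f\<close>. By Fubini almost all of its slices agree
  almost everywhere with those of \<open>F\<close>.
\<close>

lemma trace_representative:
  fixes f F :: "(real^'n) \<times> real \<Rightarrow> real"
  assumes tr: "is_trace f \<phi>" and F: "F \<in> borel_measurable borel" "AE z in lborel. z \<in> upper_half \<longrightarrow> f z = F z"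
    and \<Phi>: "\<Phi> \<in> borel_measurable borel" "AE x in lborel. \<phi> x = \<Phi> x"
    and \<rho>: "0 < \<rho>" and \<epsilon>: "0 < \<epsilon>"
  shows "\<exists>\<delta>>0. AE t in lborel. t \<in> {0<..<\<delta>} \<longrightarrow>
      (\<integral>\<^sup>+x\<in>open_cube c \<rho>. ennreal \<bar>\<Phi> x - F (x, t)\<bar> \<partial>lborel) \<le> ennreal \<epsilon>"
proof -
  obtain g where g: "AE z in lebesgue. z \<in> upper_half \<longrightarrow> g z = f z"
    and int: "\<forall>\<^sub>F t in at_right 0. set_integrable lebesgue (open_cube c \<rho>) (\<lambda>x. \<phi> x - g (x, t))"
    and lim: "((\<lambda>t. LINT x:open_cube c \<rho>|lebesgue. \<bar>\<phi> x - g (x, t)\<bar>) \<longlongrightarrow> 0) (at_right 0)"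
    using tr \<rho> unfolding is_trace_def by blast
  have "\<forall>\<^sub>F t in at_right 0. (LINT x:open_cube c \<rho>|lebesgue. \<bar>\<phi> x - g (x, t)\<bar>) < \<epsilon>"
    using order_tendstoD(2)[OF lim \<epsilon>] .
  with int have "\<forall>\<^sub>F t in at_right 0. set_integrable lebesgue (open_cube c \<rho>) (\<lambda>x. \<phi> x - g (x, t)) \<and>
      (LINT x:open_cube c \<rho>|lebesgue. \<bar>\<phi> x - g (x, t)\<bar>) < \<epsilon>"
    by eventually_elim simp
  then obtain \<delta> where \<delta>: "\<delta> > 0" "\<And>t. 0 < t \<Longrightarrow> t < \<delta> \<Longrightarrow> set_integrable lebesgue (open_cube c \<rho>) (\<lambda>x. \<phi> x - g (x, t)) \<and>
      (LINT x:open_cube c \<rho>|lebesgue. \<bar>\<phi> x - g (x, t)\<bar>) < \<epsilon>"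
    unfolding eventually_at_right_field by auto
  have "AE z in lborel. z \<in> upper_half \<longrightarrow> g z = F z"
    using g[unfolded AE_completion_iff] F(2) by eventually_elim auto
  then have "AE z in lborel \<Otimes>\<^sub>M lborel. z \<in> upper_half \<longrightarrow> g z = F z"
    by (simp only: lborel_prod)
  then have "AE z in distr (lborel \<Otimes>\<^sub>M lborel) (lborel \<Otimes>\<^sub>M lborel) (\<lambda>(t, x). (x, t)). z \<in> upper_half \<longrightarrow> g z = F z"
    by (subst (asm) lborel_pair.distr_pair_swap)
  then have "AE z in lborel \<Otimes>\<^sub>M lborel. (case z of (t, x) \<Rightarrow> (x, t)) \<in> upper_half \<longrightarrow>
      g (case z of (t, x) \<Rightarrow> (x, t)) = F (case z of (t, x) \<Rightarrow> (x, t))"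
    by (rule AE_distrD[rotated]) simp
  from lborel_pair.AE_pair[OF this]
  have "AE t in lborel. AE x in lborel. 0 < t \<longrightarrow> g (x, t) = F (x, t)"
    by (simp add: upper_half_def)
  then have "AE t in lborel. t \<in> {0<..<\<delta>} \<longrightarrow>
      (\<integral>\<^sup>+x\<in>open_cube c \<rho>. ennreal \<bar>\<Phi> x - F (x, t)\<bar> \<partial>lborel) \<le> ennreal \<epsilon>"
  proof eventually_elim
    case (elim t)
    show ?case
    proof
      assume t: "t \<in> {0<..<\<delta>}"
      then have tr: "integrable lebesgue (\<lambda>x. indicator (open_cube c \<rho>) x * (\<phi> x - g (x, t)))"
        "(\<integral>x. indicator (open_cube c \<rho>) x * \<bar>\<phi> x - g (x, t)\<bar> \<partial>lebesgue) < \<epsilon>"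
        using \<delta>(2)[of t] by (auto simp: set_integrable_def set_lebesgue_integral_def)
      have "AE x in lborel. 0 < t \<longrightarrow> g (x, t) = F (x, t)" using elim .
      with \<Phi>(2) have "AE x in lborel. ennreal \<bar>\<Phi> x - F (x, t)\<bar> * indicator (open_cube c \<rho>) x =
          ennreal \<bar>indicator (open_cube c \<rho>) x * (\<phi> x - g (x, t))\<bar>"
        by eventually_elim (use t in \<open>auto simp: indicator_def\<close>)
      then have "(\<integral>\<^sup>+x\<in>open_cube c \<rho>. ennreal \<bar>\<Phi> x - F (x, t)\<bar> \<partial>lborel)
          = (\<integral>\<^sup>+x. ennreal \<bar>indicator (open_cube c \<rho>) x * (\<phi> x - g (x, t))\<bar> \<partial>lebesgue)"
        unfolding nn_integral_completion by (rule nn_integral_cong_AE)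
      also have "\<dots> = ennreal (\<integral>x. \<bar>indicator (open_cube c \<rho>) x * (\<phi> x - g (x, t))\<bar> \<partial>lebesgue)"
        by (rule nn_integral_eq_integral) (use tr(1) in auto)
      also have "\<dots> \<le> ennreal \<epsilon>"
        using tr(2) by (intro ennreal_leI) (simp add: abs_mult)
      finally show "(\<integral>\<^sup>+x\<in>open_cube c \<rho>. ennreal \<bar>\<Phi> x - F (x, t)\<bar> \<partial>lborel) \<le> ennreal \<epsilon>" .
    qed
  qed
  then show ?thesis using \<delta>(1) by blast
qed

text \<open>
  \<open>trace_oscillation\<close> and \<open>trace_size\<close>, carried over from Borel representatives to \<open>f\<close>, its weak derivatives and its
  trace.
\<close>

lemma half_space_estimates:
  fixes f :: "(real^'n) \<times> real \<Rightarrow> real" and c :: "real^'n"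
  assumes f: "locally_L1 upper_half f" and g: "\<And>b. b \<in> Basis \<Longrightarrow> is_weak_deriv upper_half b f (g b)"
    and tr: "is_trace f \<phi>" and r: "0 < r" and \<rho>: "0 < \<rho>" "\<rho> \<le> 2 * r"
  defines "Q \<equiv> open_cube c \<rho>"
  shows "L1_norm Q (\<lambda>x. mean Q \<phi> - \<phi> x) \<le> 2 * L1_norm (Q \<times> {0<..<r}) (g (0, 1)) +
      ennreal (16 * 2 ^ CARD('n)) * (\<Sum>b\<in>Basis. L1_norm (Q \<times> {r/2<..<r}) (g b))" (is ?osc)
    and "ennreal (r / 2) * L1_norm Q \<phi> \<le> ennreal (r / 2) * L1_norm (Q \<times> {0<..<r}) (g (0, 1)) +
      L1_norm (Q \<times> {0<..<r}) f" (is ?size)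
proof -
  obtain F G where wg: "weak_grad upper_half F G" and F: "AE z in lborel. z \<in> upper_half \<longrightarrow> f z = F z"
    and G: "\<And>b. b \<in> Basis \<Longrightarrow> AE z in lborel. z \<in> upper_half \<longrightarrow> g b z = G b z"
    using weak_grad_of_weak_deriv[OF upper_half_open f g] by blast
  have \<phi>: "locally_L1 UNIV \<phi>" using tr by (simp add: is_trace_def)
  obtain \<Phi> where \<Phi>[measurable]: "\<Phi> \<in> borel_measurable borel" and AE\<Phi>: "AE x in lborel. \<phi> x = \<Phi> x"
    using borel_representative[OF open_UNIV \<phi>] by auto
  define a b where "a = c - (\<rho> / 2) *\<^sub>R One" and "b = c + (\<rho> / 2) *\<^sub>R One"
  have Q: "Q = box a b" by (simp add: Q_def open_cube_def a_def b_def)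
  have ab: "a \<bullet> i < b \<bullet> i \<and> (b - a) \<bullet> i \<le> 2 * r" if "i \<in> Basis" for i
    unfolding a_def b_def inner_diff_left inner_add_left inner_scaleR_left using that \<rho> by simp
  have trace: "\<exists>\<delta>>0. AE t in lborel. t \<in> {0<..<\<delta>} \<longrightarrow>
      (\<integral>\<^sup>+x\<in>box a b. ennreal \<bar>\<Phi> x - F (x, t)\<bar> \<partial>lborel) \<le> ennreal \<epsilon>" if "0 < \<epsilon>" for \<epsilon>
    using trace_representative[OF tr weak_grad_measurable(1)[OF wg] F \<Phi> AE\<Phi> \<rho>(1) that, of c]
    unfolding Q[symmetric] Q_def .
  have sub: "Q \<times> {0<..<r} \<subseteq> upper_half" "Q \<times> {r/2<..<r} \<subseteq> upper_half"
    using r by (auto simp: upper_half_def)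
  have e1: "(0, 1) \<in> (Basis :: ((real^'n) \<times> real) set)" by (simp add: Basis_prod_def)
  have wg': "weak_grad (UNIV \<times> {0<..}) F G" using wg by (simp add: upper_half_def)
  have \<phi>\<Phi>: "AE x in lborel. x \<in> UNIV \<longrightarrow> \<phi> x = \<Phi> x" using AE\<Phi> by simp
  have cb: "integrable lborel (\<lambda>x. indicator (cbox a b) x * \<Phi> x)"
    by (rule integrable_representative[OF \<phi> compact_cbox _ \<Phi> \<phi>\<Phi>]) simp
  have int: "integrable lborel (\<lambda>x. indicator (box a b) x * \<Phi> x)"
  proof -
    have "set_integrable lborel (cbox a b) \<Phi>" using cb by (simp add: set_integrable_def)
    then have "set_integrable lborel (box a b) \<Phi>"
      by (rule set_integrable_subset) (auto simp: box_subset_cbox[THEN subsetD])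
    then show ?thesis by (simp add: set_integrable_def)
  qed
  have mean: "mean Q \<phi> * measure lborel (box a b) = (\<integral>x. indicator (box a b) x * \<Phi> x \<partial>lborel)"
  proof -
    have "(LINT x:Q|lebesgue. \<phi> x) = (\<integral>x. indicator (box a b) x * \<Phi> x \<partial>lebesgue)"
      unfolding set_lebesgue_integral_def Q
    proof (rule integral_cong_AE)
      show "(\<lambda>x. indicator (box a b) x * \<Phi> x) \<in> borel_measurable lebesgue"
        by (intro measurable_completion) simp
      have "(\<lambda>x. indicator (box a b) x * (indicator UNIV x * \<phi> x)) \<in> borel_measurable lebesgue"
        by (intro borel_measurable_times locally_L1_measurable[OF open_UNIV \<phi>] measurable_completion) simp
      then show "(\<lambda>x. indicator (box a b) x *\<^sub>R \<phi> x) \<in> borel_measurable lebesgue" by simp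
      show "AE x in lebesgue. indicator (box a b) x *\<^sub>R \<phi> x = indicator (box a b) x * \<Phi> x"
        using AE_completion[OF AE\<Phi>] by eventually_elim simp
    qed
    also have "\<dots> = (\<integral>x. indicator (box a b) x * \<Phi> x \<partial>lborel)"
      by (rule integral_completion) simp
    finally have "(LINT x:Q|lebesgue. \<phi> x) = (\<integral>x. indicator (box a b) x * \<Phi> x \<partial>lborel)" .
    moreover have "measure lebesgue Q = measure lborel (box a b)"
      unfolding Q by (rule measure_completion) simp
    moreover have "measure lebesgue Q \<noteq> 0"
      using \<rho> unfolding Q_def by (simp add: measure_open_cube)
    ultimately show ?thesis by (simp add: mean_def)
  qed
  have "AE x in lborel. x \<in> UNIV \<longrightarrow> mean Q \<phi> - \<phi> x = mean Q \<phi> - \<Phi> x"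
    using AE\<Phi> by eventually_elim simp
  from L1_norm_cong[OF this, of Q]
  have "L1_norm Q (\<lambda>x. mean Q \<phi> - \<phi> x) = (\<integral>\<^sup>+x\<in>box a b. ennreal \<bar>mean Q \<phi> - \<Phi> x\<bar> \<partial>lborel)"
    by (simp add: Q)
  also have "\<dots> \<le> 2 * (\<integral>\<^sup>+z\<in>box a b \<times> {0<..<r}. ennreal \<bar>G (0, 1) z\<bar> \<partial>lborel) +
    ennreal (16 * 2 ^ DIM(real^'n)) * (\<Sum>e\<in>Basis. (\<integral>\<^sup>+z\<in>box a b \<times> {r/2<..<r}. ennreal \<bar>G e z\<bar> \<partial>lborel))"
    by (rule trace_oscillation[OF wg' \<Phi> r trace ab int mean])
  also have "(\<integral>\<^sup>+z\<in>box a b \<times> {0<..<r}. ennreal \<bar>G (0, 1) z\<bar> \<partial>lborel) = L1_norm (Q \<times> {0<..<r}) (g (0, 1))"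
    unfolding Q[symmetric] by (rule L1_norm_cong[OF G[OF e1] sub(1), symmetric])
  also have "(\<Sum>e\<in>Basis. (\<integral>\<^sup>+z\<in>box a b \<times> {r/2<..<r}. ennreal \<bar>G e z\<bar> \<partial>lborel)) =
      (\<Sum>b\<in>Basis. L1_norm (Q \<times> {r/2<..<r}) (g b))"
    unfolding Q[symmetric] by (intro sum.cong refl L1_norm_cong[OF G sub(2), symmetric])
  finally show ?osc by simp
  have "ennreal (r / 2) * L1_norm Q \<phi> = ennreal (r / 2) * (\<integral>\<^sup>+x\<in>box a b. ennreal \<bar>\<Phi> x\<bar> \<partial>lborel)"
    using L1_norm_cong[OF \<phi>\<Phi>, of Q] by (simp add: Q)
  also have "\<dots> \<le> ennreal (r / 2) * (\<integral>\<^sup>+z\<in>box a b \<times> {0<..<r}. ennreal \<bar>G (0, 1) z\<bar> \<partial>lborel) +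
    (\<integral>\<^sup>+z\<in>box a b \<times> {0<..<r}. ennreal \<bar>F z\<bar> \<partial>lborel)"
    by (rule trace_size[OF wg' \<Phi> r trace])
  also have "(\<integral>\<^sup>+z\<in>box a b \<times> {0<..<r}. ennreal \<bar>G (0, 1) z\<bar> \<partial>lborel) = L1_norm (Q \<times> {0<..<r}) (g (0, 1))"
    unfolding Q[symmetric] by (rule L1_norm_cong[OF G[OF e1] sub(1), symmetric])
  also have "(\<integral>\<^sup>+z\<in>box a b \<times> {0<..<r}. ennreal \<bar>F z\<bar> \<partial>lborel) = L1_norm (Q \<times> {0<..<r}) f"
    unfolding Q[symmetric] by (rule L1_norm_cong[OF F sub(1), symmetric])
  finally show ?size .
qed

section \<open>Summation over the tilings\<close>

text \<open>
  Exchanging sum and integral reduces a weighted sum of integrals to a pointwise bound for the weights of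
  those sets that contain a given point.
\<close>

lemma weighted_sum_le:
  fixes \<gamma> g :: "'a::euclidean_space \<Rightarrow> real" and D :: "'i \<Rightarrow> 'a set" and h :: "'a \<Rightarrow> ennreal"
  assumes fin: "finite I" and U: "open U" "locally_L1 U g"
    and D: "\<And>i. i \<in> I \<Longrightarrow> D i \<in> sets borel \<and> D i \<subseteq> U"
    and bound: "AE z in lebesgue. z \<in> U \<longrightarrow>
      (\<Sum>i\<in>I. ennreal (w i) * indicator (D i) z) \<le> ennreal (\<gamma> z) * h z"
  shows "(\<Sum>i\<in>I. ennreal (w i) * L1_norm (D i) g) \<le> (\<integral>\<^sup>+z\<in>U. ennreal \<bar>\<gamma> z * g z\<bar> * h z \<partial>lebesgue)"
proof -
  define e where "e z = ennreal \<bar>indicator U z * g z\<bar>" for z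
  have e[measurable]: "e \<in> borel_measurable lebesgue"
    using locally_L1_measurable[OF U] unfolding e_def[abs_def] by measurable
  have Dm: "D i \<in> sets lebesgue" if "i \<in> I" for i using D[OF that] by simp
  have L1: "L1_norm (D i) g = (\<integral>\<^sup>+z. e z * indicator (D i) z \<partial>lebesgue)" if "i \<in> I" for i
    unfolding L1_norm_def e_def using D[OF that] by (intro nn_integral_cong) (auto simp: indicator_def)
  have "(\<Sum>i\<in>I. ennreal (w i) * L1_norm (D i) g) = (\<Sum>i\<in>I. \<integral>\<^sup>+z. ennreal (w i) * (e z * indicator (D i) z) \<partial>lebesgue)"
    using L1 Dm by (intro sum.cong refl) (simp add: nn_integral_cmult)
  also have "\<dots> = (\<integral>\<^sup>+z. (\<Sum>i\<in>I. ennreal (w i) * (e z * indicator (D i) z)) \<partial>lebesgue)"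
    using Dm by (intro nn_integral_sum[symmetric]) auto
  also have "\<dots> = (\<integral>\<^sup>+z. e z * (\<Sum>i\<in>I. ennreal (w i) * indicator (D i) z) \<partial>lebesgue)"
    by (simp add: sum_distrib_left mult_ac)
  also have "\<dots> \<le> (\<integral>\<^sup>+z\<in>U. ennreal \<bar>\<gamma> z * g z\<bar> * h z \<partial>lebesgue)"
  proof (rule nn_integral_mono_AE, use bound in eventually_elim)
    case (elim z)
    show ?case
    proof (cases "z \<in> U")
      case True
      then have "e z * (\<Sum>i\<in>I. ennreal (w i) * indicator (D i) z) \<le> ennreal \<bar>g z\<bar> * (ennreal (\<gamma> z) * h z)"
        using elim by (auto simp: e_def intro!: mult_left_mono)
      also have "\<dots> \<le> ennreal \<bar>g z\<bar> * (ennreal \<bar>\<gamma> z\<bar> * h z)"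
        by (intro mult_left_mono mult_right_mono ennreal_leI) auto
      also have "\<dots> = ennreal \<bar>\<gamma> z * g z\<bar> * h z"
        by (simp add: abs_mult ennreal_mult mult_ac)
      finally show ?thesis using True by simp
    qed (simp add: e_def)
  qed
  finally show ?thesis .
qed

text \<open>
  As the sets are disjoint, bounds for finite partial sums suffice.
\<close>

lemma suminf_infsum_le:
  fixes f :: "'i \<Rightarrow> ennreal"
  assumes disj: "\<And>s s'. s \<noteq> s' \<Longrightarrow> R s \<inter> R s' = {}"
    and bound: "\<And>I. finite I \<Longrightarrow> I \<subseteq> (\<Union>s. R s) \<Longrightarrow> sum f I \<le> B"
  shows "(\<Sum>s. infsum f (R s)) \<le> B"
proof (rule suminf_le_const[OF summableI])
  have sm: "f summable_on S" for S by (rule nonneg_summable_on_complete) simp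
  fix n
  have "(\<Sum>s<n. infsum f (R s)) = infsum f (\<Union>s<n. R s)"
  proof (induction n)
    case (Suc n)
    have "R s \<inter> R n = {}" if "s < n" for s using disj[of s n] that by simp
    then have "(\<Union>s<n. R s) \<inter> R n = {}" by blast
    from infsum_Un_disjoint[OF sm sm this]
    have "infsum f ((\<Union>s<n. R s) \<union> R n) = infsum f (\<Union>s<n. R s) + infsum f (R n)" .
    then show ?case using Suc by (simp add: lessThan_Suc Un_commute)
  qed simp
  also have "\<dots> \<le> B"
  proof (rule infsum_le_finite_sums[OF sm])
    fix I assume "finite I" "I \<subseteq> (\<Union>s<n. R s)"
    then show "sum f I \<le> B" by (intro bound) blast+
  qed
  finally show "(\<Sum>s<n. infsum f (R s)) \<le> B" .
qed

lemma sum_indicator_filter: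
  assumes "finite I" "\<And>i. i \<in> I \<Longrightarrow> 0 \<le> w i"
  shows "(\<Sum>i\<in>I. ennreal (w i) * indicator (D i) z) = ennreal (\<Sum>i\<in>{i\<in>I. z \<in> D i}. w i)"
proof -
  have "(\<Sum>i\<in>I. ennreal (w i) * indicator (D i) z) = (\<Sum>i\<in>I. if z \<in> D i then ennreal (w i) else 0)"
    by (intro sum.cong) (auto simp: indicator_def)
  also have "\<dots> = (\<Sum>i\<in>{i\<in>I. z \<in> D i}. ennreal (w i))"
    by (rule sum.inter_filter[OF assms(1), symmetric])
  also have "\<dots> = ennreal (\<Sum>i\<in>{i\<in>I. z \<in> D i}. w i)"
    using assms(2) by (intro sum_ennreal) auto
  finally show ?thesis .
qed

text \<open>
  The bound for families of sets of which those containing \<open>z\<close> belong to cubes of a single level: there are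
  boundedly many of them, all neighbours of the cube of that level at \<open>z\<close>.
\<close>

lemma level_weight_sum:
  fixes \<gamma> :: "(real^'n) \<times> real \<Rightarrow> real"
  assumes clock: "dyadic_clock (\<lambda>\<alpha>. ln (weight_mean \<gamma> \<alpha>)) d N" and pos: "\<And>\<alpha>. 0 < weight_mean \<gamma> \<alpha>"
    and fin: "finite I" and good: "good_point C \<gamma> z" and C: "0 \<le> C" and c: "c \<le> 2"
    and D: "\<And>\<alpha>. \<alpha> \<in> I \<Longrightarrow> z \<in> D \<alpha> \<Longrightarrow> fst \<alpha> = k \<and> fst z \<in> dilate c \<alpha> \<and> 0 < snd z \<and> snd z < 1 / 2 ^ k"
  shows "(\<Sum>\<alpha>\<in>I. ennreal (weight_mean \<gamma> \<alpha>) * indicator (D \<alpha>) z) \<le>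
    ennreal (\<gamma> z) * ennreal (nbr_count TYPE('n) * exp d * C)"
proof -
  interpret dyadic_clock "\<lambda>\<alpha>. ln (weight_mean \<gamma> \<alpha>)" d N by (rule clock)
  define J where "J = {\<alpha>\<in>I. z \<in> D \<alpha>}"
  have "(\<Sum>\<alpha>\<in>J. weight_mean \<gamma> \<alpha>) \<le> \<gamma> z * (nbr_count TYPE('n) * exp d * C)"
  proof (cases "J = {}")
    case True
    then show ?thesis using C good by (simp add: good_point_def)
  next
    case False
    then obtain \<beta> where "\<beta> \<in> I" "z \<in> D \<beta>" by (auto simp: J_def)
    then have t: "0 < snd z" "snd z < 1 / 2 ^ k" using D by blast+
    have cub: "weight_mean \<gamma> (cube_at k (fst z)) \<le> C * \<gamma> z"
      using good t unfolding good_point_def by blast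
    have each: "weight_mean \<gamma> \<alpha> \<le> exp d * (C * \<gamma> z)" if "\<alpha> \<in> J" for \<alpha>
    proof -
      have "fst \<alpha> = k" "fst z \<in> dilate c \<alpha>" using D that unfolding J_def by blast+
      then have "nbr \<alpha> (cube_at k (fst z))" using dilate_nbr_cube_at c by metis
      then have "exp (ln (weight_mean \<gamma> \<alpha>)) \<le> exp (ln (weight_mean \<gamma> (cube_at k (fst z))) + d)"
        using v_nbr by simp
      then have "weight_mean \<gamma> \<alpha> \<le> exp d * weight_mean \<gamma> (cube_at k (fst z))"
        using pos by (simp add: exp_add mult.commute)
      also have "\<dots> \<le> exp d * (C * \<gamma> z)" using cub by (intro mult_left_mono) auto
      finally show ?thesis .
    qed
    have nn: "0 \<le> exp d * (C * \<gamma> z)" using cub pos[of "cube_at k (fst z)"] by simp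
    have "J \<subseteq> {\<alpha>. fst \<alpha> = k \<and> fst z \<in> dilate c \<alpha>}" using D unfolding J_def by blast
    from card_mono[OF dilate_level_card(1)[OF c] this] dilate_level_card(2)[OF c, of k "fst z"]
    have cardJ: "card J \<le> nbr_count TYPE('n)" by linarith
    have "(\<Sum>\<alpha>\<in>J. weight_mean \<gamma> \<alpha>) \<le> card J * (exp d * (C * \<gamma> z))"
      by (rule sum_bounded_above) (rule each)
    also have "\<dots> \<le> nbr_count TYPE('n) * (exp d * (C * \<gamma> z))"
      using cardJ nn by (intro mult_right_mono) auto
    finally show ?thesis by (simp add: mult_ac)
  qed
  then have "ennreal (\<Sum>\<alpha>\<in>J. weight_mean \<gamma> \<alpha>) \<le> ennreal (\<gamma> z * (nbr_count TYPE('n) * exp d * C))"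
    by (rule ennreal_leI)
  also have "\<dots> = ennreal (\<gamma> z) * ennreal (nbr_count TYPE('n) * exp d * C)"
    using good unfolding good_point_def by (intro ennreal_mult') simp
  finally show ?thesis
    unfolding J_def using pos by (subst sum_indicator_filter[OF fin]) (auto intro: less_imp_le)
qed

text \<open>
  The bound for the columns of tiles. With \<open>K\<close> the largest level that occurs at \<open>z\<close>, the height of \<open>z\<close> is
  less than \<open>2^(- K)\<close>, so that \<open>z\<close> lies in the weight cube of level \<open>K\<close> and its weight mean is at most
  \<open>C * \<gamma> z\<close>.
\<close>

lemma clock_weight_sum:
  fixes \<gamma> :: "(real^'n) \<times> real \<Rightarrow> real"
  assumes clock: "dyadic_clock (\<lambda>\<alpha>. ln (weight_mean \<gamma> \<alpha>)) d (scale_count l)"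
    and l: "strict_mono l" "l 0 = 0" and pos: "\<And>\<alpha>. 0 < weight_mean \<gamma> \<alpha>"
    and fin: "finite I" and I: "I \<subseteq> (\<Union>s. dyadic_clock.tiles (\<lambda>\<alpha>. ln (weight_mean \<gamma> \<alpha>)) d (scale_count l) s)"
    and good: "good_point C \<gamma> z" and c: "1 \<le> c" "c \<le> 2" and C: "0 \<le> C"
  shows "(\<Sum>\<alpha>\<in>I. ennreal (weight_mean \<gamma> \<alpha>) * indicator (dilate c \<alpha> \<times> {0<..<side \<alpha>}) z) \<le>
    ennreal (\<gamma> z) * (ennreal (6 * nbr_count TYPE('n) * exp (9 * d) * C) *
      (1 + (\<Sum>j. indicator {z. snd z < 1 / 2 ^ l (Suc j)} z)))"
proof -
  interpret dyadic_clock "\<lambda>\<alpha>. ln (weight_mean \<gamma> \<alpha>)" d "scale_count l" by (rule clock)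
  define J where "J = {\<alpha>\<in>I. z \<in> dilate c \<alpha> \<times> {0<..<side \<alpha>}}"
  define M where "M = 6 * nbr_count TYPE('n) * exp (9 * d) * C"
  have M0: "0 \<le> M" using C by (simp add: M_def)
  have \<gamma>0: "0 < \<gamma> z" using good by (simp add: good_point_def)
  have "ennreal (\<Sum>\<alpha>\<in>J. weight_mean \<gamma> \<alpha>) \<le> ennreal (\<gamma> z) * (ennreal M *
      (1 + (\<Sum>j. indicator {z. snd z < 1 / 2 ^ l (Suc j)} z)))"
  proof (cases "J = {}")
    case False
    have finJ: "finite J" using fin by (simp add: J_def)
    define K where "K = Max (fst ` J)"
    have "K \<in> fst ` J" unfolding K_def using finJ False by (intro Max_in) auto
    then obtain \<beta> where \<beta>: "\<beta> \<in> J" "fst \<beta> = K" by blast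
    then have t: "0 < snd z" "snd z < 1 / 2 ^ K" by (auto simp: J_def side_def)
    have cub: "weight_mean \<gamma> (cube_at K (fst z)) \<le> C * \<gamma> z"
      using good t unfolding good_point_def by blast
    define B where "B = {\<alpha> \<in> (\<Union>s. tiles s). fst \<alpha> \<le> K \<and> fst z \<in> dilate c \<alpha>}"
    have "fst \<alpha> \<le> K" if "\<alpha> \<in> J" for \<alpha> unfolding K_def using finJ that by (intro Max_ge) auto
    then have JB: "J \<subseteq> B" using I unfolding J_def B_def by auto
    have w: "weight_mean \<gamma> \<alpha> = exp (ln (weight_mean \<gamma> \<alpha>))" for \<alpha> using pos by simp
    have "(\<Sum>\<alpha>\<in>J. weight_mean \<gamma> \<alpha>) \<le> (\<Sum>\<alpha>\<in>B. weight_mean \<gamma> \<alpha>)"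
      using clock_sum_bound(1)[OF c, of K "fst z"] JB pos unfolding B_def
      by (intro sum_mono2) (auto intro: less_imp_le)
    also have "\<dots> = (\<Sum>\<alpha>\<in>B. exp (ln (weight_mean \<gamma> \<alpha>)))" by (intro sum.cong refl w)
    also have "\<dots> \<le> 6 * nbr_count TYPE('n) * exp (9 * d) * (scale_count l K + 1) * exp (ln (weight_mean \<gamma> (cube_at K (fst z))))"
      unfolding B_def by (rule clock_sum_bound(2)[OF c])
    also have "\<dots> \<le> 6 * nbr_count TYPE('n) * exp (9 * d) * (scale_count l K + 1) * (C * \<gamma> z)"
      using cub unfolding w[symmetric] by (intro mult_left_mono) auto
    also have "\<dots> = \<gamma> z * (M * (1 + scale_count l K))" by (simp add: M_def mult_ac add.commute)
    finally have "ennreal (\<Sum>\<alpha>\<in>J. weight_mean \<gamma> \<alpha>) \<le> ennreal (\<gamma> z * (M * (1 + scale_count l K)))"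
      by (rule ennreal_leI)
    also have "\<dots> = ennreal (\<gamma> z) * (ennreal M * (1 + of_nat (scale_count l K)))"
      using M0 \<gamma>0 by (simp add: ennreal_mult ennreal_of_nat_eq_real_of_nat)
    also have "\<dots> \<le> ennreal (\<gamma> z) * (ennreal M * (1 + (\<Sum>j. indicator {z. snd z < 1 / 2 ^ l (Suc j)} z)))"
      using scale_count_le_suminf[OF l t(2)]
      by (intro mult_left_mono add_left_mono) (auto simp: indicator_def)
    finally show ?thesis .
  qed simp
  then show ?thesis
    unfolding J_def M_def using pos by (subst sum_indicator_filter[OF fin]) (auto intro: less_imp_le)
qed

lemma dilate_cube: "dilate c \<alpha> = open_cube (fst (weight_centre \<alpha>)) (c * side \<alpha>)"
  by (simp add: dilate_def weight_centre_def)

lemma dilate_layer_borel: "dilate c \<alpha> \<times> {s<..<(t::real)} \<in> sets borel"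
  unfolding dilate_def open_cube_def by (intro borel_open open_Times open_box open_greaterThanLessThan)

text \<open>
  The left side of the estimate, where \<open>R s\<close> is a set of indices from the tiling number \<open>s + 1\<close>.
\<close>

definition trace_sum ::
  "real \<Rightarrow> ((real^'n) \<times> real \<Rightarrow> real) \<Rightarrow> (real^'n \<Rightarrow> real) \<Rightarrow> (nat \<Rightarrow> 'n::finite idx set) \<Rightarrow> ennreal"
where
  "trace_sum lam \<gamma> \<phi> R =
    (\<Sum>\<^sub>\<infinity>m\<in>UNIV. ennreal (weight_mean \<gamma> (0, m)) * L1_norm (dyadic (0, m)) \<phi>) +
    (\<Sum>s. \<Sum>\<^sub>\<infinity>\<alpha>\<in>R s. ennreal (weight_mean \<gamma> \<alpha>) *
       L1_norm (dilate (1 + lam) \<alpha>) (\<lambda>x. mean (dilate (1 + lam) \<alpha>) \<phi> - \<phi> x))"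

text \<open>
  \<open>K1\<close> is the constant of \<open>level_weight_sum\<close>, used for the layers, and \<open>K2\<close> that of \<open>clock_weight_sum\<close>, used
  for the columns. The scales of the clock are
  adapted to the vertical derivative of \<open>f\<close>.
\<close>

lemma tilings_for_function:
  fixes \<gamma> f :: "(real^'n) \<times> real \<Rightarrow> real"
  assumes A1: "A1_loc C \<gamma>" and f: "f \<in> W11 \<gamma>" and tr: "is_trace f \<phi>" and lam: "0 < lam" "lam \<le> 1"
  defines "d \<equiv> ln ((C * 2 ^ (CARD('n) + 1))\<^sup>2)"
  defines "K1 \<equiv> nbr_count TYPE('n) * exp d * C" and "K2 \<equiv> 6 * nbr_count TYPE('n) * exp (9 * d) * C"
  shows "\<exists>A. admissible lam (exp (3 * d)) (exp (13 * d)) \<gamma> A \<and>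
    (\<forall>R. (\<forall>s. R s \<subseteq> A (Suc s)) \<longrightarrow>
      trace_sum lam \<gamma> \<phi> R \<le> ennreal (2 * K1 + 4 * K2 + 16 * 2 ^ CARD('n) * K1) * W11_norm \<gamma> f)"
proof -
  let ?U = "upper_half :: ((real^'n) \<times> real) set"
  define g where "g b = weak_deriv ?U b f" for b
  have f_loc: "locally_L1 ?U f" and finW: "W11_norm \<gamma> f < \<infinity>" using f unfolding W11_def by blast+
  have g: "is_weak_deriv ?U b f (g b)" if "b \<in> Basis" for b
  proof -
    have "\<exists>h. is_weak_deriv ?U b f h" using f that unfolding W11_def by blast
    then show ?thesis unfolding g_def weak_deriv_def by (rule someI_ex)
  qed
  have g_loc: "locally_L1 ?U (g b)" if "b \<in> Basis" for b
    using g[OF that] by (simp add: is_weak_deriv_def)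
  have e1: "(0, 1) \<in> (Basis :: ((real^'n) \<times> real) set)" by (simp add: Basis_prod_def)
  have weight: "weight \<gamma>" and C: "1 \<le> C" using A1 by (auto simp: A1_loc_def)
  have pos: "0 < weight_mean \<gamma> \<alpha>" for \<alpha> by (rule weight_mean_pos[OF weight])
  have K: "0 \<le> K1" "0 \<le> K2" using C by (auto simp: K1_def K2_def)
  define c where "c = 1 + lam"
  have c: "1 \<le> c" "c \<le> 2" using lam by (auto simp: c_def)
  have good: "AE z in lebesgue. good_point C \<gamma> z"
    by (rule A1_good_points[OF A1])
  define T where "T h = L1_norm ?U (\<lambda>z. \<gamma> z * h z)" for h
  have W: "W11_norm \<gamma> f = T f + (\<Sum>b\<in>Basis. T (g b))" by (simp add: W11_norm_def T_def g_def)
  have Te1: "T (g (0, 1)) \<le> (\<Sum>b\<in>Basis. T (g b))" by (rule member_le_sum[OF e1]) auto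
  define H where "H h z = ennreal \<bar>\<gamma> z * h z\<bar> * indicator ?U z" for h z
  have T_H: "T h = (\<integral>\<^sup>+z. H h z \<partial>lebesgue)" for h by (simp add: T_def L1_norm_def H_def)
  have H_meas: "H h \<in> borel_measurable lebesgue" if "locally_L1 ?U h" for h
  proof -
    have "\<gamma> \<in> borel_measurable lebesgue"
      using locally_L1_measurable[OF open_UNIV, of \<gamma>] weight by (simp add: weight_def)
    then have "(\<lambda>z. ennreal \<bar>\<gamma> z * (indicator ?U z * h z)\<bar>) \<in> borel_measurable lebesgue"
      using locally_L1_measurable[OF upper_half_open that] by measurable
    moreover have "H h z = ennreal \<bar>\<gamma> z * (indicator ?U z * h z)\<bar>" for z
      by (simp add: H_def indicator_def)
    ultimately show ?thesis by (simp add: fun_eq_iff[symmetric, of "H h"] cong: measurable_cong)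
  qed
  have "(\<integral>\<^sup>+z. H (g (0, 1)) z \<partial>lebesgue) \<le> W11_norm \<gamma> f"
    unfolding T_H[symmetric] W using Te1 by (rule add_increasing[OF zero_le])
  then have finH: "(\<integral>\<^sup>+z. H (g (0, 1)) z \<partial>lebesgue) < \<infinity>" using finW by (rule le_less_trans)
  obtain l where l: "strict_mono l" "l 0 = 0"
    and tail: "\<And>j. (\<integral>\<^sup>+z. H (g (0, 1)) z * indicator {z. snd z < 1 / 2 ^ l (Suc j)} z \<partial>lebesgue)
      \<le> ennreal ((1/2) ^ Suc j) * (\<integral>\<^sup>+z. H (g (0, 1)) z \<partial>lebesgue)"
    by (rule vanishing_tails[OF H_meas[OF g_loc[OF e1]] finH])
      (auto simp: H_def upper_half_def indicator_def)
  have clock: "dyadic_clock (\<lambda>\<alpha>. ln (weight_mean \<gamma> \<alpha>)) d (scale_count l)"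
    unfolding d_def by (rule A1_dyadic_clock[OF A1 l])
  interpret dyadic_clock "\<lambda>\<alpha>. ln (weight_mean \<gamma> \<alpha>)" d "scale_count l" by (rule clock)
  have adm: "admissible lam (exp (3 * d)) (exp (13 * d)) \<gamma> tiles"
    by (rule admissible_tiles[OF lam l scale_count(5)[OF l] pos]) auto

  have const_int: "(\<integral>\<^sup>+z\<in>?U. ennreal \<bar>\<gamma> z * h z\<bar> * ennreal k \<partial>lebesgue) = ennreal k * T h"
    if "locally_L1 ?U h" for h k
  proof -
    have "(\<integral>\<^sup>+z\<in>?U. ennreal \<bar>\<gamma> z * h z\<bar> * ennreal k \<partial>lebesgue) = (\<integral>\<^sup>+z. ennreal k * H h z \<partial>lebesgue)"
      by (intro nn_integral_cong) (simp add: H_def mult_ac)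
    then show ?thesis using H_meas[OF that] by (simp add: nn_integral_cmult T_H)
  qed
  have level: "(\<Sum>\<alpha>\<in>I. ennreal (weight_mean \<gamma> \<alpha>) * L1_norm (D \<alpha>) h) \<le> ennreal K1 * T h"
    if "finite I" "locally_L1 ?U h" "\<And>\<alpha>. \<alpha> \<in> I \<Longrightarrow> D \<alpha> \<in> sets borel \<and> D \<alpha> \<subseteq> ?U"
      and D: "\<And>z. \<exists>k. \<forall>\<alpha>\<in>I. z \<in> D \<alpha> \<longrightarrow> fst \<alpha> = k \<and> fst z \<in> dilate c \<alpha> \<and> 0 < snd z \<and> snd z < 1 / 2 ^ k"
    for I and D :: "'n idx \<Rightarrow> ((real^'n) \<times> real) set" and h
  proof -
    have "(\<Sum>\<alpha>\<in>I. ennreal (weight_mean \<gamma> \<alpha>) * L1_norm (D \<alpha>) h)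
        \<le> (\<integral>\<^sup>+z\<in>?U. ennreal \<bar>\<gamma> z * h z\<bar> * ennreal K1 \<partial>lebesgue)"
    proof (rule weighted_sum_le[OF that(1) upper_half_open that(2,3)])
      show "AE z in lebesgue. z \<in> ?U \<longrightarrow>
          (\<Sum>\<alpha>\<in>I. ennreal (weight_mean \<gamma> \<alpha>) * indicator (D \<alpha>) z) \<le> ennreal (\<gamma> z) * ennreal K1"
      proof (use good in eventually_elim, rule impI)
        fix z assume z: "good_point C \<gamma> z"
        obtain k where k: "\<forall>\<alpha>\<in>I. z \<in> D \<alpha> \<longrightarrow> fst \<alpha> = k \<and> fst z \<in> dilate c \<alpha> \<and> 0 < snd z \<and> snd z < 1 / 2 ^ k"
          using D by blast
        show "(\<Sum>\<alpha>\<in>I. ennreal (weight_mean \<gamma> \<alpha>) * indicator (D \<alpha>) z) \<le> ennreal (\<gamma> z) * ennreal K1"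
          unfolding K1_def using k using C by (intro level_weight_sum[OF clock pos that(1) z _ c(2), of D k]) (simp, blast)
      qed
    qed
    then show ?thesis using const_int[OF that(2)] by simp
  qed

  have first: "(\<Sum>\<^sub>\<infinity>m\<in>UNIV. ennreal (weight_mean \<gamma> (0, m)) * L1_norm (dyadic (0, m)) \<phi>)
      \<le> ennreal (2 * K1) * W11_norm \<gamma> f"
  proof (rule infsum_le_finite_sums[OF nonneg_summable_on_complete[OF zero_le]])
    fix M :: "(int^'n) set" assume M: "finite M"
    define I where "I = Pair (0::nat) ` M"
    define D where "D \<alpha> = dyadic \<alpha> \<times> {0<..<1::real}" for \<alpha> :: "'n idx"
    have finI: "finite I" using M by (simp add: I_def)
    have I0: "fst \<alpha> = 0" if "\<alpha> \<in> I" for \<alpha> using that by (auto simp: I_def)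
    have size: "L1_norm (dyadic \<alpha>) \<phi> \<le> L1_norm (D \<alpha>) (g (0, 1)) + 2 * L1_norm (D \<alpha>) f" if "\<alpha> \<in> I" for \<alpha>
    proof -
      have dy: "dyadic \<alpha> = open_cube (fst (weight_centre \<alpha>)) 1"
        using I0[OF that] dilate_cube[of 1 \<alpha>] by (simp add: dilate_1 side_def)
      have half: "2 * ennreal (1 / 2) = 1"
        by (subst ennreal_numeral[symmetric], subst ennreal_mult[symmetric]) auto
      have "2 * (ennreal (1 / 2) * L1_norm (dyadic \<alpha>) \<phi>) \<le> 2 * (ennreal (1 / 2) * L1_norm (D \<alpha>) (g (0, 1)) + L1_norm (D \<alpha>) f)"
        unfolding D_def dy
        by (intro mult_left_mono half_space_estimates(2)[OF f_loc g tr]) auto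
      then show ?thesis by (simp only: distrib_left mult.assoc[symmetric] half mult_1)
    qed
    have D: "D \<alpha> \<in> sets borel \<and> D \<alpha> \<subseteq> ?U" for \<alpha>
      using dilate_layer_borel[of 1 \<alpha> 0 1] by (auto simp: D_def dilate_1 upper_half_def)
    have lev: "\<exists>k. \<forall>\<alpha>\<in>I. z \<in> D \<alpha> \<longrightarrow> fst \<alpha> = k \<and> fst z \<in> dilate c \<alpha> \<and> 0 < snd z \<and> snd z < 1 / 2 ^ k" for z
      using I0 dyadic_subset_dilate[OF c(1)] by (intro exI[of _ 0]) (fastforce simp: D_def)
    have "(\<Sum>m\<in>M. ennreal (weight_mean \<gamma> (0, m)) * L1_norm (dyadic (0, m)) \<phi>)
        = (\<Sum>\<alpha>\<in>I. ennreal (weight_mean \<gamma> \<alpha>) * L1_norm (dyadic \<alpha>) \<phi>)"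
      unfolding I_def by (subst sum.reindex) (auto simp: inj_on_def)
    also have "\<dots> \<le> (\<Sum>\<alpha>\<in>I. ennreal (weight_mean \<gamma> \<alpha>) * (L1_norm (D \<alpha>) (g (0, 1)) + 2 * L1_norm (D \<alpha>) f))"
      using size by (intro sum_mono mult_left_mono) auto
    also have "\<dots> = (\<Sum>\<alpha>\<in>I. ennreal (weight_mean \<gamma> \<alpha>) * L1_norm (D \<alpha>) (g (0, 1))) +
        2 * (\<Sum>\<alpha>\<in>I. ennreal (weight_mean \<gamma> \<alpha>) * L1_norm (D \<alpha>) f)"
      by (simp add: distrib_left sum.distrib sum_distrib_left mult_ac)
    also have "\<dots> \<le> ennreal K1 * T (g (0, 1)) + 2 * (ennreal K1 * T f)"
      by (intro add_mono mult_left_mono level[OF finI _ D lev] g_loc e1 f_loc) auto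
    also have "\<dots> \<le> ennreal K1 * (\<Sum>b\<in>Basis. T (g b)) + ennreal K1 * (\<Sum>b\<in>Basis. T (g b)) + 2 * (ennreal K1 * T f)"
      using mult_left_mono[OF Te1, of "ennreal K1"] by (intro add_right_mono add_increasing2) auto
    also have "\<dots> = ennreal (2 * K1) * W11_norm \<gamma> f"
    proof -
      have "ennreal (2 * K1) = 2 * ennreal K1" using K by (simp add: ennreal_mult)
      then show ?thesis unfolding W by (simp only: distrib_left mult_2 distrib_right add_ac)
    qed
    finally show "(\<Sum>m\<in>M. ennreal (weight_mean \<gamma> (0, m)) * L1_norm (dyadic (0, m)) \<phi>) \<le> ennreal (2 * K1) * W11_norm \<gamma> f" .
  qed

  have second: "(\<Sum>s. \<Sum>\<^sub>\<infinity>\<alpha>\<in>R s. ennreal (weight_mean \<gamma> \<alpha>) *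
         L1_norm (dilate c \<alpha>) (\<lambda>x. mean (dilate c \<alpha>) \<phi> - \<phi> x))
      \<le> ennreal (4 * K2) * W11_norm \<gamma> f + ennreal (16 * 2 ^ CARD('n) * K1) * W11_norm \<gamma> f"
    if R: "\<And>s. R s \<subseteq> tiles (Suc s)" for R
  proof (rule suminf_infsum_le)
    show "R s \<inter> R s' = {}" if "s \<noteq> s'" for s s'
      using R[of s] R[of s'] tiles_disjoint that by blast
    fix I assume finI: "finite I" and "I \<subseteq> (\<Union>s. R s)"
    then have I: "I \<subseteq> (\<Union>s. tiles s)" using R by blast
    define D where "D \<alpha> = dilate c \<alpha> \<times> {0<..<side \<alpha>}" for \<alpha> :: "'n idx"
    define L where "L \<alpha> = dilate c \<alpha> \<times> {side \<alpha> / 2<..<side \<alpha>}" for \<alpha> :: "'n idx"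
    define e where "e = ennreal (16 * 2 ^ CARD('n))"
    have osc: "L1_norm (dilate c \<alpha>) (\<lambda>x. mean (dilate c \<alpha>) \<phi> - \<phi> x) \<le>
        2 * L1_norm (D \<alpha>) (g (0, 1)) + e * (\<Sum>b\<in>Basis. L1_norm (L \<alpha>) (g b))" for \<alpha>
      unfolding D_def L_def e_def dilate_cube using c side_bounds[of \<alpha>]
      by (intro half_space_estimates(1)[OF f_loc g tr]) auto
    have D: "D \<alpha> \<in> sets borel \<and> D \<alpha> \<subseteq> ?U" for \<alpha>
      using dilate_layer_borel[of c \<alpha> 0 "side \<alpha>"] by (auto simp: D_def upper_half_def)
    have L: "L \<alpha> \<in> sets borel \<and> L \<alpha> \<subseteq> ?U" for \<alpha>
      using dilate_layer_borel[of c \<alpha> "side \<alpha> / 2" "side \<alpha>"] side_bounds(1)[of \<alpha>] by (auto simp: L_def upper_half_def)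
    have lev: "\<exists>k. \<forall>\<alpha>\<in>I. z \<in> L \<alpha> \<longrightarrow> fst \<alpha> = k \<and> fst z \<in> dilate c \<alpha> \<and> 0 < snd z \<and> snd z < 1 / 2 ^ k" for z
    proof (cases "\<exists>\<alpha>\<in>I. z \<in> L \<alpha>")
      case True
      then obtain \<beta> where \<beta>: "z \<in> L \<beta>" by blast
      have same: "fst \<alpha> = fst \<beta>" if "z \<in> L \<alpha>" for \<alpha>
      proof -
        have "\<not> fst p < fst q" if "z \<in> L p" "z \<in> L q" for p q
        proof
          assume "fst p < fst q"
          then have "(2::real) ^ Suc (fst p) \<le> 2 ^ fst q" by (intro power_increasing) auto
          then have "side q \<le> side p / 2" unfolding side_def by (simp add: field_simps)
          then show False using that by (auto simp: L_def)
        qed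
        then show ?thesis using \<beta> that by (meson linorder_neqE_nat)
      qed
      show ?thesis
      proof (intro exI[of _ "fst \<beta>"] ballI impI)
        fix \<alpha> assume z: "z \<in> L \<alpha>"
        have k: "fst \<alpha> = fst \<beta>" using z by (rule same)
        have "fst z \<in> dilate c \<alpha>" "side \<alpha> / 2 < snd z" "snd z < side \<alpha>"
          using z by (auto simp: L_def)
        moreover have "side \<alpha> = 1 / 2 ^ fst \<beta>" by (simp add: side_def k)
        moreover have "0 < side \<alpha> / 2" using side_bounds(1)[of \<alpha>] by simp
        ultimately show "fst \<alpha> = fst \<beta> \<and> fst z \<in> dilate c \<alpha> \<and> 0 < snd z \<and> snd z < 1 / 2 ^ fst \<beta>"
          using k by (metis less_trans)
      qed
    qed blast
    define u where "u = (\<lambda>z :: (real^'n) \<times> real. 1 + (\<Sum>j. indicator {z. snd z < 1 / 2 ^ l (Suc j)} z) :: ennreal)"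
    have part1: "(\<Sum>\<alpha>\<in>I. ennreal (weight_mean \<gamma> \<alpha>) * L1_norm (D \<alpha>) (g (0, 1))) \<le> ennreal K2 * (2 * T (g (0, 1)))"
    proof -
      note lower_strip_sets[measurable]
      note [measurable] = H_meas[OF g_loc[OF e1]]
      have "(\<Sum>\<alpha>\<in>I. ennreal (weight_mean \<gamma> \<alpha>) * L1_norm (D \<alpha>) (g (0, 1)))
          \<le> (\<integral>\<^sup>+z\<in>?U. ennreal \<bar>\<gamma> z * g (0, 1) z\<bar> * (ennreal K2 * u z) \<partial>lebesgue)"
      proof (rule weighted_sum_le[OF finI upper_half_open g_loc[OF e1] D])
        show "AE z in lebesgue. z \<in> ?U \<longrightarrow>
            (\<Sum>\<alpha>\<in>I. ennreal (weight_mean \<gamma> \<alpha>) * indicator (D \<alpha>) z) \<le> ennreal (\<gamma> z) * (ennreal K2 * u z)"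
        proof (use good in eventually_elim, rule impI)
          fix z assume z: "good_point C \<gamma> z"
          show "(\<Sum>\<alpha>\<in>I. ennreal (weight_mean \<gamma> \<alpha>) * indicator (D \<alpha>) z) \<le> ennreal (\<gamma> z) * (ennreal K2 * u z)"
            unfolding D_def K2_def u_def using C
            by (intro clock_weight_sum[OF clock l pos finI I z c]) simp
        qed
      qed
      also have "\<dots> = (\<integral>\<^sup>+z. ennreal K2 * (H (g (0, 1)) z + (\<Sum>j. H (g (0, 1)) z * indicator {z. snd z < 1 / 2 ^ l (Suc j)} z)) \<partial>lebesgue)"
        by (intro nn_integral_cong) (simp add: H_def u_def distrib_left mult_ac flip: ennreal_suminf_cmult)
      also have "\<dots> = ennreal K2 * (T (g (0, 1)) + (\<Sum>j. \<integral>\<^sup>+z. H (g (0, 1)) z * indicator {z. snd z < 1 / 2 ^ l (Suc j)} z \<partial>lebesgue))"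
        unfolding T_H by (subst nn_integral_cmult, measurable, subst nn_integral_add, measurable,
            subst nn_integral_suminf, measurable)
      also have "\<dots> \<le> ennreal K2 * (T (g (0, 1)) + (\<Sum>j. ennreal ((1/2) ^ Suc j) * T (g (0, 1))))"
        using tail unfolding T_H[symmetric] by (intro mult_left_mono add_left_mono suminf_le) auto
      also have "(\<Sum>j. ennreal ((1/2) ^ Suc j) * T (g (0, 1))) = T (g (0, 1))"
      proof -
        have "(\<Sum>j. ennreal ((1/2) ^ Suc j)) = ennreal 1"
          by (rule suminf_ennreal_eq[OF _ power_half_series]) simp
        then show ?thesis by (simp only: ennreal_suminf_multc ennreal_1 mult_1)
      qed
      finally show ?thesis by (simp add: mult_2)
    qed
    have part2: "(\<Sum>b\<in>Basis. \<Sum>\<alpha>\<in>I. ennreal (weight_mean \<gamma> \<alpha>) * L1_norm (L \<alpha>) (g b)) \<le> (\<Sum>b\<in>Basis. ennreal K1 * T (g b))"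
      by (intro sum_mono level[OF finI g_loc L lev])
    have "(\<Sum>\<alpha>\<in>I. ennreal (weight_mean \<gamma> \<alpha>) * L1_norm (dilate c \<alpha>) (\<lambda>x. mean (dilate c \<alpha>) \<phi> - \<phi> x))
        \<le> (\<Sum>\<alpha>\<in>I. ennreal (weight_mean \<gamma> \<alpha>) * (2 * L1_norm (D \<alpha>) (g (0, 1)) + e * (\<Sum>b\<in>Basis. L1_norm (L \<alpha>) (g b))))"
      by (intro sum_mono mult_left_mono osc) auto
    also have "\<dots> = 2 * (\<Sum>\<alpha>\<in>I. ennreal (weight_mean \<gamma> \<alpha>) * L1_norm (D \<alpha>) (g (0, 1))) +
        e * (\<Sum>\<alpha>\<in>I. \<Sum>b\<in>Basis. ennreal (weight_mean \<gamma> \<alpha>) * L1_norm (L \<alpha>) (g b))"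
      by (simp add: distrib_left sum.distrib sum_distrib_left mult_ac)
    also have "\<dots> \<le> 2 * (ennreal K2 * (2 * T (g (0, 1)))) + e * (\<Sum>b\<in>Basis. ennreal K1 * T (g b))"
      using part1 part2 by (subst sum.swap) (intro add_mono mult_left_mono; simp)
    also have "\<dots> \<le> 2 * (ennreal K2 * (2 * W11_norm \<gamma> f)) + e * (ennreal K1 * W11_norm \<gamma> f)"
      unfolding sum_distrib_left[symmetric] W using Te1
      by (intro add_mono mult_left_mono add_increasing[OF zero_le]) auto
    also have "\<dots> = ennreal (4 * K2) * W11_norm \<gamma> f + ennreal (16 * 2 ^ CARD('n) * K1) * W11_norm \<gamma> f"
    proof -
      have "ennreal (4 * K2) = 2 * (ennreal K2 * 2)" using K by (simp add: ennreal_mult mult_ac)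
      moreover have "ennreal (16 * 2 ^ CARD('n) * K1) = e * ennreal K1"
        unfolding e_def using K by (intro ennreal_mult) auto
      ultimately show ?thesis by (simp only: mult.assoc)
    qed
    finally show "(\<Sum>\<alpha>\<in>I. ennreal (weight_mean \<gamma> \<alpha>) * L1_norm (dilate c \<alpha>) (\<lambda>x. mean (dilate c \<alpha>) \<phi> - \<phi> x))
        \<le> ennreal (4 * K2) * W11_norm \<gamma> f + ennreal (16 * 2 ^ CARD('n) * K1) * W11_norm \<gamma> f" .
  qed

  have total: "ennreal (2 * K1 + 4 * K2 + 16 * 2 ^ CARD('n) * K1) * W11_norm \<gamma> f =
      ennreal (2 * K1) * W11_norm \<gamma> f + (ennreal (4 * K2) * W11_norm \<gamma> f + ennreal (16 * 2 ^ CARD('n) * K1) * W11_norm \<gamma> f)"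
    using K by (simp add: distrib_right add.assoc)
  show ?thesis
    using adm first second unfolding total c_def trace_sum_def by (intro exI[of _ tiles] conjI allI impI add_mono) blast+
qed

text \<open>
  The remaining indices form a subset of each tiling, and \<open>d\<close> depends only on the dimension and the A1
  constant.
\<close>

theorem theorem4p1:
  fixes C\<gamma> :: real
  assumes "1 \<le> C\<gamma>"
  shows "\<exists>c1 c2 :: real. 1 \<le> c1 \<and> 1 \<le> c2 \<and>
    (\<forall>k0 :: nat. \<forall>lam :: real. lam = 1 / 2 ^ k0 \<longrightarrow>
      (\<exists>C :: real. 0 \<le> C \<and>
        (\<forall>\<gamma> :: (real^'n) \<times> real \<Rightarrow> real. A1_loc C\<gamma> \<gamma> \<longrightarrow>
          (\<forall>f \<phi>. f \<in> W11 \<gamma> \<and> is_trace f \<phi> \<longrightarrow>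
            (\<exists>A :: nat \<Rightarrow> 'n idx set. admissible lam c1 c2 \<gamma> A \<and>
              (\<forall>e. (\<forall>s. bij_betw (e s) UNIV (A s)) \<longrightarrow>
                (\<Sum>\<^sub>\<infinity>m\<in>UNIV. ennreal (weight_mean \<gamma> (0, m)) * L1_norm (dyadic (0, m)) \<phi>) +
                (\<Sum>s. \<Sum>\<^sub>\<infinity>\<alpha>\<in>remaining lam (A (Suc s)) (e (Suc s)).
                   ennreal (weight_mean \<gamma> \<alpha>) *
                   L1_norm (dilate (1 + lam) \<alpha>)
                     (\<lambda>x. mean (dilate (1 + lam) \<alpha>) \<phi> - \<phi> x))
                \<le> ennreal C * W11_norm \<gamma> f))))))"
proof -
  define d where "d = ln ((C\<gamma> * 2 ^ (CARD('n) + 1))\<^sup>2)"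
  define K1 where "K1 = nbr_count TYPE('n) * exp d * C\<gamma>"
  define K2 where "K2 = 6 * nbr_count TYPE('n) * exp (9 * d) * C\<gamma>"
  have "1 \<le> C\<gamma> * 2 ^ (CARD('n) + 1)"
    using mult_mono[OF assms one_le_power[of 2 "CARD('n) + 1"]] assms by simp
  then have d: "0 \<le> d" unfolding d_def by (intro ln_ge_zero one_le_power)
  have K: "0 \<le> 2 * K1 + 4 * K2 + 16 * 2 ^ CARD('n) * K1"
    using assms by (simp add: K1_def K2_def)
  let ?c1 = "exp (3 * d)" and ?c2 = "exp (13 * d)" and ?C = "2 * K1 + 4 * K2 + 16 * 2 ^ CARD('n) * K1"
  have "\<exists>A :: nat \<Rightarrow> 'n idx set. admissible lam ?c1 ?c2 \<gamma> A \<and> (\<forall>e. (\<forall>s. bij_betw (e s) UNIV (A s)) \<longrightarrow>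
      trace_sum lam \<gamma> \<phi> (\<lambda>s. remaining lam (A (Suc s)) (e (Suc s))) \<le> ennreal ?C * W11_norm \<gamma> f)"
    if lam: "lam = 1 / 2 ^ k0" and A1: "A1_loc C\<gamma> \<gamma>" and f: "f \<in> W11 \<gamma> \<and> is_trace f \<phi>"
    for k0 :: nat and lam and \<gamma> f :: "(real^'n) \<times> real \<Rightarrow> real" and \<phi>
  proof -
    have lam': "0 < lam" "lam \<le> 1" using lam by auto
    obtain A where A: "admissible lam ?c1 ?c2 \<gamma> A"
      and bound: "\<And>R. (\<forall>s. R s \<subseteq> A (Suc s)) \<Longrightarrow> trace_sum lam \<gamma> \<phi> R \<le> ennreal ?C * W11_norm \<gamma> f"
      using tilings_for_function[OF A1 conjunct1[OF f] conjunct2[OF f] lam']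
      unfolding K1_def K2_def d_def by blast
    have "trace_sum lam \<gamma> \<phi> (\<lambda>s. remaining lam (A (Suc s)) (e (Suc s))) \<le> ennreal ?C * W11_norm \<gamma> f" for e
      by (rule bound) (auto simp: remaining_def)
    then show ?thesis using A by blast
  qed
  note main = this
  show ?thesis
    unfolding trace_sum_def[symmetric]
  proof (rule exI[of _ ?c1], rule exI[of _ ?c2], intro conjI allI impI)
    fix k0 :: nat and lam :: real
    assume lam: "lam = 1 / 2 ^ k0"
    show "\<exists>C\<ge>0. \<forall>\<gamma> :: (real^'n) \<times> real \<Rightarrow> real. A1_loc C\<gamma> \<gamma> \<longrightarrow> (\<forall>f \<phi>. f \<in> W11 \<gamma> \<and> is_trace f \<phi> \<longrightarrow>
        (\<exists>A :: nat \<Rightarrow> 'n idx set. admissible lam ?c1 ?c2 \<gamma> A \<and> (\<forall>e. (\<forall>s. bij_betw (e s) UNIV (A s)) \<longrightarrow>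
          trace_sum lam \<gamma> \<phi> (\<lambda>s. remaining lam (A (Suc s)) (e (Suc s))) \<le> ennreal C * W11_norm \<gamma> f)))"
      by (intro exI[of _ ?C] conjI allI impI K) (rule main[OF lam]; assumption)
  qed (use d in auto)
qed

end
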